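(* Let $G$ be a locally convex Lie group with Lie algebra $\mathfrak{g}$, let $\overline{\rho}\colon G\to\mathrm{PU}(\mathcal{H})$ be a smooth projective unitary representation, and consider the weakly Hamiltonian action of $G$ on $\mathbb{P}(\mathcal{H}^\infty)$ derived from it. Then for every $[\psi]\in\mathbb{P}(\mathcal{H}^\infty)$, $$\omega_{[\psi]}=\delta\mu_{[\psi]},$$ where $\omega_{[\psi]}$ is the Kostant–Souriau cocycle of the action at $[\psi]$ and $\mu\colon\mathbb{P}(\mathcal{H}^\infty)\to(\mathfrak{g}^\sharp)'$ is the momentum map of the $G^\sharp$-action.
   Context: Conventions: locally convex Lie groups and manifolds are modelled on Hausdorff locally convex spaces, with smoothness in the sense of Michal–Bastiani. Scalar products are antilinear in the first and linear in the second argument. Projective representation: $\mathrm{PU}(\mathcal{H})=\mathrm{U}(\mathcal{H})/\mathrm{U}(1)\mathbf{1}$ for a complex Hilbert space $\mathcal{H}$. A projective unitary representation $\overline{\rho}\colon G\to \mathrm{PU}(\mathcal{H})$ is smooth if the set $\mathbb{P}(\mathcal{H})^\infty$ of rays $[\psi]$ with smooth orbit map $G\to\mathbb{P}(\mathcal{H})$, $g\mapsto\overline{\rho}(g)[\psi]$, is dense in $\mathbb{P}(\mathcal{H})$. Set $G^\sharp=\{(g,U)\in G\times \mathrm{U}(\mathcal{H}): \overline{\rho}(g)=[U]\}$ and $\rho(g,U)=U$. It is known that $G^\sharp$ is a locally convex Lie group, that $G^\sharp\to G$ is a homomorphism of Lie groups and a principal $\mathrm{U}(1)$-bundle, that $\rho(z)=z\mathbf{1}$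 for $z\in \mathrm{U}(1)$, and that the space $\mathcal{H}^\infty$ of smooth vectors of $\rho$ is dense, with $\mathbb{P}(\mathcal{H}^\infty)=\mathbb{P}(\mathcal{H})^\infty$. The Lie algebra $\mathfrak{g}^\sharp$ of $G^\sharp$ is a central extension of $\mathfrak{g}$ by $\mathbb{R}$. The derived representation $d\rho(\xi)\psi$ is the derivative at the identity of $g\mapsto \rho(g)\psi$ in direction $\xi\in\mathfrak{g}^\sharp$. $\mathcal{H}^\infty$ carries the strong topology: the locally convex topology induced by the norm of $\mathcal{H}$ and the seminorms $p_B(\psi)=\sup_{(\xi_1,\dots,\xi_k)\in B}\|d\rho(\xi_1)\cdots d\rho(\xi_k)\psi\|$, where $k\in\mathbb{N}$ and $B\subseteq(\mathfrak{g}^\sharp)^k$ runs over the bounded sets. Symplectic form: $\mathbb{P}(\mathcal{H}^\infty)$ is a locally convex manifold with charts, for unit vectors $\psi$, $\kappa_\psi\colon\{[\chi]:\langle\psi,\chi\rangle\neq0\}\to T_{[\psi]}:=\{v\in\mathcal{H}^\infty:\langle\psi,v\rangle=0\}$, $\kappa_\psi([\chi])=\langle\psi,\chi\rangle^{-1}\chi-\psi$. Identifying tangent vectors at $[\psi]$ with elements of $T_{[\psi]}$ via the differential of $\kappa_\psi$ at $[\psi]$, $\Omega_{[\psi]}(\delta v,\delta w)=2\,\mathrm{Im}\langle\delta v,\delta w\rangle$. Kostant–Souriau cocycle: $\omega_{[\psi]}\colon\mathfrak{g}\times\mathfrak{g}\to\mathbb{R}$, $\omega_{[\psi]}(\xi,\eta)=\Omega_{[\psi]}(X_\xi,X_\eta)$,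 where $X_\xi([\psi])$ (fundamental vector field) is the derivative of $g\mapsto\overline{\rho}(g)[\psi]$ at the identity in direction $\xi$. Momentum map: $\mu_{[\psi]}(\xi)=\langle\psi,i\,d\rho(\xi)\psi\rangle/\langle\psi,\psi\rangle$ for $\xi\in\mathfrak{g}^\sharp$. Differential $\delta$: for $\lambda\in(\mathfrak{g}^\sharp)'$ (continuous dual), $\delta\lambda\colon\mathfrak{g}\times\mathfrak{g}\to\mathbb{R}$ is the 2-cocycle $(\delta\lambda)(\xi,\eta)=\lambda([\xi^\sharp,\eta^\sharp])$, where $\xi^\sharp,\eta^\sharp\in\mathfrak{g}^\sharp$ are arbitrary lifts of $\xi,\eta$ (the value is independent of the lifts). *)

theory Defs
  imports "HOL-Analysis.Analysis" "HOL-Algebra.Coset"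
begin

section \<open>Locally convex spaces and Michal--Bastiani smoothness\<close>

class locally_convex_space = real_vector + topological_ab_group_add + t2_space +
  assumes tendsto_scaleR_Pair: "LIM x (nhds a \<times>\<^sub>F nhds b). fst x *\<^sub>R snd x :> nhds (a *\<^sub>R b)"
    and locally_convex_0: "open S \<Longrightarrow> 0 \<in> S \<Longrightarrow>
      \<exists>V. open V \<and> 0 \<in> V \<and> V \<subseteq> S \<and> (\<forall>x\<in>V. \<forall>y\<in>V. \<forall>t. 0 \<le> t \<and> t \<le> 1 \<longrightarrow> (1 - t) *\<^sub>R x + t *\<^sub>R y \<in> V)"

instance real_normed_vector \<subseteq> locally_convex_space
proof
  fix a :: real and b :: 'a
  show "LIM x (nhds a \<times>\<^sub>F nhds b). fst x *\<^sub>R snd x :> nhds (a *\<^sub>R b)"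
    by (intro tendsto_scaleR filterlim_fst filterlim_snd)
next
  fix S :: "'a set" assume "open S" "0 \<in> S"
  then obtain e where e: "e > 0" "ball 0 e \<subseteq> S"
    by (auto simp: open_contains_ball)
  have "(1 - t) *\<^sub>R x + t *\<^sub>R y \<in> ball 0 e"
    if "x \<in> ball 0 e" "y \<in> ball 0 e" "0 \<le> t" "t \<le> 1" for x y :: 'a and t
    using convexD[OF convex_ball[of 0 e] that(1,2), of "1 - t" t] that by simp
  with e show "\<exists>V. open V \<and> 0 \<in> V \<and> V \<subseteq> S \<and>
      (\<forall>x\<in>V. \<forall>y\<in>V. \<forall>t. 0 \<le> t \<and> t \<le> 1 \<longrightarrow> (1 - t) *\<^sub>R x + t *\<^sub>R y \<in> V)"
    by (intro exI[of _ "ball 0 e"]) auto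
qed

instance prod :: (topological_monoid_add, topological_monoid_add) topological_monoid_add
proof
  fix a b :: "'a \<times> 'b"
  have 1: "(fst \<longlongrightarrow> a) (nhds a \<times>\<^sub>F nhds b)" "(snd \<longlongrightarrow> b) (nhds a \<times>\<^sub>F nhds b)"
    by (simp_all add: filterlim_fst filterlim_snd)
  have "((\<lambda>x. (fst (fst x) + fst (snd x), snd (fst x) + snd (snd x)))
      \<longlongrightarrow> (fst a + fst b, snd a + snd b)) (nhds a \<times>\<^sub>F nhds b)"
    by (intro tendsto_Pair tendsto_add tendsto_fst tendsto_snd 1)
  then show "LIM x (nhds a \<times>\<^sub>F nhds b). fst x + snd x :> nhds (a + b)"
    by (simp add: plus_prod_def)
qed

instance prod :: (topological_comm_monoid_add, topological_comm_monoid_add) topological_comm_monoid_add ..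

instance prod :: (topological_group_add, topological_group_add) topological_group_add
proof
  fix a :: "'a \<times> 'b"
  have "((\<lambda>x. (- fst x, - snd x)) \<longlongrightarrow> (- fst a, - snd a)) (nhds a)"
    by (intro tendsto_Pair tendsto_minus tendsto_fst tendsto_snd filterlim_ident)
  moreover have "(\<lambda>x. (- fst x, - snd x)) = (uminus :: 'a \<times> 'b \<Rightarrow> _)" "(- fst a, - snd a) = - a"
    by (simp_all add: fun_eq_iff uminus_prod_def)
  ultimately show "(uminus \<longlongrightarrow> - a) (nhds a)"
    by metis
qed

instance prod :: (topological_ab_group_add, topological_ab_group_add) topological_ab_group_add ..

instance prod :: (locally_convex_space, locally_convex_space) locally_convex_space
proof
  fix a :: real and b :: "'a \<times> 'b"
  have 1: "(fst \<longlongrightarrow> a) (nhds a \<times>\<^sub>F nhds b)" "(snd \<longlongrightarrow> b) (nhds a \<times>\<^sub>F nhds b)"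
    by (simp_all add: filterlim_fst filterlim_snd)
  have 2: "((\<lambda>x. f x *\<^sub>R g x) \<longlongrightarrow> r *\<^sub>R s) F"
    if "(f \<longlongrightarrow> r) F" "(g \<longlongrightarrow> s) F"
    for f :: "real \<times> 'a \<times> 'b \<Rightarrow> real" and g :: "_ \<Rightarrow> 'c::locally_convex_space" and r s F
    using filterlim_compose[OF tendsto_scaleR_Pair, of "\<lambda>x. (f x, g x)" r s F] that
    by (simp add: nhds_prod[symmetric] tendsto_Pair)
  have "((\<lambda>x. (fst x *\<^sub>R fst (snd x), fst x *\<^sub>R snd (snd x)))
      \<longlongrightarrow> (a *\<^sub>R fst b, a *\<^sub>R snd b)) (nhds a \<times>\<^sub>F nhds b)"
    by (intro tendsto_Pair 2 tendsto_fst tendsto_snd 1)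
  then show "LIM x (nhds a \<times>\<^sub>F nhds b). fst x *\<^sub>R snd x :> nhds (a *\<^sub>R b)"
    by (simp add: scaleR_prod_def)
next
  fix S :: "('a \<times> 'b) set" assume "open S" "0 \<in> S"
  then obtain A B where AB: "open A" "open B" "0 \<in> A" "0 \<in> B" "A \<times> B \<subseteq> S"
    by (metis open_prod_elim mem_Times_iff fst_zero snd_zero)
  obtain A' where A': "open A'" "0 \<in> A'" "A' \<subseteq> A"
    "\<forall>x\<in>A'. \<forall>y\<in>A'. \<forall>t. 0 \<le> t \<and> t \<le> 1 \<longrightarrow> (1 - t) *\<^sub>R x + t *\<^sub>R y \<in> A'"
    using locally_convex_0[OF AB(1,3)] by blast
  obtain B' where B': "open B'" "0 \<in> B'" "B' \<subseteq> B"
    "\<forall>x\<in>B'. \<forall>y\<in>B'. \<forall>t. 0 \<le> t \<and> t \<le> 1 \<longrightarrow> (1 - t) *\<^sub>R x + t *\<^sub>R y \<in> B'"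
    using locally_convex_0[OF AB(2,4)] by blast
  show "\<exists>V. open V \<and> 0 \<in> V \<and> V \<subseteq> S \<and>
      (\<forall>x\<in>V. \<forall>y\<in>V. \<forall>t. 0 \<le> t \<and> t \<le> 1 \<longrightarrow> (1 - t) *\<^sub>R x + t *\<^sub>R y \<in> V)"
    by (intro exI[of _ "A' \<times> B'"]) (use A' B' AB in \<open>auto simp: open_Times zero_prod_def\<close>)
qed

definition dir_deriv :: "('e::locally_convex_space \<Rightarrow> 'f::locally_convex_space) \<Rightarrow> 'e \<Rightarrow> 'e \<Rightarrow> 'f" where
  "dir_deriv f x v = Lim (at 0) (\<lambda>t::real. (1 / t) *\<^sub>R (f (x + t *\<^sub>R v) - f x))"

definition dir_differentiable :: "('e::locally_convex_space \<Rightarrow> 'f::locally_convex_space) \<Rightarrow> 'e \<Rightarrow> 'e \<Rightarrow> bool" where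
  "dir_differentiable f x v \<longleftrightarrow>
    (\<exists>l. ((\<lambda>t::real. (1 / t) *\<^sub>R (f (x + t *\<^sub>R v) - f x)) \<longlongrightarrow> l) (at 0))"

text \<open>
  \<open>iter_deriv f k x v\<close> is $d^kf(x; v_0, \dots, v_{k-1})$. An element of the power $E^k$ is given by
  the first \<open>k\<close> entries of a sequence in \<open>E\<close>; the other entries are irrelevant, so that continuity
  on \<open>S \<times> UNIV\<close> for the product topology is continuity on $S \times E^k$.
\<close>
fun iter_deriv :: "('e::locally_convex_space \<Rightarrow> 'f::locally_convex_space) \<Rightarrow> nat \<Rightarrow> 'e \<Rightarrow> (nat \<Rightarrow> 'e) \<Rightarrow> 'f" where
  "iter_deriv f 0 x v = f x"
| "iter_deriv f (Suc k) x v = dir_deriv (\<lambda>y. iter_deriv f k y v) x (v k)"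

definition mb_smooth_on :: "'e::locally_convex_space set \<Rightarrow> ('e \<Rightarrow> 'f::locally_convex_space) \<Rightarrow> bool" where
  "mb_smooth_on S f \<longleftrightarrow> open S \<and>
    (\<forall>k. continuous_on (S \<times> UNIV) (\<lambda>(x, v). iter_deriv f k x v) \<and>
         (\<forall>x\<in>S. \<forall>v w. dir_differentiable (\<lambda>y. iter_deriv f k y v) x w))"


section \<open>Locally convex manifolds and Lie groups\<close>

type_synonym ('m, 'e) chart = "'m set \<times> ('m \<Rightarrow> 'e)"

abbreviation chart_inv :: "('m, 'e) chart \<Rightarrow> 'e \<Rightarrow> 'm" where
  "chart_inv c \<equiv> inv_into (fst c) (snd c)"

definition manifold_topology :: "'m set \<Rightarrow> ('m, 'e::locally_convex_space) chart set \<Rightarrow> 'm topology" where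
  "manifold_topology M A = topology (\<lambda>W. W \<subseteq> M \<and> (\<forall>c\<in>A. open (snd c ` (W \<inter> fst c))))"

definition lc_manifold :: "'m set \<Rightarrow> ('m, 'e::locally_convex_space) chart set \<Rightarrow> bool" where
  "lc_manifold M A \<longleftrightarrow>
    (\<forall>c\<in>A. fst c \<subseteq> M \<and> inj_on (snd c) (fst c) \<and> open (snd c ` fst c)) \<and>
    (\<Union>c\<in>A. fst c) = M \<and>
    (\<forall>c\<in>A. \<forall>d\<in>A. mb_smooth_on (snd c ` (fst c \<inter> fst d)) (snd d \<circ> chart_inv c)) \<and>
    Hausdorff_space (manifold_topology M A)"

text \<open>Continuity is part of this: \<open>mb_smooth_on\<close> requires the sets \<open>f -` fst d\<close> to be open in charts.\<close>
definition smooth_map :: "'m set \<Rightarrow> ('m, 'e::locally_convex_space) chart set \<Rightarrow>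
    'n set \<Rightarrow> ('n, 'f::locally_convex_space) chart set \<Rightarrow> ('m \<Rightarrow> 'n) \<Rightarrow> bool" where
  "smooth_map M A N B f \<longleftrightarrow> f ` M \<subseteq> N \<and>
    (\<forall>c\<in>A. \<forall>d\<in>B. mb_smooth_on (snd c ` (fst c \<inter> f -` fst d)) (snd d \<circ> f \<circ> chart_inv c))"

definition diffeomorphism :: "'m set \<Rightarrow> ('m, 'e::locally_convex_space) chart set \<Rightarrow>
    'n set \<Rightarrow> ('n, 'f::locally_convex_space) chart set \<Rightarrow> ('m \<Rightarrow> 'n) \<Rightarrow> bool" where
  "diffeomorphism M A N B f \<longleftrightarrow>
    bij_betw f M N \<and> smooth_map M A N B f \<and> smooth_map N B M A (inv_into M f)"

definition vector_atlas :: "('e, 'e::locally_convex_space) chart set" where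
  "vector_atlas = {(UNIV, \<lambda>x. x)}"

definition prod_atlas :: "('m, 'e) chart set \<Rightarrow> ('n, 'f) chart set \<Rightarrow> ('m \<times> 'n, 'e \<times> 'f) chart set" where
  "prod_atlas A B = {(fst c \<times> fst d, map_prod (snd c) (snd d)) | c d. c \<in> A \<and> d \<in> B}"

definition restrict_atlas :: "('m, 'e) chart set \<Rightarrow> 'm set \<Rightarrow> ('m, 'e) chart set" where
  "restrict_atlas A V = (\<lambda>c. (fst c \<inter> V, snd c)) ` A"

definition circle :: "complex set" where
  "circle = {z. cmod z = 1}"

definition circle_atlas :: "(complex, real) chart set" where
  "circle_atlas =
    {(cis ` {a<..<a + 2 * pi}, \<lambda>z. THE t. a < t \<and> t < a + 2 * pi \<and> z = cis t) | a. True}"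

definition lc_lie_group :: "('g, 'b) monoid_scheme \<Rightarrow> ('g, 'e::locally_convex_space) chart set \<Rightarrow> bool" where
  "lc_lie_group G A \<longleftrightarrow> group G \<and> lc_manifold (carrier G) A \<and>
    smooth_map (carrier G \<times> carrier G) (prod_atlas A A) (carrier G) A (\<lambda>(g, h). g \<otimes>\<^bsub>G\<^esub> h) \<and>
    smooth_map (carrier G) A (carrier G) A (\<lambda>g. inv\<^bsub>G\<^esub> g)"

text \<open>
  For a chart \<open>c\<close> around \<open>\<one>\<close>, the tangent space $T_{\mathbf 1}G$ is identified with the model space
  by the differential of \<open>c\<close>. The Lie bracket is the value at \<open>\<one>\<close> of the bracket of left invariant
  vector fields, all vector fields being written in the chart \<open>c\<close>.
\<close>
definition left_invariant_field :: "('g, 'b) monoid_scheme \<Rightarrow> ('g, 'e::locally_convex_space) chart \<Rightarrow>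
    'e \<Rightarrow> 'e \<Rightarrow> 'e" where
  "left_invariant_field G c \<xi> x =
    dir_deriv (\<lambda>y. snd c (chart_inv c x \<otimes>\<^bsub>G\<^esub> chart_inv c y)) (snd c \<one>\<^bsub>G\<^esub>) \<xi>"

definition field_bracket :: "('e::locally_convex_space \<Rightarrow> 'e) \<Rightarrow> ('e \<Rightarrow> 'e) \<Rightarrow> 'e \<Rightarrow> 'e" where
  "field_bracket X Y x = dir_deriv Y x (X x) - dir_deriv X x (Y x)"

definition lie_bracket :: "('g, 'b) monoid_scheme \<Rightarrow> ('g, 'e::locally_convex_space) chart \<Rightarrow>
    'e \<Rightarrow> 'e \<Rightarrow> 'e" where
  "lie_bracket G c \<xi> \<eta> =
    field_bracket (left_invariant_field G c \<xi>) (left_invariant_field G c \<eta>) (snd c \<one>\<^bsub>G\<^esub>)"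


section \<open>Hilbert spaces, unitary groups and projective spaces\<close>

text \<open>The scalar product is antilinear in the first argument; completeness comes from \<open>banach\<close>.\<close>
class complex_hilbert_space = banach +
  fixes cscale :: "complex \<Rightarrow> 'a \<Rightarrow> 'a"
    and cinner :: "'a \<Rightarrow> 'a \<Rightarrow> complex"
  assumes cscale_add_right: "cscale a (x + y) = cscale a x + cscale a y"
    and cscale_add_left: "cscale (a + b) x = cscale a x + cscale b x"
    and cscale_cscale: "cscale a (cscale b x) = cscale (a * b) x"
    and cscale_of_real: "cscale (complex_of_real r) x = r *\<^sub>R x"
    and cinner_commute: "cinner x y = cnj (cinner y x)"
    and cinner_add_right: "cinner x (y + z) = cinner x y + cinner x z"
    and cinner_cscale_right: "cinner x (cscale a y) = a * cinner x y"
    and norm_eq_sqrt_cinner: "norm x = sqrt (Re (cinner x x))"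

definition unitary_group :: "('h::complex_hilbert_space \<Rightarrow> 'h) monoid" where
  "unitary_group =
    \<lparr>carrier = {U. (\<forall>x y. U (x + y) = U x + U y) \<and> (\<forall>a x. U (cscale a x) = cscale a (U x)) \<and>
                 (\<forall>x y. cinner (U x) (U y) = cinner x y) \<and> surj U},
     mult = (\<circ>), one = id\<rparr>"

definition phases :: "('h::complex_hilbert_space \<Rightarrow> 'h) set" where
  "phases = cscale ` circle"

definition projective_unitary_group :: "('h::complex_hilbert_space \<Rightarrow> 'h) set monoid" where
  "projective_unitary_group = unitary_group Mod phases"

abbreviation pu_class :: "('h::complex_hilbert_space \<Rightarrow> 'h) \<Rightarrow> ('h \<Rightarrow> 'h) set" where
  "pu_class U \<equiv> phases #>\<^bsub>unitary_group\<^esub> U"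

text \<open>A ray is a one-dimensional complex subspace with the origin removed.\<close>
definition ray :: "'h::complex_hilbert_space \<Rightarrow> 'h set" where
  "ray \<psi> = {cscale a \<psi> | a. a \<noteq> 0}"

definition proj :: "'h::complex_hilbert_space set \<Rightarrow> 'h set set" where
  "proj D = ray ` (D - {0})"

definition proj_topology :: "'h::complex_hilbert_space set topology" where
  "proj_topology = topology (\<lambda>W. W \<subseteq> proj UNIV \<and> open {\<psi>. \<psi> \<noteq> 0 \<and> ray \<psi> \<in> W})"

text \<open>For \<open>C = [U]\<close> and \<open>r = [\<psi>]\<close> this is the ray \<open>[U \<psi>]\<close>.\<close>
definition pu_act :: "('h::complex_hilbert_space \<Rightarrow> 'h) set \<Rightarrow> 'h set \<Rightarrow> 'h set" where
  "pu_act C r = (\<Union>U\<in>C. U ` r)"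

definition proj_chart_dom :: "'h::complex_hilbert_space \<Rightarrow> 'h set set" where
  "proj_chart_dom \<psi> = {ray \<phi> | \<phi>. cinner \<psi> \<phi> \<noteq> 0}"

text \<open>The chart $\kappa_\psi$; the right-hand side does not depend on the representative \<open>\<phi>\<close>.\<close>
definition proj_chart :: "'h::complex_hilbert_space \<Rightarrow> 'h set \<Rightarrow> 'h" where
  "proj_chart \<psi> r = (let \<phi> = SOME \<phi>. \<phi> \<in> r in cscale (inverse (cinner \<psi> \<phi>)) \<phi> - \<psi>)"

text \<open>
  The charts $\kappa_\psi$ of the full projective space take values in the closed subspace
  $\psi^\perp$ of the Hilbert space, so smoothness of a map into $\psi^\perp$ is the same as
  smoothness as a map into the Hilbert space.
\<close>
definition smooth_to_proj :: "'m set \<Rightarrow> ('m, 'e::locally_convex_space) chart set \<Rightarrow>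
    ('m \<Rightarrow> 'h::complex_hilbert_space set) \<Rightarrow> bool" where
  "smooth_to_proj M A f \<longleftrightarrow> f ` M \<subseteq> proj UNIV \<and>
    (\<forall>c\<in>A. \<forall>\<psi>. norm \<psi> = 1 \<longrightarrow>
      mb_smooth_on (snd c ` (fst c \<inter> f -` proj_chart_dom \<psi>)) (proj_chart \<psi> \<circ> f \<circ> chart_inv c))"


section \<open>Smooth projective unitary representations\<close>

definition proj_smooth_rays :: "('g, 'b) monoid_scheme \<Rightarrow> ('g, 'e::locally_convex_space) chart set \<Rightarrow>
    ('g \<Rightarrow> ('h::complex_hilbert_space \<Rightarrow> 'h) set) \<Rightarrow> 'h set set" where
  "proj_smooth_rays G A \<rho> =
    {r \<in> proj UNIV. smooth_to_proj (carrier G) A (\<lambda>g. pu_act (\<rho> g) r)}"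

definition smooth_projective_rep :: "('g, 'b) monoid_scheme \<Rightarrow> ('g, 'e::locally_convex_space) chart set \<Rightarrow>
    ('g \<Rightarrow> ('h::complex_hilbert_space \<Rightarrow> 'h) set) \<Rightarrow> bool" where
  "smooth_projective_rep G A \<rho> \<longleftrightarrow>
    \<rho> \<in> hom G projective_unitary_group \<and>
    proj_topology closure_of proj_smooth_rays G A \<rho> = proj UNIV"

definition sharp_group :: "('g, 'b) monoid_scheme \<Rightarrow>
    ('g \<Rightarrow> ('h::complex_hilbert_space \<Rightarrow> 'h) set) \<Rightarrow> ('g \<times> ('h \<Rightarrow> 'h)) monoid" where
  "sharp_group G \<rho> = (G \<times>\<times> unitary_group)
    \<lparr>carrier := {(g, U). g \<in> carrier G \<and> U \<in> carrier unitary_group \<and> \<rho> g = pu_class U}\<rparr>"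

definition smooth_vectors :: "('g, 'b) monoid_scheme \<Rightarrow>
    ('g \<Rightarrow> ('h::complex_hilbert_space \<Rightarrow> 'h) set) \<Rightarrow>
    ('g \<times> ('h \<Rightarrow> 'h), 'f::locally_convex_space) chart set \<Rightarrow> 'h set" where
  "smooth_vectors G \<rho> Ash =
    {\<psi>. smooth_map (carrier (sharp_group G \<rho>)) Ash UNIV vector_atlas (\<lambda>(g, U). U \<psi>)}"

text \<open>
  \<open>(g, U) \<mapsto> g\<close> is a principal \<open>U(1)\<close>-bundle for the action \<open>z \<cdot> (g, U) = (g, z U)\<close>.
\<close>
definition principal_U1_bundle :: "('g, 'b) monoid_scheme \<Rightarrow> ('g, 'e::locally_convex_space) chart set \<Rightarrow>
    ('g \<Rightarrow> ('h::complex_hilbert_space \<Rightarrow> 'h) set) \<Rightarrow>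
    ('g \<times> ('h \<Rightarrow> 'h), 'f::locally_convex_space) chart set \<Rightarrow> bool" where
  "principal_U1_bundle G A \<rho> Ash \<longleftrightarrow>
    (\<forall>g\<in>carrier G. \<exists>V \<Phi>. openin (manifold_topology (carrier G) A) V \<and> g \<in> V \<and>
      diffeomorphism (V \<times> circle) (prod_atlas (restrict_atlas A V) circle_atlas)
        (carrier (sharp_group G \<rho>) \<inter> fst -` V) (restrict_atlas Ash (fst -` V)) \<Phi> \<and>
      (\<forall>h\<in>V. \<forall>z\<in>circle. fst (\<Phi> (h, z)) = h \<and> snd (\<Phi> (h, z)) = cscale z \<circ> snd (\<Phi> (h, 1))))"

text \<open>
  The Lie group structure of $G^\sharp$. Such an atlas exists (for a nonzero Hilbert space) for every smooth projective unitary
  representation, and its smooth structure is unique: two local smooth sections for two such atlases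
  differ by a function $f$ into \<open>U(1)\<close>, and for a nonzero \<open>\<psi>\<close> that is smooth for both (the last
  condition makes the smooth vectors coincide) $f$ is a quotient of scalar products of smooth
  Hilbert space valued functions.
\<close>
definition sharp_lie_group :: "('g, 'b) monoid_scheme \<Rightarrow> ('g, 'e::locally_convex_space) chart set \<Rightarrow>
    ('g \<Rightarrow> ('h::complex_hilbert_space \<Rightarrow> 'h) set) \<Rightarrow>
    ('g \<times> ('h \<Rightarrow> 'h), 'f::locally_convex_space) chart set \<Rightarrow> bool" where
  "sharp_lie_group G A \<rho> Ash \<longleftrightarrow>
    lc_lie_group (sharp_group G \<rho>) Ash \<and>
    fst \<in> hom (sharp_group G \<rho>) G \<and>
    smooth_map (carrier (sharp_group G \<rho>)) Ash (carrier G) A fst \<and>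
    principal_U1_bundle G A \<rho> Ash \<and>
    closure (smooth_vectors G \<rho> Ash) = UNIV \<and>
    proj (smooth_vectors G \<rho> Ash) = proj_smooth_rays G A \<rho>"

text \<open>In the following, \<open>c\<close> and \<open>csh\<close> are charts of $G$ and $G^\sharp$ around the identity.\<close>

definition derived_rep :: "('g, 'b) monoid_scheme \<Rightarrow>
    ('g \<Rightarrow> ('h::complex_hilbert_space \<Rightarrow> 'h) set) \<Rightarrow>
    ('g \<times> ('h \<Rightarrow> 'h), 'f::locally_convex_space) chart \<Rightarrow> 'f \<Rightarrow> 'h \<Rightarrow> 'h" where
  "derived_rep G \<rho> csh \<xi> \<psi> =
    dir_deriv (\<lambda>x. snd (chart_inv csh x) \<psi>) (snd csh \<one>\<^bsub>sharp_group G \<rho>\<^esub>) \<xi>"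

text \<open>\<open>derived_rep_iter G \<rho> csh k v \<psi>\<close> is $d\rho(v_0)\cdots d\rho(v_{k-1})\psi$.\<close>
fun derived_rep_iter :: "('g, 'b) monoid_scheme \<Rightarrow>
    ('g \<Rightarrow> ('h::complex_hilbert_space \<Rightarrow> 'h) set) \<Rightarrow>
    ('g \<times> ('h \<Rightarrow> 'h), 'f::locally_convex_space) chart \<Rightarrow> nat \<Rightarrow> (nat \<Rightarrow> 'f) \<Rightarrow> 'h \<Rightarrow> 'h" where
  "derived_rep_iter G \<rho> csh 0 v \<psi> = \<psi>"
| "derived_rep_iter G \<rho> csh (Suc k) v \<psi> =
    derived_rep_iter G \<rho> csh k v (derived_rep G \<rho> csh (v k) \<psi>)"

text \<open>
  Bounded subsets of $E^k$, which is embedded in the product space of all sequences in \<open>E\<close> as the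
  subspace of the sequences vanishing from index \<open>k\<close> on.
\<close>
definition bounded_in_power :: "nat \<Rightarrow> (nat \<Rightarrow> 'f::locally_convex_space) set \<Rightarrow> bool" where
  "bounded_in_power k B \<longleftrightarrow> (\<forall>v\<in>B. \<forall>i\<ge>k. v i = 0) \<and>
    (\<forall>N. open N \<and> (\<lambda>_. 0) \<in> N \<longrightarrow> (\<exists>s>0. \<forall>t>s. \<forall>v\<in>B. (\<lambda>i. (1 / t) *\<^sub>R v i) \<in> N))"

definition strong_seminorm :: "('g, 'b) monoid_scheme \<Rightarrow>
    ('g \<Rightarrow> ('h::complex_hilbert_space \<Rightarrow> 'h) set) \<Rightarrow>
    ('g \<times> ('h \<Rightarrow> 'h), 'f::locally_convex_space) chart \<Rightarrow> nat \<Rightarrow> (nat \<Rightarrow> 'f) set \<Rightarrow> 'h \<Rightarrow> ennreal" where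
  "strong_seminorm G \<rho> csh k B \<psi> = (SUP v\<in>B. ennreal (norm (derived_rep_iter G \<rho> csh k v \<psi>)))"

text \<open>The norm is the seminorm for \<open>k = 0\<close> and \<open>B = {\<lambda>_. 0}\<close>.\<close>
definition strong_topology :: "('g, 'b) monoid_scheme \<Rightarrow>
    ('g \<Rightarrow> ('h::complex_hilbert_space \<Rightarrow> 'h) set) \<Rightarrow>
    ('g \<times> ('h \<Rightarrow> 'h), 'f::locally_convex_space) chart set \<Rightarrow>
    ('g \<times> ('h \<Rightarrow> 'h), 'f) chart \<Rightarrow> 'h topology" where
  "strong_topology G \<rho> Ash csh = topology (\<lambda>W. W \<subseteq> smooth_vectors G \<rho> Ash \<and>
    (\<forall>\<psi>\<in>W. \<exists>F \<epsilon>. finite F \<and> (\<forall>(k, B)\<in>F. bounded_in_power k B) \<and> \<epsilon> > 0 \<and>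
      (\<forall>\<phi>\<in>smooth_vectors G \<rho> Ash.
        (\<forall>(k, B)\<in>F. strong_seminorm G \<rho> csh k B (\<phi> - \<psi>) < \<epsilon>) \<longrightarrow> \<phi> \<in> W)))"


section \<open>Kostant--Souriau cocycle and momentum map\<close>

text \<open>A unit vector in a ray; it determines the chart $\kappa_\psi$ used at the ray \<open>[\<psi>]\<close>.\<close>
definition unit_rep :: "'h::complex_hilbert_space set \<Rightarrow> 'h" where
  "unit_rep r = (SOME \<psi>. \<psi> \<in> r \<and> norm \<psi> = 1)"

text \<open>$T_{[\psi]}$ as a topological subspace of the smooth vectors with the strong topology.\<close>
definition proj_tangent_topology :: "('g, 'b) monoid_scheme \<Rightarrow>
    ('g \<Rightarrow> ('h::complex_hilbert_space \<Rightarrow> 'h) set) \<Rightarrow>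
    ('g \<times> ('h \<Rightarrow> 'h), 'f::locally_convex_space) chart set \<Rightarrow>
    ('g \<times> ('h \<Rightarrow> 'h), 'f) chart \<Rightarrow> 'h set \<Rightarrow> 'h topology" where
  "proj_tangent_topology G \<rho> Ash csh r =
    subtopology (strong_topology G \<rho> Ash csh) {v. cinner (unit_rep r) v = 0}"

text \<open>
  $X_\xi(r)$: the derivative at \<open>\<one>\<close> in direction \<open>\<xi>\<close> of the orbit map of \<open>r\<close>, as a map into the
  projective space of the smooth vectors, read in the chart $\kappa_\psi$ at \<open>r = [\<psi>]\<close>.
\<close>
definition fundamental_field :: "('g, 'b) monoid_scheme \<Rightarrow> ('g, 'e::locally_convex_space) chart \<Rightarrow>
    ('g \<Rightarrow> ('h::complex_hilbert_space \<Rightarrow> 'h) set) \<Rightarrow>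
    ('g \<times> ('h \<Rightarrow> 'h), 'f::locally_convex_space) chart set \<Rightarrow>
    ('g \<times> ('h \<Rightarrow> 'h), 'f) chart \<Rightarrow> 'e \<Rightarrow> 'h set \<Rightarrow> 'h" where
  "fundamental_field G c \<rho> Ash csh \<xi> r =
    (THE v. limitin (proj_tangent_topology G \<rho> Ash csh r)
      (\<lambda>t::real. (1 / t) *\<^sub>R
        (proj_chart (unit_rep r) (pu_act (\<rho> (chart_inv c (snd c \<one>\<^bsub>G\<^esub> + t *\<^sub>R \<xi>))) r)
          - proj_chart (unit_rep r) r))
      v (at 0))"

definition symplectic_form :: "'h::complex_hilbert_space \<Rightarrow> 'h \<Rightarrow> real" where
  "symplectic_form v w = 2 * Im (cinner v w)"

definition kostant_souriau :: "('g, 'b) monoid_scheme \<Rightarrow> ('g, 'e::locally_convex_space) chart \<Rightarrow>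
    ('g \<Rightarrow> ('h::complex_hilbert_space \<Rightarrow> 'h) set) \<Rightarrow>
    ('g \<times> ('h \<Rightarrow> 'h), 'f::locally_convex_space) chart set \<Rightarrow>
    ('g \<times> ('h \<Rightarrow> 'h), 'f) chart \<Rightarrow> 'h set \<Rightarrow> 'e \<Rightarrow> 'e \<Rightarrow> real" where
  "kostant_souriau G c \<rho> Ash csh r \<xi> \<eta> =
    symplectic_form (fundamental_field G c \<rho> Ash csh \<xi> r) (fundamental_field G c \<rho> Ash csh \<eta> r)"

text \<open>The quotient is real because the operators $d\rho(\xi)$ are skew-symmetric.\<close>
definition momentum :: "('g, 'b) monoid_scheme \<Rightarrow>
    ('g \<Rightarrow> ('h::complex_hilbert_space \<Rightarrow> 'h) set) \<Rightarrow>
    ('g \<times> ('h \<Rightarrow> 'h), 'f::locally_convex_space) chart \<Rightarrow> 'h set \<Rightarrow> 'f \<Rightarrow> real" where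
  "momentum G \<rho> csh r \<xi> = (let \<psi> = SOME \<psi>. \<psi> \<in> r in
    Re (cinner \<psi> (cscale \<i> (derived_rep G \<rho> csh \<xi> \<psi>)) / cinner \<psi> \<psi>))"

text \<open>The derivative at the identity of $G^\sharp \to G$, in the charts \<open>csh\<close> and \<open>c\<close>.\<close>
definition sharp_projection :: "('g, 'b) monoid_scheme \<Rightarrow> ('g, 'e::locally_convex_space) chart \<Rightarrow>
    ('g \<Rightarrow> ('h::complex_hilbert_space \<Rightarrow> 'h) set) \<Rightarrow>
    ('g \<times> ('h \<Rightarrow> 'h), 'f::locally_convex_space) chart \<Rightarrow> 'f \<Rightarrow> 'e" where
  "sharp_projection G c \<rho> csh =
    dir_deriv (\<lambda>x. snd c (fst (chart_inv csh x))) (snd csh \<one>\<^bsub>sharp_group G \<rho>\<^esub>)"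

text \<open>Only brackets of lifts are used below; they do not depend on the choice, because the extension is central.\<close>
definition sharp_lift :: "('g, 'b) monoid_scheme \<Rightarrow> ('g, 'e::locally_convex_space) chart \<Rightarrow>
    ('g \<Rightarrow> ('h::complex_hilbert_space \<Rightarrow> 'h) set) \<Rightarrow>
    ('g \<times> ('h \<Rightarrow> 'h), 'f::locally_convex_space) chart \<Rightarrow> 'e \<Rightarrow> 'f" where
  "sharp_lift G c \<rho> csh \<xi> = (SOME \<zeta>. sharp_projection G c \<rho> csh \<zeta> = \<xi>)"

definition delta :: "('g, 'b) monoid_scheme \<Rightarrow> ('g, 'e::locally_convex_space) chart \<Rightarrow>
    ('g \<Rightarrow> ('h::complex_hilbert_space \<Rightarrow> 'h) set) \<Rightarrow>
    ('g \<times> ('h \<Rightarrow> 'h), 'f::locally_convex_space) chart \<Rightarrow> ('f \<Rightarrow> real) \<Rightarrow> 'e \<Rightarrow> 'e \<Rightarrow> real" where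
  "delta G c \<rho> csh l \<xi> \<eta> =
    l (lie_bracket (sharp_group G \<rho>) csh (sharp_lift G c \<rho> csh \<xi>) (sharp_lift G c \<rho> csh \<eta>))"

end

theory Submission
  imports Defs
begin

text \<open>
  Let \<open>\<psi>\<close> be a smooth unit vector and let \<open>A\<close>, \<open>B\<close> be the operators of the derived representation for
  lifts of \<open>\<xi>\<close> and \<open>\<eta>\<close>. In the chart centred at the ray of \<open>\<psi>\<close> the fundamental vector field of \<open>\<xi>\<close> is
  the component \<open>A\<psi> - \<langle>\<psi>, A\<psi>\<rangle>\<psi>\<close> of \<open>A\<psi>\<close> orthogonal to \<open>\<psi>\<close>. As \<open>A\<close> and \<open>B\<close> are skew-symmetric, the
  symplectic form of the two fields is \<open>2 Im \<langle>A\<psi>, B\<psi>\<rangle>\<close>, and this is also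
  \<open>\<langle>\<psi>, \<i>[A, B]\<psi>\<rangle>\<close>, the momentum at the bracket of the lifts.

  Two facts carry this computation. The first is \<open>d\<rho>([\<zeta>, \<eta>]) = [d\<rho>(\<zeta>), d\<rho>(\<eta>)]\<close> on smooth vectors
  (\<open>drep_lie_bracket\<close>). The vector \<open>R(x) d\<rho>(\<eta>)\<psi>\<close> is the derivative of the orbit map along the left
  invariant field of \<open>\<eta>\<close>; differentiating once more, the second derivatives of the orbit map cancel by
  symmetry, and the bracket of the vector fields remains.

  The second is that the orbit of a ray is differentiable for the strong topology
  (\<open>fundamental_field_eq\<close>), that is, in the seminorms
  \<open>sup\<^bsub>v \<in> V\<^esub> \<parallel>d\<rho>(v\<^sub>0) \<cdots> d\<rho>(v\<^bsub>k-1\<^esub>)\<phi>\<parallel>\<close> with \<open>V\<close> bounded. For a smooth curve \<open>f\<close> in an orbit the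
  expression \<open>R(y) d\<rho>(v\<^sub>0) \<cdots> d\<rho>(v\<^bsub>k-1\<^esub>) f(t)\<close> is jointly smooth in \<open>y\<close>, \<open>t\<close> and the sequence \<open>v\<close>,
  because every \<open>d\<rho>(v\<^sub>i)\<close> is a derivative along a left invariant field in the variable \<open>y\<close>. The
  second derivative in \<open>t\<close> is homogeneous in \<open>v\<close> and continuous, hence bounded uniformly on \<open>V\<close>, and
  Taylor's formula gives convergence of the difference quotients (\<open>drep_iter_taylor\<close>). The lifted
  curves come from local sections of the circle bundle. The limit does not depend on the lift because
  it is also the derivative of the orbit map of the ray, which is smooth on \<open>G\<close> itself
  (\<open>horizontal_eq_orbit_deriv\<close>).

  All this rests on a calculus of Michal-Bastiani smooth maps: the mean value theorem
  \<open>mean_value_convex\<close>, the chain rule \<open>C1_on_chain\<close>, and \<open>mb_smooth_on_iter_deriv\<close>, which contains the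
  smoothness of compositions and of tangent maps.
\<close>

section \<open>Directional derivatives in locally convex spaces\<close>

lemma tendsto_scaleR_lc:
  fixes g :: "'a \<Rightarrow> 'e::locally_convex_space"
  assumes "(f \<longlongrightarrow> r) F" "(g \<longlongrightarrow> s) F"
  shows "((\<lambda>x. f x *\<^sub>R g x) \<longlongrightarrow> r *\<^sub>R s) F"
  using filterlim_compose[OF tendsto_scaleR_Pair, of "\<lambda>x. (f x, g x)" r s F] assms
  by (simp add: nhds_prod[symmetric] tendsto_Pair)

lemma continuous_on_scaleR_lc:
  fixes g :: "'a::topological_space \<Rightarrow> 'e::locally_convex_space"
  assumes "continuous_on S f" "continuous_on S g"
  shows "continuous_on S (\<lambda>x. f x *\<^sub>R g x)"
  using assms unfolding continuous_on_def by (auto intro: tendsto_scaleR_lc)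

lemma tendsto_compose_continuous_on:
  assumes "continuous_on S h" "open S" "l \<in> S" "(f \<longlongrightarrow> l) F"
  shows "((\<lambda>x. h (f x)) \<longlongrightarrow> h l) F"
  using continuous_on_tendsto_compose[OF assms(1,4,3)] topological_tendstoD[OF assms(4,2,3)] by blast

lemma convex_open_nhd:
  fixes x :: "'e::locally_convex_space"
  assumes "open S" "x \<in> S"
  obtains V where "open V" "x \<in> V" "V \<subseteq> S" "convex V"
proof -
  let ?S = "(\<lambda>y. x + y) -` S"
  have "open ?S" using assms by (intro open_vimage continuous_intros) auto
  then obtain V where V: "open V" "0 \<in> V" "V \<subseteq> ?S"
    "\<forall>y\<in>V. \<forall>z\<in>V. \<forall>t. 0 \<le> t \<and> t \<le> 1 \<longrightarrow> (1 - t) *\<^sub>R y + t *\<^sub>R z \<in> V"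
    using locally_convex_0[of ?S] assms by auto
  let ?V = "(\<lambda>y. - x + y) -` V"
  show ?thesis
  proof
    show "open ?V" using V by (intro open_vimage continuous_intros) auto
    show "x \<in> ?V" "?V \<subseteq> S" using V by auto
    show "convex ?V"
      unfolding convex_alt
    proof (intro ballI allI impI)
      fix y z u assume "y \<in> ?V" "z \<in> ?V" "0 \<le> u \<and> u \<le> (1::real)"
      then have "(1 - u) *\<^sub>R (- x + y) + u *\<^sub>R (- x + z) \<in> V" using V by blast
      moreover have "(1 - u) *\<^sub>R (- x + y) + u *\<^sub>R (- x + z) = - x + ((1 - u) *\<^sub>R y + u *\<^sub>R z)"
        by (simp add: algebra_simps)
      ultimately show "(1 - u) *\<^sub>R y + u *\<^sub>R z \<in> ?V" by simp
    qed
  qed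
qed

lemma convex_combination_unnormalized:
  fixes v w :: "'e::real_vector"
  assumes "convex V" "v \<in> V" "w \<in> V" "0 \<le> a" "0 \<le> b"
  shows "\<exists>u\<in>V. a *\<^sub>R v + b *\<^sub>R w = (a + b) *\<^sub>R u"
proof (cases "a + b = 0")
  case True
  then have "a = 0" "b = 0" using assms(4,5) by simp_all
  then show ?thesis using assms(2) by auto
next
  case False
  have "(a / (a + b)) *\<^sub>R v + (b / (a + b)) *\<^sub>R w \<in> V"
    using assms False by (intro convexD[OF \<open>convex V\<close>]) (auto simp: add_divide_distrib[symmetric])
  moreover have "(a + b) *\<^sub>R ((a / (a + b)) *\<^sub>R v + (b / (a + b)) *\<^sub>R w) = a *\<^sub>R v + b *\<^sub>R w"
    using False by (simp add: scaleR_right_distrib)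
  ultimately show ?thesis by metis
qed

text \<open>
  If the statement fails on an interval, it fails on one of its halves, because a convex combination of
  mean slopes in \<open>V\<close> lies in \<open>V\<close>. Bisection leads to a point near which it holds, since \<open>V\<close> is open.
\<close>
lemma mean_value_convex:
  fixes \<gamma> :: "real \<Rightarrow> 'e::locally_convex_space"
  assumes "a < b" "open V" "convex V"
    and d: "\<And>s. a \<le> s \<Longrightarrow> s \<le> b \<Longrightarrow> ((\<lambda>t. (1 / t) *\<^sub>R (\<gamma> (s + t) - \<gamma> s)) \<longlongrightarrow> \<gamma>' s) (at 0)"
    and V: "\<And>s. a \<le> s \<Longrightarrow> s \<le> b \<Longrightarrow> \<gamma>' s \<in> V"
  shows "(1 / (b - a)) *\<^sub>R (\<gamma> b - \<gamma> a) \<in> V"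
proof -
  have "\<exists>v\<in>V. \<gamma> b - \<gamma> a = (b - a) *\<^sub>R v"
    using less_imp_le[OF \<open>a < b\<close>]
  proof (induction a b rule: Bolzano)
    case (trans p q s)
    then obtain v w where vw: "v \<in> V" "w \<in> V" "\<gamma> q - \<gamma> p = (q - p) *\<^sub>R v" "\<gamma> s - \<gamma> q = (s - q) *\<^sub>R w"
      by blast
    from convex_combination_unnormalized[OF \<open>convex V\<close> vw(1,2), of "q - p" "s - q"] trans(3,4)
    obtain u where "u \<in> V" "(q - p) *\<^sub>R v + (s - q) *\<^sub>R w = (s - p) *\<^sub>R u" by auto
    moreover have "\<gamma> s - \<gamma> p = (\<gamma> q - \<gamma> p) + (\<gamma> s - \<gamma> q)" by simp
    ultimately show ?case using vw(3,4) by metis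
  next
    case (local x)
    have "\<forall>\<^sub>F t in at 0. (1 / t) *\<^sub>R (\<gamma> (x + t) - \<gamma> x) \<in> V"
      using topological_tendstoD[OF d \<open>open V\<close> V] local by blast
    then obtain e where e: "e > 0" "\<And>t. t \<noteq> 0 \<Longrightarrow> \<bar>t\<bar> < e \<Longrightarrow> (1 / t) *\<^sub>R (\<gamma> (x + t) - \<gamma> x) \<in> V"
      by (auto simp: eventually_at dist_real_def)
    have V1: "\<exists>v\<in>V. \<gamma> (x + t) - \<gamma> x = t *\<^sub>R v" if "\<bar>t\<bar> < e" for t
    proof (cases "t = 0")
      case True
      then show ?thesis using V local by auto
    next
      case False
      then show ?thesis using e(2)[OF False that] by (intro bexI) auto
    qed
    show ?case
    proof (intro exI[of _ e] conjI allI impI)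
      show "e > 0" by fact
      fix p q assume pq: "p \<le> x \<and> x \<le> q \<and> q - p < e"
      obtain v where v: "v \<in> V" "\<gamma> q - \<gamma> x = (q - x) *\<^sub>R v" using V1[of "q - x"] pq by auto
      obtain w where w: "w \<in> V" "\<gamma> p - \<gamma> x = (p - x) *\<^sub>R w" using V1[of "p - x"] pq by auto
      from convex_combination_unnormalized[OF \<open>convex V\<close> w(1) v(1), of "x - p" "q - x"] pq
      obtain u where u: "u \<in> V" "(x - p) *\<^sub>R w + (q - x) *\<^sub>R v = (q - p) *\<^sub>R u" by auto
      have "\<gamma> q - \<gamma> p = (\<gamma> q - \<gamma> x) - (\<gamma> p - \<gamma> x)" by simp
      also have "\<dots> = (q - p) *\<^sub>R u" unfolding v(2) w(2) u(2)[symmetric] by (simp add: algebra_simps)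
      finally show "\<exists>v\<in>V. \<gamma> q - \<gamma> p = (q - p) *\<^sub>R v" using u(1) by blast
    qed
  qed
  then show ?thesis using \<open>a < b\<close> by auto
qed

definition has_dir_deriv ::
    "('e::locally_convex_space \<Rightarrow> 'f::locally_convex_space) \<Rightarrow> 'e \<Rightarrow> 'e \<Rightarrow> 'f \<Rightarrow> bool" where
  "has_dir_deriv f x v l \<longleftrightarrow> ((\<lambda>t::real. (1 / t) *\<^sub>R (f (x + t *\<^sub>R v) - f x)) \<longlongrightarrow> l) (at 0)"

lemma has_dir_derivD:
  assumes "has_dir_deriv f x v l"
  shows "dir_differentiable f x v" "dir_deriv f x v = l"
  using assms tendsto_Lim[OF trivial_limit_at assms[unfolded has_dir_deriv_def]]
  unfolding dir_differentiable_def has_dir_deriv_def dir_deriv_def by blast+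

lemma has_dir_derivI:
  assumes "dir_differentiable f x v"
  shows "has_dir_deriv f x v (dir_deriv f x v)"
proof -
  obtain l where "has_dir_deriv f x v l"
    using assms unfolding dir_differentiable_def has_dir_deriv_def by blast
  with has_dir_derivD(2)[OF this] show ?thesis by simp
qed

lemma has_dir_deriv_unique: "has_dir_deriv f x v l \<Longrightarrow> has_dir_deriv f x v l' \<Longrightarrow> l = l'"
  by (metis has_dir_derivD(2))

lemma tendsto_line: "((\<lambda>t. x + t *\<^sub>R v) \<longlongrightarrow> x) (at (0::real))" for x v :: "'e::locally_convex_space"
  using tendsto_add[OF tendsto_const[of x] tendsto_scaleR_lc[OF tendsto_ident_at tendsto_const[of v], of 0]]
  by simp

lemma eventually_line:
  fixes x v :: "'e::locally_convex_space"
  assumes "open S" "x \<in> S"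
  shows "\<forall>\<^sub>F t in at (0::real). x + t *\<^sub>R v \<in> S"
  using topological_tendstoD[OF tendsto_line assms] .

lemma has_dir_deriv_cong:
  assumes "open S" "x \<in> S" "\<And>y. y \<in> S \<Longrightarrow> f y = g y"
  shows "has_dir_deriv f x v l \<longleftrightarrow> has_dir_deriv g x v l"
  unfolding has_dir_deriv_def
  by (rule tendsto_cong, rule eventually_mono[OF eventually_line[OF assms(1,2), of v]])
    (simp add: assms)

lemma has_dir_deriv_const: "has_dir_deriv (\<lambda>_. a) x v 0"
  by (simp add: has_dir_deriv_def)

lemma has_dir_deriv_add:
  assumes "has_dir_deriv f x v l" "has_dir_deriv g x v m"
  shows "has_dir_deriv (\<lambda>y. f y + g y) x v (l + m)"
  using tendsto_add[OF assms[unfolded has_dir_deriv_def]] unfolding has_dir_deriv_def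
  by (simp only: add_diff_add scaleR_right_distrib)

lemma has_dir_deriv_scaleR:
  assumes "has_dir_deriv f x v l"
  shows "has_dir_deriv (\<lambda>y. c *\<^sub>R f y) x v (c *\<^sub>R l)"
  using tendsto_scaleR_lc[OF tendsto_const[of c] assms[unfolded has_dir_deriv_def]]
  unfolding has_dir_deriv_def
  by (simp only: scaleR_right_diff_distrib[symmetric] scaleR_left_commute[of _ c])

lemma has_dir_deriv_Pair:
  assumes "has_dir_deriv f x v l" "has_dir_deriv g x v m"
  shows "has_dir_deriv (\<lambda>y. (f y, g y)) x v (l, m)"
  using tendsto_Pair[OF assms[unfolded has_dir_deriv_def]] unfolding has_dir_deriv_def
  by simp

lemma has_dir_deriv_linear:
  assumes "linear f"
  shows "has_dir_deriv f x v (f v)"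
proof -
  have "\<forall>\<^sub>F t in at (0::real). f v = (1 / t) *\<^sub>R (f (x + t *\<^sub>R v) - f x)"
    by (auto simp: eventually_at_filter linear_add[OF assms] linear_scale[OF assms])
  then show ?thesis unfolding has_dir_deriv_def by (rule tendsto_eventually[OF eventually_mono]) simp
qed

lemma has_dir_deriv_scale_dir:
  assumes "has_dir_deriv f x v l"
  shows "has_dir_deriv f x (c *\<^sub>R v) (c *\<^sub>R l)"
proof (cases "c = 0")
  case True
  then show ?thesis by (simp add: has_dir_deriv_def)
next
  case False
  have "filterlim (\<lambda>t. t * c) (at 0) (at (0::real))"
    unfolding filterlim_at using False
    by (auto simp: eventually_at_filter intro!: tendsto_eq_intros)
  then have "((\<lambda>t. c *\<^sub>R ((1 / (t * c)) *\<^sub>R (f (x + (t * c) *\<^sub>R v) - f x))) \<longlongrightarrow> c *\<^sub>R l) (at 0)"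
    using assms unfolding has_dir_deriv_def
    by (intro tendsto_scaleR_lc tendsto_const) (rule filterlim_compose)
  then show ?thesis using False by (simp add: has_dir_deriv_def)
qed


definition C1_on :: "'e::locally_convex_space set \<Rightarrow> ('e \<Rightarrow> 'f::locally_convex_space) \<Rightarrow> bool" where
  "C1_on S f \<longleftrightarrow> open S \<and> (\<forall>x\<in>S. \<forall>v. dir_differentiable f x v) \<and>
    continuous_on (S \<times> UNIV) (\<lambda>(x, v). dir_deriv f x v)"

lemma C1_on_has_dir_deriv: "C1_on S f \<Longrightarrow> x \<in> S \<Longrightarrow> has_dir_deriv f x v (dir_deriv f x v)"
  unfolding C1_on_def by (blast intro: has_dir_derivI)

text \<open>
  For small \<open>t\<close> the mean value theorem applies to \<open>s \<mapsto> (1/t) f(x\<^sub>t + s t w\<^sub>t)\<close>, whose derivative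
  stays near \<open>f'(x; v)\<close> because the derivative is jointly continuous. The moving base point yields
  additivity in the direction, the moving direction yields the chain rule.
\<close>
lemma C1_on_difference_quotient:
  fixes f :: "'e::locally_convex_space \<Rightarrow> 'f::locally_convex_space"
  assumes C1: "C1_on S f" and x: "x \<in> S"
    and y: "(y \<longlongrightarrow> x) (at (0::real))" and w: "(w \<longlongrightarrow> v) (at (0::real))"
  shows "((\<lambda>t. (1 / t) *\<^sub>R (f (y t + t *\<^sub>R w t) - f (y t))) \<longlongrightarrow> dir_deriv f x v) (at 0)"
proof (rule topological_tendstoI)
  fix N :: "'f set" assume N: "open N" "dir_deriv f x v \<in> N"
  obtain V where V: "open V" "dir_deriv f x v \<in> V" "V \<subseteq> N" "convex V"
    using convex_open_nhd[OF N] .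
  have S: "open S" and cont: "continuous_on (S \<times> UNIV) (\<lambda>(x, v). dir_deriv f x v)"
    using C1 by (auto simp: C1_on_def)
  have "open ((\<lambda>(x, v). dir_deriv f x v) -` V \<inter> S \<times> UNIV)"
    using continuous_on_open_vimage[of "S \<times> UNIV" "\<lambda>(x, v). dir_deriv f x v"] cont S V(1)
    by (auto simp: open_Times)
  moreover have "(x, v) \<in> (\<lambda>(x, v). dir_deriv f x v) -` V \<inter> S \<times> UNIV" using V x by auto
  ultimately obtain A B where AB: "open A" "open B" "(x, v) \<in> A \<times> B"
    "A \<times> B \<subseteq> (\<lambda>(x, v). dir_deriv f x v) -` V \<inter> S \<times> UNIV"
    by (rule open_prod_elim)
  then have xv: "x \<in> A" "v \<in> B" by auto
  obtain A' where A': "open A'" "x \<in> A'" "A' \<subseteq> A" "convex A'"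
    using convex_open_nhd[OF AB(1) xv(1)] .
  have "((\<lambda>t. y t + t *\<^sub>R w t) \<longlongrightarrow> x) (at 0)"
    using tendsto_add[OF y tendsto_scaleR_lc[OF tendsto_ident_at w]] by simp
  then have ev: "\<forall>\<^sub>F t in at 0. y t + t *\<^sub>R w t \<in> A'" "\<forall>\<^sub>F t in at 0. w t \<in> B" "\<forall>\<^sub>F t in at 0. y t \<in> A'"
    using topological_tendstoD[OF _ A'(1,2)] topological_tendstoD[OF w AB(2) xv(2)] y by auto
  have "\<forall>\<^sub>F t in at (0::real). t \<noteq> 0" by (auto simp: eventually_at_filter)
  with ev show "\<forall>\<^sub>F t in at 0. (1 / t) *\<^sub>R (f (y t + t *\<^sub>R w t) - f (y t)) \<in> N"
  proof eventually_elim
    case (elim t)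
    let ?z = "\<lambda>s. y t + (s * t) *\<^sub>R w t"
    have z: "?z s \<in> A'" if "0 \<le> s" "s \<le> 1" for s
    proof -
      have "(1 - s) *\<^sub>R y t + s *\<^sub>R (y t + t *\<^sub>R w t) \<in> A'"
        using convexD_alt[OF A'(4) elim(3,1) that] .
      then show ?thesis by (simp add: algebra_simps)
    qed
    have in_V: "dir_deriv f (?z s) (w t) \<in> V" "?z s \<in> S" if "0 \<le> s" "s \<le> 1" for s
      using subsetD[OF AB(4), of "(?z s, w t)"] z[OF that] A'(3) elim(2) by auto
    have flt: "filterlim (\<lambda>u. u * t) (at 0) (at (0::real))"
      unfolding filterlim_at using elim(4)
      by (auto simp: eventually_at_filter intro!: tendsto_eq_intros)
    have "((\<lambda>u. (1 / u) *\<^sub>R ((1 / t) *\<^sub>R f (?z (s + u)) - (1 / t) *\<^sub>R f (?z s)))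
        \<longlongrightarrow> dir_deriv f (?z s) (w t)) (at 0)" if "0 \<le> s" "s \<le> 1" for s
    proof -
      have "((\<lambda>u. (1 / (u * t)) *\<^sub>R (f (?z s + (u * t) *\<^sub>R w t) - f (?z s)))
          \<longlongrightarrow> dir_deriv f (?z s) (w t)) (at 0)"
        using filterlim_compose[OF C1_on_has_dir_deriv[OF C1 in_V(2)[OF that], unfolded has_dir_deriv_def] flt] .
      moreover have "?z s + (u * t) *\<^sub>R w t = ?z (s + u)" for u
        by (simp add: distrib_right scaleR_left_distrib add.assoc)
      ultimately show ?thesis by (simp add: scaleR_right_diff_distrib[symmetric])
    qed
    from mean_value_convex[OF zero_less_one V(1,4) this in_V(1)]
    have "(1 / t) *\<^sub>R (f (y t + t *\<^sub>R w t) - f (y t)) \<in> V"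
      by (simp add: scaleR_right_diff_distrib)
    then show ?case using V(3) by blast
  qed
qed

lemma C1_on_chain:
  assumes "C1_on T g" "f x \<in> T" "has_dir_deriv f x v l"
  shows "has_dir_deriv (\<lambda>y. g (f y)) x v (dir_deriv g (f x) l)"
proof -
  let ?w = "\<lambda>t. (1 / t) *\<^sub>R (f (x + t *\<^sub>R v) - f x)"
  have "((\<lambda>t. (1 / t) *\<^sub>R (g (f x + t *\<^sub>R ?w t) - g (f x))) \<longlongrightarrow> dir_deriv g (f x) l) (at 0)"
    using C1_on_difference_quotient[OF assms(1,2) tendsto_const, of ?w l] assms(3)
    by (simp add: has_dir_deriv_def)
  moreover have "\<forall>\<^sub>F t in at (0::real). (1 / t) *\<^sub>R (g (f x + t *\<^sub>R ?w t) - g (f x)) =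
      (1 / t) *\<^sub>R (g (f (x + t *\<^sub>R v)) - g (f x))"
    by (auto simp: eventually_at_filter)
  ultimately show ?thesis
    unfolding has_dir_deriv_def by (rule Lim_transform_eventually)
qed

lemma C1_on_add_dir:
  assumes C1: "C1_on S f" and x: "x \<in> S"
  shows "dir_deriv f x (v + w) = dir_deriv f x v + dir_deriv f x w"
proof -
  have "x + t *\<^sub>R (v + w) = x + t *\<^sub>R v + t *\<^sub>R w" for t :: real
    by (simp add: scaleR_right_distrib add.assoc)
  moreover have "(1 / t) *\<^sub>R (f (x + t *\<^sub>R v + t *\<^sub>R w) - f (x + t *\<^sub>R v))
      + (1 / t) *\<^sub>R (f (x + t *\<^sub>R v) - f x)
    = (1 / t) *\<^sub>R (f (x + t *\<^sub>R v + t *\<^sub>R w) - f x)" for t :: real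
    by (metis (no_types) scaleR_right_distrib diff_add_cancel add_diff_eq)
  moreover note tendsto_add[OF C1_on_difference_quotient[OF C1 x tendsto_line[of x v] tendsto_const[of w]]
    C1_on_has_dir_deriv[OF C1 x, of v, unfolded has_dir_deriv_def]]
  ultimately have "has_dir_deriv f x (v + w) (dir_deriv f x w + dir_deriv f x v)"
    unfolding has_dir_deriv_def by (simp only:)
  then show ?thesis by (simp add: has_dir_derivD(2) add.commute)
qed

section \<open>Calculus of smooth maps\<close>

lemma tendsto_funI:
  fixes f :: "'a \<Rightarrow> 'i \<Rightarrow> 'b::topological_space"
  assumes "\<And>i. ((\<lambda>x. f x i) \<longlongrightarrow> l i) F"
  shows "(f \<longlongrightarrow> l) F"
proof -
  have "limitin (product_topology (\<lambda>i::'i. euclidean) UNIV) f l F"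
    using assms by (simp add: limitin_componentwise)
  then show ?thesis by (simp add: euclidean_product_topology)
qed

lemma continuous_on_snd_coordinate:
  "continuous_on A (\<lambda>p :: 'a::topological_space \<times> ('i \<Rightarrow> 'b::topological_space). snd p i)"
  by (rule continuous_on_product_then_coordinatewise[OF continuous_on_snd[OF continuous_on_id]])

lemma iter_deriv_cong_dirs:
  "(\<And>i. i < k \<Longrightarrow> v i = w i) \<Longrightarrow> iter_deriv f k x v = iter_deriv f k x w"
proof (induction k arbitrary: x)
  case (Suc k)
  then have "(\<lambda>y. iter_deriv f k y v) = (\<lambda>y. iter_deriv f k y w)" "v k = w k" by auto
  then show ?case by simp
qed simp

declare iter_deriv.simps(2) [simp del]

lemma mb_smooth_on_open: "mb_smooth_on S f \<Longrightarrow> open S"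
  by (simp add: mb_smooth_on_def)

lemma tendsto_iter_deriv:
  assumes "mb_smooth_on S f" "x \<in> S" "(y \<longlongrightarrow> x) F" "\<And>i. ((\<lambda>t. w t i) \<longlongrightarrow> v i) F"
  shows "((\<lambda>t. iter_deriv f k (y t) (w t)) \<longlongrightarrow> iter_deriv f k x v) F"
proof -
  have "((\<lambda>t. (y t, w t)) \<longlongrightarrow> (x, v)) F"
    by (intro tendsto_Pair assms(3) tendsto_funI[OF assms(4)])
  with assms(1,2) show ?thesis
    using tendsto_compose_continuous_on[of "S \<times> UNIV" "\<lambda>(x, v). iter_deriv f k x v" "(x, v)" "\<lambda>t. (y t, w t)" F]
    by (simp add: mb_smooth_on_def open_Times)
qed

lemma continuous_on_iter_deriv:
  assumes "mb_smooth_on S f" "continuous_on A y" "y ` A \<subseteq> S" "\<And>i. continuous_on A (\<lambda>t. w t i)"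
  shows "continuous_on A (\<lambda>t. iter_deriv f k (y t) (w t))"
  unfolding continuous_on_def
proof
  fix a assume "a \<in> A"
  with assms show "((\<lambda>t. iter_deriv f k (y t) (w t)) \<longlongrightarrow> iter_deriv f k (y a) (w a)) (at a within A)"
    by (intro tendsto_iter_deriv[OF assms(1)]) (auto simp: continuous_on_def)
qed

lemma mb_smooth_on_continuous: "mb_smooth_on S f \<Longrightarrow> continuous_on S f"
  using continuous_on_iter_deriv[of S f S "\<lambda>x. x" "\<lambda>_ _. undefined" 0] by simp

lemma has_dir_deriv_iter_deriv:
  assumes "mb_smooth_on S f" "x \<in> S"
  shows "has_dir_deriv (\<lambda>y. iter_deriv f k y v) x w (iter_deriv f (Suc k) x (v(k := w)))"
proof -
  have "iter_deriv f k y (v(k := w)) = iter_deriv f k y v" for y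
    by (rule iter_deriv_cong_dirs) simp
  then show ?thesis
    using assms by (simp add: mb_smooth_on_def has_dir_derivI iter_deriv.simps(2))
qed

lemma has_dir_deriv_smooth:
  assumes "mb_smooth_on S f" "x \<in> S"
  shows "has_dir_deriv f x w (dir_deriv f x w)"
  using has_dir_deriv_iter_deriv[OF assms, of 0 "\<lambda>_. w"] by (simp add: iter_deriv.simps(2))

lemma C1_on_iter_deriv:
  assumes "mb_smooth_on S f"
  shows "C1_on S (\<lambda>y. iter_deriv f k y v)"
proof -
  have eq: "dir_deriv (\<lambda>y. iter_deriv f k y v) x w = iter_deriv f (Suc k) x (v(k := w))" if "x \<in> S" for x w
    by (rule has_dir_derivD(2)[OF has_dir_deriv_iter_deriv[OF assms that]])
  have "continuous_on (S \<times> UNIV) (\<lambda>p. (v(k := snd p)) i)" for i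
    by (cases "i = k") (auto intro!: continuous_intros)
  then have "continuous_on (S \<times> UNIV) (\<lambda>p. iter_deriv f (Suc k) (fst p) (v(k := snd p)))"
    by (intro continuous_on_iter_deriv[OF assms] continuous_on_fst continuous_on_id) auto
  then have "continuous_on (S \<times> UNIV) (\<lambda>(x, w). dir_deriv (\<lambda>y. iter_deriv f k y v) x w)"
    by (rule continuous_on_eq) (auto simp: eq)
  then show ?thesis
    using assms has_dir_derivD(1)[OF has_dir_deriv_iter_deriv[OF assms]]
    by (auto simp: C1_on_def mb_smooth_on_def)
qed

lemma C1_on_smooth: "mb_smooth_on S f \<Longrightarrow> C1_on S f"
  using C1_on_iter_deriv[of S f 0] by simp

text \<open>
  A coinduction principle. A family of functions \<open>h\<close> of a point and a sequence of directions, graded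
  by the number of derivatives taken, contains all iterated derivatives of \<open>f\<close> as soon as it contains
  \<open>f\<close> and is closed under differentiation in the next direction. Closure properties of smooth maps
  thus only require a guess of the shape of the iterated derivatives.
\<close>
lemma mb_smooth_on_stages:
  fixes f :: "'e::locally_convex_space \<Rightarrow> 'f::locally_convex_space"
  assumes S: "open S" and P0: "P 0 h\<^sub>0" "\<And>x v. x \<in> S \<Longrightarrow> f x = h\<^sub>0 x v"
    and cont: "\<And>k h. P k h \<Longrightarrow> continuous_on (S \<times> UNIV) (\<lambda>(x, v). h x v)"
    and step: "\<And>k h. P k h \<Longrightarrow> \<exists>h'. P (Suc k) h' \<and>
      (\<forall>x\<in>S. \<forall>v. has_dir_deriv (\<lambda>y. h y v) x (v k) (h' x v))"
  shows "mb_smooth_on S f"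
proof -
  have ex: "\<exists>h. P k h \<and> (\<forall>x\<in>S. \<forall>v. iter_deriv f k x v = h x v)" for k
  proof (induction k)
    case 0
    show ?case using P0 by (intro exI[of _ "h\<^sub>0"]) auto
  next
    case (Suc k)
    then obtain h where h: "P k h" "\<And>x v. x \<in> S \<Longrightarrow> iter_deriv f k x v = h x v" by blast
    obtain h' where h': "P (Suc k) h'" "\<And>x v. x \<in> S \<Longrightarrow> has_dir_deriv (\<lambda>y. h y v) x (v k) (h' x v)"
      using step[OF h(1)] by blast
    have "iter_deriv f (Suc k) x v = h' x v" if "x \<in> S" for x v
      using has_dir_derivD(2)[OF iffD2[OF has_dir_deriv_cong[OF S that h(2)] h'(2)[OF that]]] by (simp add: iter_deriv.simps(2))
    then show ?case using h'(1) by blast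
  qed
  show ?thesis
    unfolding mb_smooth_on_def
  proof (intro conjI allI ballI S)
    fix k
    obtain h where h: "P k h" "\<And>x v. x \<in> S \<Longrightarrow> iter_deriv f k x v = h x v" using ex by blast
    show "continuous_on (S \<times> UNIV) (\<lambda>(x, v). iter_deriv f k x v)"
      by (rule continuous_on_eq[OF cont[OF h(1)]]) (auto simp: h(2))
    fix x and v :: "nat \<Rightarrow> 'e" and w :: 'e assume x: "x \<in> S"
    obtain h' where "\<And>x v. x \<in> S \<Longrightarrow> has_dir_deriv (\<lambda>y. h y v) x (v k) (h' x v)"
      using step[OF h(1)] by blast
    from this[OF x, of "v(k := w)"]
    have "has_dir_deriv (\<lambda>y. h y (v(k := w))) x w (h' x (v(k := w)))" by simp
    moreover have "iter_deriv f k y v = h y (v(k := w))" if "y \<in> S" for y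
      using h(2)[OF that, of "v(k := w)"] iter_deriv_cong_dirs[of k v "v(k := w)" f y] by simp
    ultimately have "has_dir_deriv (\<lambda>y. iter_deriv f k y v) x w (h' x (v(k := w)))"
      using has_dir_deriv_cong[OF S x, of "\<lambda>y. iter_deriv f k y v" "\<lambda>y. h y (v(k := w))"] by blast
    then show "dir_differentiable (\<lambda>y. iter_deriv f k y v) x w" by (rule has_dir_derivD(1))
  qed
qed

lemma mb_smooth_on_localI:
  assumes S: "open S" and loc: "\<And>x. x \<in> S \<Longrightarrow> \<exists>U. x \<in> U \<and> mb_smooth_on U f"
  shows "mb_smooth_on S f"
proof (rule mb_smooth_on_stages[where P = "\<lambda>k h. h = iter_deriv f k" and h\<^sub>0 = "iter_deriv f 0"])
  fix k h assume h: "h = iter_deriv f k"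
  show "continuous_on (S \<times> UNIV) (\<lambda>(x, v). h x v)"
    unfolding continuous_on_def
  proof (clarsimp simp: h)
    fix x v assume "x \<in> S"
    then obtain U where U: "x \<in> U" "mb_smooth_on U f" using loc by blast
    show "((\<lambda>(x, v). iter_deriv f k x v) \<longlongrightarrow> iter_deriv f k x v) (at (x, v) within S \<times> UNIV)"
      using tendsto_compose_continuous_on[of "U \<times> UNIV" "\<lambda>(x, v). iter_deriv f k x v" "(x, v)" "\<lambda>p. p"] U
      by (auto simp: mb_smooth_on_def open_Times)
  qed
  show "\<exists>h'. h' = iter_deriv f (Suc k) \<and> (\<forall>x\<in>S. \<forall>v. has_dir_deriv (\<lambda>y. h y v) x (v k) (h' x v))"
    using has_dir_deriv_iter_deriv[of _ f] loc by (metis fun_upd_triv h)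
qed (auto simp: S)

lemma mb_smooth_on_cong:
  assumes f: "mb_smooth_on T f" and S: "open S" "S \<subseteq> T" and eq: "\<And>x. x \<in> S \<Longrightarrow> g x = f x"
  shows "mb_smooth_on S g"
proof (rule mb_smooth_on_stages[where P = "\<lambda>k h. h = iter_deriv f k" and h\<^sub>0 = "iter_deriv f 0"])
  fix k h assume h: "h = iter_deriv f k"
  show "continuous_on (S \<times> UNIV) (\<lambda>(x, v). h x v)"
    by (rule continuous_on_subset[of "T \<times> UNIV"]) (use f S in \<open>auto simp: h mb_smooth_on_def\<close>)
  show "\<exists>h'. h' = iter_deriv f (Suc k) \<and> (\<forall>x\<in>S. \<forall>v. has_dir_deriv (\<lambda>y. h y v) x (v k) (h' x v))"
    using has_dir_deriv_iter_deriv[OF f] S(2) by (metis fun_upd_triv h subsetD)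
qed (auto simp: S eq)

lemma mb_smooth_on_Pair:
  assumes f: "mb_smooth_on S f" and g: "mb_smooth_on S g"
  shows "mb_smooth_on S (\<lambda>x. (f x, g x))"
proof (rule mb_smooth_on_stages[where P = "\<lambda>k h. h = (\<lambda>x v. (iter_deriv f k x v, iter_deriv g k x v))"
      and h\<^sub>0 = "\<lambda>x v. (iter_deriv f 0 x v, iter_deriv g 0 x v)"])
  fix k h assume h: "h = (\<lambda>x v. (iter_deriv f k x v, iter_deriv g k x v))"
  have "continuous_on (S \<times> UNIV) (\<lambda>p. (iter_deriv f k (fst p) (snd p), iter_deriv g k (fst p) (snd p)))"
    using f g by (intro continuous_on_Pair) (auto simp: mb_smooth_on_def case_prod_unfold)
  then show "continuous_on (S \<times> UNIV) (\<lambda>(x, v). h x v)"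
    by (simp add: h case_prod_unfold)
  show "\<exists>h'. h' = (\<lambda>x v. (iter_deriv f (Suc k) x v, iter_deriv g (Suc k) x v)) \<and>
      (\<forall>x\<in>S. \<forall>v. has_dir_deriv (\<lambda>y. h y v) x (v k) (h' x v))"
    using has_dir_deriv_iter_deriv[OF f, of _ k v "v k" for v] has_dir_deriv_iter_deriv[OF g, of _ k v "v k" for v]
    unfolding h by (auto intro!: has_dir_deriv_Pair)
qed (auto simp: mb_smooth_on_open[OF f])

lemma mb_smooth_on_const: "open S \<Longrightarrow> mb_smooth_on S (\<lambda>x. a)"
  by (rule mb_smooth_on_stages[where P = "\<lambda>k h. \<exists>b. h = (\<lambda>x v. b)" and h\<^sub>0 = "\<lambda>x v. a"])
    (auto intro: has_dir_deriv_const)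

lemma mb_smooth_on_linear:
  fixes l :: "'e::locally_convex_space \<Rightarrow> 'f::locally_convex_space"
  assumes "linear l" "continuous_on UNIV l" "open S"
  shows "mb_smooth_on S l"
proof (rule mb_smooth_on_stages[where h\<^sub>0 = "\<lambda>x v. l x" and
      P = "\<lambda>k h. (k = 0 \<and> h = (\<lambda>x v. l x)) \<or> (k > 0 \<and> (h = (\<lambda>x v. l (v 0)) \<or> h = (\<lambda>x v. 0)))"])
  fix k :: nat and h :: "'e \<Rightarrow> (nat \<Rightarrow> 'e) \<Rightarrow> 'f"
  assume h: "(k = 0 \<and> h = (\<lambda>x v. l x)) \<or> (k > 0 \<and> (h = (\<lambda>x v. l (v 0)) \<or> h = (\<lambda>x v. 0)))"
  have "continuous_on (S \<times> UNIV) (\<lambda>p. snd p (0::nat))"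
    by (rule continuous_on_snd_coordinate)
  from continuous_on_compose2[OF assms(2) this]
    continuous_on_compose2[OF assms(2) continuous_on_fst[OF continuous_on_id]]
  have "continuous_on (S \<times> UNIV) (\<lambda>p. l (snd p (0::nat)))"
    "continuous_on (S \<times> UNIV) (\<lambda>p::'e \<times> (nat \<Rightarrow> 'e). l (fst p))"
    by simp_all
  then show "continuous_on (S \<times> UNIV) (\<lambda>(x, v). h x v)" using h by (auto simp: case_prod_unfold)
  show "\<exists>h'. ((Suc k = 0 \<and> h' = (\<lambda>x v. l x)) \<or> (Suc k > 0 \<and> (h' = (\<lambda>x v. l (v 0)) \<or> h' = (\<lambda>x v. 0)))) \<and>
      (\<forall>x\<in>S. \<forall>v. has_dir_deriv (\<lambda>y. h y v) x (v k) (h' x v))"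
  proof (cases "k = 0")
    case True
    then show ?thesis using h has_dir_deriv_linear[OF assms(1)]
      by (intro exI[of _ "\<lambda>x v. l (v 0)"]) simp
  next
    case False
    then have "has_dir_deriv (\<lambda>y. h y v) x (v k) 0" for x v
      using h by (auto simp: has_dir_deriv_const)
    then show ?thesis by (intro exI[of _ "\<lambda>x v. 0"]) simp
  qed
qed (auto simp: assms)

text \<open>
  Since \<open>iter_deriv f k\<close> is the \<open>k\<close>-fold application of directional derivatives, additivity in the
  slot \<open>j\<close> is additivity of the derivative taken at stage \<open>j\<close>, and the later derivatives preserve it.
\<close>
lemma iter_deriv_slot_add:
  assumes f: "mb_smooth_on S f" and "x \<in> S" "j < n"
  shows "iter_deriv f n x (v(j := a + b)) = iter_deriv f n x (v(j := a)) + iter_deriv f n x (v(j := b))"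
  using assms(2,3)
proof (induction n arbitrary: x)
  case (Suc n)
  note x = \<open>x \<in> S\<close>
  have hd: "has_dir_deriv (\<lambda>y. iter_deriv f n y u) x w (iter_deriv f (Suc n) x (u(n := w)))" for u w
    by (rule has_dir_deriv_iter_deriv[OF f x])
  show ?case
  proof (cases "j = n")
    case True
    have "iter_deriv f (Suc n) x (v(j := w)) = dir_deriv (\<lambda>y. iter_deriv f n y v) x w" for w
      using has_dir_derivD(2)[OF hd[of v w]] True by simp
    then show ?thesis using C1_on_add_dir[OF C1_on_iter_deriv[OF f] x] by metis
  next
    case False
    then have j: "j < n" using Suc by simp
    have hd': "has_dir_deriv (\<lambda>y. iter_deriv f n y (v(j := w))) x (v n) (iter_deriv f (Suc n) x (v(j := w)))" for w
      using hd[of "v(j := w)" "v n"] False by (simp add: fun_upd_twist[of j n])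
    have "has_dir_deriv (\<lambda>y. iter_deriv f n y (v(j := a + b))) x (v n)
        (iter_deriv f (Suc n) x (v(j := a)) + iter_deriv f (Suc n) x (v(j := b)))"
      by (rule iffD2[OF has_dir_deriv_cong[OF mb_smooth_on_open[OF f] x]
          has_dir_deriv_add[OF hd'[of a] hd'[of b]]]) (rule Suc.IH[OF _ j])
    then show ?thesis by (rule has_dir_deriv_unique[OF hd'])
  qed
qed simp

lemma iter_deriv_slot_scaleR:
  assumes f: "mb_smooth_on S f" and "x \<in> S" "j < n"
  shows "iter_deriv f n x (v(j := c *\<^sub>R a)) = c *\<^sub>R iter_deriv f n x (v(j := a))"
  using assms(2,3)
proof (induction n arbitrary: x)
  case (Suc n)
  note x = \<open>x \<in> S\<close>
  have hd: "has_dir_deriv (\<lambda>y. iter_deriv f n y u) x w (iter_deriv f (Suc n) x (u(n := w)))" for u w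
    by (rule has_dir_deriv_iter_deriv[OF f x])
  show ?case
  proof (cases "j = n")
    case True
    then show ?thesis
      using has_dir_deriv_unique[OF hd has_dir_deriv_scale_dir[OF hd[of v a]], of c] by blast
  next
    case False
    then have j: "j < n" using Suc by simp
    have hd': "has_dir_deriv (\<lambda>y. iter_deriv f n y (v(j := w))) x (v n) (iter_deriv f (Suc n) x (v(j := w)))" for w
      using hd[of "v(j := w)" "v n"] False by (simp add: fun_upd_twist[of j n])
    have "has_dir_deriv (\<lambda>y. iter_deriv f n y (v(j := c *\<^sub>R a))) x (v n) (c *\<^sub>R iter_deriv f (Suc n) x (v(j := a)))"
      by (rule iffD2[OF has_dir_deriv_cong[OF mb_smooth_on_open[OF f] x]
          has_dir_deriv_scaleR[OF hd'[of a]]]) (rule Suc.IH[OF _ j])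
    then show ?thesis by (rule has_dir_deriv_unique[OF hd'])
  qed
qed simp

lemma has_dir_deriv_imp_tendsto:
  assumes "has_dir_deriv f x v l"
  shows "((\<lambda>t. f (x + t *\<^sub>R v)) \<longlongrightarrow> f x) (at 0)"
proof -
  have "((\<lambda>t. f x + t *\<^sub>R ((1 / t) *\<^sub>R (f (x + t *\<^sub>R v) - f x))) \<longlongrightarrow> f x) (at 0)"
    using tendsto_add[OF tendsto_const tendsto_scaleR_lc[OF tendsto_ident_at assms[unfolded has_dir_deriv_def]], of "f x"]
    by simp
  then show ?thesis
    by (rule Lim_transform_eventually) (auto simp: eventually_at_filter)
qed

text \<open>
  The product rule for the multilinear expression \<open>d\<^sup>ng(F(y); U\<^sub>0(y), \<dots>, U\<^bsub>n-1\<^esub>(y))\<close>: the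
  arguments are moved one after the other, first \<open>F\<close> and then the slots \<open>0, \<dots>, n - 1\<close>.
\<close>
lemma has_dir_deriv_iter_deriv_comp:
  assumes g: "mb_smooth_on T g" and T: "F x \<in> T" and F: "has_dir_deriv F x v y'"
    and U: "\<And>j. j < n \<Longrightarrow> has_dir_deriv (U j) x v (u' j)"
  shows "has_dir_deriv (\<lambda>y. iter_deriv g n (F y) (\<lambda>j. U j y)) x v
    (iter_deriv g (Suc n) (F x) ((\<lambda>j. U j x)(n := y')) +
      (\<Sum>j<n. iter_deriv g n (F x) ((\<lambda>j. U j x)(j := u' j))))"
proof -
  define F\<^sub>t where "F\<^sub>t t = F (x + t *\<^sub>R v)" for t
  define w where "w m t j = (if j < m then U j (x + t *\<^sub>R v) else U j x)" for m t j
  define q where "q j t = (1 / t) *\<^sub>R (U j (x + t *\<^sub>R v) - U j x)" for j t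
  let ?U0 = "\<lambda>j. U j x"
  let ?D = "\<lambda>y u. iter_deriv g n y u"
  have Ft: "(F\<^sub>t \<longlongrightarrow> F x) (at 0)" unfolding F\<^sub>t_def by (rule has_dir_deriv_imp_tendsto[OF F])
  have evT: "\<forall>\<^sub>F t in at 0. F\<^sub>t t \<in> T" using topological_tendstoD[OF Ft mb_smooth_on_open[OF g] T] .
  have lim: "m \<le> n \<Longrightarrow> ((\<lambda>t. (1 / t) *\<^sub>R (?D (F\<^sub>t t) (w m t) - ?D (F x) ?U0)) \<longlongrightarrow>
      iter_deriv g (Suc n) (F x) (?U0(n := y')) + (\<Sum>j<m. ?D (F x) (?U0(j := u' j)))) (at 0)" for m
  proof (induction m)
    case 0
    have "has_dir_deriv (\<lambda>y. ?D (F y) ?U0) x v (iter_deriv g (Suc n) (F x) (?U0(n := y')))"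
      using C1_on_chain[where g = "\<lambda>y. ?D y ?U0", OF C1_on_iter_deriv[OF g] T F]
        has_dir_derivD(2)[OF has_dir_deriv_iter_deriv[OF g T, of n ?U0 y']] by simp
    then show ?case by (simp add: has_dir_deriv_def F\<^sub>t_def w_def fun_upd_def)
  next
    case (Suc m)
    then have m: "m < n" by simp
    have "((\<lambda>t. ((w m t)(m := q m t)) j) \<longlongrightarrow> (?U0(m := u' m)) j) (at 0)" for j
      using U[OF m] has_dir_deriv_imp_tendsto[OF U[of j]] m
      by (cases "j < m") (auto simp: w_def q_def has_dir_deriv_def)
    from tendsto_iter_deriv[OF g T Ft this]
    have lim: "((\<lambda>t. ?D (F\<^sub>t t) ((w m t)(m := q m t))) \<longlongrightarrow> ?D (F x) (?U0(m := u' m))) (at 0)" .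
    have "\<forall>\<^sub>F t in at (0::real). t \<noteq> 0" by (auto simp: eventually_at_filter)
    with evT have "\<forall>\<^sub>F t in at 0. (1 / t) *\<^sub>R (?D (F\<^sub>t t) (w m t) - ?D (F x) ?U0) + ?D (F\<^sub>t t) ((w m t)(m := q m t))
      = (1 / t) *\<^sub>R (?D (F\<^sub>t t) (w (Suc m) t) - ?D (F x) ?U0)"
    proof eventually_elim
      case (elim t)
      have "w (Suc m) t = (w m t)(m := U m x + t *\<^sub>R q m t)" "(w m t)(m := U m x) = w m t"
        using elim(2) by (auto simp: w_def q_def fun_eq_iff)
      then have "?D (F\<^sub>t t) (w (Suc m) t) = ?D (F\<^sub>t t) (w m t) + t *\<^sub>R ?D (F\<^sub>t t) ((w m t)(m := q m t))"
        using iter_deriv_slot_add[OF g elim(1) m] iter_deriv_slot_scaleR[OF g elim(1) m] by simp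
      then show ?case using elim(2) by (simp add: scaleR_right_diff_distrib scaleR_right_distrib)
    qed
    from Lim_transform_eventually[OF tendsto_add[OF Suc.IH[OF less_imp_le[OF m]] lim] this]
    show ?case by (simp only: sum.lessThan_Suc add.assoc)
  qed
  have "iter_deriv g n (F\<^sub>t t) (w n t) = ?D (F (x + t *\<^sub>R v)) (\<lambda>j. U j (x + t *\<^sub>R v))" for t
    unfolding F\<^sub>t_def by (rule iter_deriv_cong_dirs) (simp add: w_def)
  with lim[of n] show ?thesis unfolding has_dir_deriv_def by (simp add: F\<^sub>t_def)
qed

text \<open>
  The functions spanned by the terms of Faa di Bruno's formula for the iterated derivatives of
  \<open>x \<mapsto> d\<^sup>ng(F(x); W\<^sub>0(x), W\<^sub>1(x), \<dots>)\<close>. The maps \<open>\<pi> j\<close> record which of the directions are fed into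
  the slot \<open>j\<close>. The maps \<open>W j\<close> vary with the summand, since differentiating the base point \<open>F(x)\<close> fills
  a new slot with a derivative of \<open>F\<close>.
\<close>
inductive faa_di_bruno ::
    "'e::locally_convex_space set \<Rightarrow> ('f::locally_convex_space \<Rightarrow> 'g::locally_convex_space) \<Rightarrow> ('e \<Rightarrow> 'f) \<Rightarrow>
      ('e \<Rightarrow> (nat \<Rightarrow> 'e) \<Rightarrow> 'g) \<Rightarrow> bool" for S g F where
  summand: "(\<And>j. mb_smooth_on S (W j)) \<Longrightarrow>
    faa_di_bruno S g F (\<lambda>x v. iter_deriv g n (F x) (\<lambda>j. iter_deriv (W j) (ns j) x (\<lambda>i. v (\<pi> j i))))"
| add: "faa_di_bruno S g F h \<Longrightarrow> faa_di_bruno S g F h' \<Longrightarrow> faa_di_bruno S g F (\<lambda>x v. h x v + h' x v)"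

lemma faa_di_bruno_sum:
  fixes n :: nat
  assumes "faa_di_bruno S g F h" "\<And>j. j < n \<Longrightarrow> faa_di_bruno S g F (H j)"
  shows "faa_di_bruno S g F (\<lambda>x v. h x v + (\<Sum>j<n. H j x v))"
  using assms(2)
proof (induction n)
  case (Suc n)
  have "faa_di_bruno S g F (\<lambda>x v. (h x v + (\<Sum>j<n. H j x v)) + H n x v)"
    by (rule faa_di_bruno.add[OF Suc.IH Suc.prems]) (auto intro: Suc.prems)
  then show ?case by (simp add: add.assoc)
qed (simp add: assms(1))

lemma continuous_on_faa_di_bruno:
  assumes "faa_di_bruno S g F h" and g: "mb_smooth_on T g" and F: "mb_smooth_on S F"
  shows "continuous_on ((S \<inter> F -` T) \<times> UNIV) (\<lambda>(x, v). h x v)"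
  using assms(1)
proof induction
  case (summand W n ns \<pi>)
  have "continuous_on ((S \<inter> F -` T) \<times> UNIV) (\<lambda>p. iter_deriv g n (F (fst p))
      (\<lambda>j. iter_deriv (W j) (ns j) (fst p) (\<lambda>i. snd p (\<pi> j i))))"
  proof (intro continuous_on_iter_deriv[OF g] continuous_on_iter_deriv[OF summand])
    show "continuous_on ((S \<inter> F -` T) \<times> UNIV) (\<lambda>p. F (fst p))"
      by (rule continuous_on_compose2[OF mb_smooth_on_continuous[OF F]]) (auto intro: continuous_intros)
  qed (auto intro: continuous_on_snd_coordinate continuous_on_fst continuous_on_id)
  then show ?case by (simp add: case_prod_unfold)
next
  case (add h h')
  then show ?case by (auto simp: case_prod_unfold intro: continuous_on_add)
qed

lemma has_dir_deriv_faa_di_bruno: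
  assumes "faa_di_bruno S g F h" and g: "mb_smooth_on T g" and F: "mb_smooth_on S F"
  shows "\<exists>h'. faa_di_bruno S g F h' \<and>
    (\<forall>x\<in>S \<inter> F -` T. \<forall>v. has_dir_deriv (\<lambda>y. h y v) x (v k) (h' x v))"
  using assms(1)
proof induction
  case (summand W n ns \<pi>)
  let ?T = "\<lambda>W n ns \<pi> x v. iter_deriv g n (F x) (\<lambda>j. iter_deriv (W j) (ns j) x (\<lambda>i. v (\<pi> j i)))"
  let ?h = "\<lambda>x v. ?T (W(n := F)) (Suc n) (ns(n := 1)) (\<pi>(n := \<lambda>_. k)) x v +
    (\<Sum>j<n. ?T W n (ns(j := Suc (ns j))) (\<pi>(j := (\<pi> j)(ns j := k))) x v)"
  have "faa_di_bruno S g F ?h"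
    by (intro faa_di_bruno_sum faa_di_bruno.summand) (auto simp: summand F)
  moreover have "has_dir_deriv (\<lambda>y. ?T W n ns \<pi> y v) x (v k) (?h x v)" if x: "x \<in> S \<inter> F -` T" for x v
  proof -
    have 1: "has_dir_deriv F x (v k) (iter_deriv F 1 x (\<lambda>_. v k))"
      using has_dir_deriv_smooth[OF F] x by (simp add: iter_deriv.simps(2))
    have upd: "(\<lambda>i. v (\<pi> j i))(ns j := v k) = (\<lambda>i. v (((\<pi> j)(ns j := k)) i))" for j
      by (auto simp: fun_eq_iff)
    have 2: "has_dir_deriv (\<lambda>y. iter_deriv (W j) (ns j) y (\<lambda>i. v (\<pi> j i))) x (v k)
        (iter_deriv (W j) (Suc (ns j)) x (\<lambda>i. v (((\<pi> j)(ns j := k)) i)))" for j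
      using has_dir_deriv_iter_deriv[OF summand, of x j "ns j" "\<lambda>i. v (\<pi> j i)" "v k"] x
      unfolding upd by blast
    have 3: "(\<lambda>j. iter_deriv (W j) (ns j) x (\<lambda>i. v (\<pi> j i)))(m := iter_deriv W' n' x (\<lambda>i. v (\<pi>' i)))
      = (\<lambda>j. iter_deriv ((W(m := W')) j) ((ns(m := n')) j) x (\<lambda>i. v ((\<pi>(m := \<pi>')) j i)))" for m W' n' \<pi>'
      by (auto simp: fun_eq_iff)
    from x have "F x \<in> T" by simp
    from has_dir_deriv_iter_deriv_comp[where U = "\<lambda>j y. iter_deriv (W j) (ns j) y (\<lambda>i. v (\<pi> j i))", OF g this 1 2]
    show ?thesis by (simp only: 3 fun_upd_triv)
  qed
  ultimately show ?case by blast
next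
  case (add h1 h2)
  then obtain h1' h2' where
    "faa_di_bruno S g F h1'" "\<forall>x\<in>S \<inter> F -` T. \<forall>v. has_dir_deriv (\<lambda>y. h1 y v) x (v k) (h1' x v)"
    "faa_di_bruno S g F h2'" "\<forall>x\<in>S \<inter> F -` T. \<forall>v. has_dir_deriv (\<lambda>y. h2 y v) x (v k) (h2' x v)"
    by blast
  then show ?case
    by (intro exI[of _ "\<lambda>x v. h1' x v + h2' x v"]) (auto intro: faa_di_bruno.add has_dir_deriv_add)
qed

text \<open>
  The common source of the closure properties used below: \<open>n = 0\<close> is smoothness of compositions, and
  \<open>n = 1\<close> is smoothness of the derivative in a direction that depends smoothly on the point.
\<close>
lemma mb_smooth_on_iter_deriv:
  assumes g: "mb_smooth_on T g" and F: "mb_smooth_on S F" and W: "\<And>j. mb_smooth_on S (W j)"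
  shows "mb_smooth_on (S \<inter> F -` T) (\<lambda>x. iter_deriv g n (F x) (\<lambda>j. W j x))"
proof (rule mb_smooth_on_stages[where P = "\<lambda>_. faa_di_bruno S g F"
      and h\<^sub>0 = "\<lambda>x v. iter_deriv g n (F x) (\<lambda>j. iter_deriv (W j) 0 x (\<lambda>i. v i))"])
  show "open (S \<inter> F -` T)"
    using mb_smooth_on_continuous[OF F] continuous_on_open_vimage[OF mb_smooth_on_open[OF F], of F]
      mb_smooth_on_open[OF g] by (metis Int_commute)
  show "faa_di_bruno S g F (\<lambda>x v. iter_deriv g n (F x) (\<lambda>j. iter_deriv (W j) 0 x (\<lambda>i. v i)))"
    by (rule faa_di_bruno.summand[of S W g F n "\<lambda>_. 0" "\<lambda>_ i. i"]) (rule W)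
qed (use continuous_on_faa_di_bruno[OF _ g F] has_dir_deriv_faa_di_bruno[OF _ g F] in auto)

lemma mb_smooth_on_compose:
  assumes "mb_smooth_on T g" "mb_smooth_on S f"
  shows "mb_smooth_on (S \<inter> f -` T) (\<lambda>x. g (f x))"
  using mb_smooth_on_iter_deriv[OF assms, of "\<lambda>_. f" 0] assms(2) by simp

lemma mb_smooth_on_dir_deriv:
  assumes "mb_smooth_on T g" "mb_smooth_on S f" "mb_smooth_on S w"
  shows "mb_smooth_on (S \<inter> f -` T) (\<lambda>x. dir_deriv g (f x) (w x))"
  using mb_smooth_on_iter_deriv[OF assms(1,2), of "\<lambda>_. w" 1] assms(3) by (simp add: iter_deriv.simps(2))

section \<open>Functions with values in a normed space\<close>

lemma has_dir_deriv_line: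
  assumes "has_dir_deriv f (x + s *\<^sub>R v) v l"
  shows "has_dir_deriv (\<lambda>t. f (x + t *\<^sub>R v)) s 1 l"
  using assms by (simp add: has_dir_deriv_def scaleR_left_distrib add.assoc)

lemma has_dir_deriv_bounded_bilinear:
  fixes f :: "'e::locally_convex_space \<Rightarrow> 'a::real_normed_vector" and g :: "'e \<Rightarrow> 'b::real_normed_vector"
    and prod :: "'a \<Rightarrow> 'b \<Rightarrow> 'c::real_normed_vector"
  assumes b: "bounded_bilinear prod" and f: "has_dir_deriv f x v l" and g: "has_dir_deriv g x v m"
  shows "has_dir_deriv (\<lambda>y. prod (f y) (g y)) x v (prod (f x) m + prod l (g x))"
proof -
  interpret bounded_bilinear prod by (rule b)
  let ?q = "\<lambda>f t. (1 / t) *\<^sub>R (f (x + t *\<^sub>R v) - f x)"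
  have "((\<lambda>t. prod (f (x + t *\<^sub>R v)) (?q g t) + prod (?q f t) (g x)) \<longlongrightarrow> prod (f x) m + prod l (g x)) (at 0)"
    using f g has_dir_deriv_imp_tendsto[OF f]
    by (intro tendsto_add tendsto tendsto_const) (auto simp: has_dir_deriv_def)
  moreover have "prod (f (x + t *\<^sub>R v)) (?q g t) + prod (?q f t) (g x) = ?q (\<lambda>y. prod (f y) (g y)) t" for t
    by (simp add: scaleR_right scaleR_left diff_right diff_left scaleR_right_diff_distrib)
  ultimately show ?thesis by (simp add: has_dir_deriv_def)
qed

lemma increment_bound:
  fixes \<gamma> :: "real \<Rightarrow> 'a::real_normed_vector"
  assumes d: "\<And>s. \<bar>s\<bar> \<le> \<bar>t\<bar> \<Longrightarrow> has_dir_deriv \<gamma> s 1 (\<gamma>' s)"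
    and b: "\<And>s. \<bar>s\<bar> \<le> \<bar>t\<bar> \<Longrightarrow> norm (\<gamma>' s - D) < \<epsilon>"
  shows "norm (\<gamma> t - \<gamma> 0 - t *\<^sub>R D) \<le> \<bar>t\<bar> * \<epsilon>"
proof -
  have *: "norm (\<gamma> q - \<gamma> p - (q - p) *\<^sub>R D) \<le> (q - p) * \<epsilon>" if pq: "p < q" "\<bar>p\<bar> \<le> \<bar>t\<bar>" "\<bar>q\<bar> \<le> \<bar>t\<bar>" for p q
  proof -
    have "(1 / (q - p)) *\<^sub>R (\<gamma> q - \<gamma> p) \<in> ball D \<epsilon>"
    proof (rule mean_value_convex[OF pq(1)])
      fix s assume "p \<le> s" "s \<le> q"
      then have s: "\<bar>s\<bar> \<le> \<bar>t\<bar>" using pq by linarith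
      show "((\<lambda>t. (1 / t) *\<^sub>R (\<gamma> (s + t) - \<gamma> s)) \<longlongrightarrow> \<gamma>' s) (at 0)"
        using d[OF s] by (simp add: has_dir_deriv_def)
      show "\<gamma>' s \<in> ball D \<epsilon>" using b[OF s] by (simp add: dist_norm norm_minus_commute)
    qed auto
    then have "norm ((1 / (q - p)) *\<^sub>R (\<gamma> q - \<gamma> p) - D) \<le> \<epsilon>"
      by (simp add: dist_norm norm_minus_commute)
    then have "(q - p) * norm ((1 / (q - p)) *\<^sub>R (\<gamma> q - \<gamma> p) - D) \<le> (q - p) * \<epsilon>"
      using pq(1) by simp
    moreover have "(q - p) * norm ((1 / (q - p)) *\<^sub>R (\<gamma> q - \<gamma> p) - D) =
        norm ((q - p) *\<^sub>R ((1 / (q - p)) *\<^sub>R (\<gamma> q - \<gamma> p) - D))"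
      using pq(1) by simp
    moreover have "(q - p) *\<^sub>R ((1 / (q - p)) *\<^sub>R (\<gamma> q - \<gamma> p) - D) = \<gamma> q - \<gamma> p - (q - p) *\<^sub>R D"
      using pq(1) by (simp add: scaleR_right_diff_distrib)
    ultimately show ?thesis by metis
  qed
  consider "t > 0" | "t = 0" | "t < 0" by linarith
  then show ?thesis
  proof cases
    case 1
    then show ?thesis using *[of 0 t] by simp
  next
    case 3
    then have "norm (\<gamma> 0 - \<gamma> t - (0 - t) *\<^sub>R D) \<le> (0 - t) * \<epsilon>" by (intro *) auto
    moreover have "\<gamma> 0 - \<gamma> t - (0 - t) *\<^sub>R D = - (\<gamma> t - \<gamma> 0 - t *\<^sub>R D)" by simp
    ultimately show ?thesis using 3 by (metis abs_of_neg diff_0 norm_minus_cancel)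
  qed simp
qed

text \<open>
  Both mixed derivatives are the limit of \<open>\<Delta>(h) / h\<^sup>2\<close> for the second difference
  \<open>\<Delta>(h) = f(x + ha + hb) - f(x + ha) - f(x + hb) + f(x)\<close>, which is symmetric in \<open>a\<close> and \<open>b\<close>.
\<close>
lemma second_difference_limit:
  fixes f :: "'e::locally_convex_space \<Rightarrow> 'a::real_normed_vector"
  assumes f: "mb_smooth_on S f" and x: "x \<in> S"
  shows "((\<lambda>h. (1 / h\<^sup>2) *\<^sub>R (f (x + h *\<^sub>R a + h *\<^sub>R b) - f (x + h *\<^sub>R a) - (f (x + h *\<^sub>R b) - f x)))
    \<longlongrightarrow> iter_deriv f 2 x ((\<lambda>_. a)(1 := b))) (at_right 0)"
proof (rule tendstoI)
  fix \<epsilon> :: real assume "\<epsilon> > 0"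
  let ?v = "(\<lambda>_. a)(1 := b)"
  let ?D = "iter_deriv f 2 x ?v"
  let ?z = "\<lambda>p. x + fst p *\<^sub>R a + snd p *\<^sub>R b"
  let ?W = "{y \<in> S. norm (iter_deriv f 2 y ?v - ?D) < \<epsilon> / 4}"
  have cz: "continuous_on UNIV ?z"
    by (intro continuous_on_add continuous_on_scaleR_lc continuous_on_fst continuous_on_snd
        continuous_on_const continuous_on_id)
  have "continuous_on S (\<lambda>y. iter_deriv f 2 y ?v)"
    by (intro continuous_on_iter_deriv[OF f] continuous_on_id continuous_on_const) auto
  then have "open ((\<lambda>y. iter_deriv f 2 y ?v) -` ball ?D (\<epsilon> / 4) \<inter> S)"
    using continuous_on_open_vimage[OF mb_smooth_on_open[OF f]] by blast
  moreover have "(\<lambda>y. iter_deriv f 2 y ?v) -` ball ?D (\<epsilon> / 4) \<inter> S = ?W"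
    by (auto simp: dist_norm norm_minus_commute)
  ultimately have "open ?W" by simp
  then have "open (?z -` ?W)" by (rule open_vimage[OF _ cz])
  moreover have "(0, 0) \<in> ?z -` ?W" using x \<open>\<epsilon> > 0\<close> by simp
  ultimately obtain A B where AB: "open A" "open B" "(0::real, 0::real) \<in> A \<times> B" "A \<times> B \<subseteq> ?z -` ?W"
    by (rule open_prod_elim)
  then have "open (A \<inter> B)" "0 \<in> A \<inter> B" by auto
  then obtain \<delta> where \<delta>: "\<delta> > 0" "ball 0 \<delta> \<subseteq> A \<inter> B" using open_contains_ball by metis
  have inW: "?z (s, t) \<in> ?W" if "\<bar>s\<bar> < \<delta>" "\<bar>t\<bar> < \<delta>" for s t
  proof -
    have "s \<in> A" "t \<in> B" using that \<delta>(2) by (auto simp: subset_iff)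
    then have "(s, t) \<in> ?z -` ?W" using AB(4) by blast
    then show ?thesis by simp
  qed
  have inS: "x + s *\<^sub>R a + t *\<^sub>R b \<in> S" if "\<bar>s\<bar> < \<delta>" "\<bar>t\<bar> < \<delta>" for s t
    using inW[OF that] by simp
  have main: "norm (f (x + h *\<^sub>R a + h *\<^sub>R b) - f (x + h *\<^sub>R a) - (f (x + h *\<^sub>R b) - f x) - h\<^sup>2 *\<^sub>R ?D)
      \<le> h * (h * (\<epsilon> / 2))" if h: "0 < h" "h < \<delta>" for h
  proof -
    have comm: "x + s *\<^sub>R a + t *\<^sub>R b = x + t *\<^sub>R b + s *\<^sub>R a" for s t by (simp add: add_ac)
    let ?\<phi> = "\<lambda>s. f (x + h *\<^sub>R b + s *\<^sub>R a) - f (x + s *\<^sub>R a)"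
    let ?\<phi>' = "\<lambda>s. dir_deriv f (x + h *\<^sub>R b + s *\<^sub>R a) a - dir_deriv f (x + s *\<^sub>R a) a"
    have "norm (?\<phi> h - ?\<phi> 0 - h *\<^sub>R (h *\<^sub>R ?D)) \<le> \<bar>h\<bar> * (h * (\<epsilon> / 2))"
    proof (rule increment_bound[where \<gamma>' = ?\<phi>'])
      fix s assume "\<bar>s\<bar> \<le> \<bar>h\<bar>"
      then have s: "\<bar>s\<bar> < \<delta>" using h by simp
      have 1: "has_dir_deriv (\<lambda>s. f (y + s *\<^sub>R a)) s 1 (dir_deriv f (y + s *\<^sub>R a) a)"
        if "y + s *\<^sub>R a \<in> S" for y
        by (rule has_dir_deriv_line[OF has_dir_deriv_smooth[OF f that]])
      have "x + h *\<^sub>R b + s *\<^sub>R a \<in> S" "x + s *\<^sub>R a \<in> S"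
        using inS[OF s, of h] inS[OF s, of 0] h by (simp_all add: comm)
      from has_dir_deriv_add[OF 1[OF this(1)] has_dir_deriv_scaleR[OF 1[OF this(2)], of "-1"]]
      show "has_dir_deriv ?\<phi> s 1 (?\<phi>' s)" by simp
      let ?\<psi> = "\<lambda>t. dir_deriv f (x + s *\<^sub>R a + t *\<^sub>R b) a"
      have "norm (?\<psi> h - ?\<psi> 0 - h *\<^sub>R ?D) \<le> \<bar>h\<bar> * (\<epsilon> / 4)"
      proof (rule increment_bound[where \<gamma>' = "\<lambda>t. iter_deriv f 2 (x + s *\<^sub>R a + t *\<^sub>R b) ?v"])
        fix t assume "\<bar>t\<bar> \<le> \<bar>h\<bar>"
        then have t: "\<bar>t\<bar> < \<delta>" using h by simp
        show "has_dir_deriv ?\<psi> t 1 (iter_deriv f 2 (x + s *\<^sub>R a + t *\<^sub>R b) ?v)"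
          using has_dir_deriv_line[OF has_dir_deriv_iter_deriv[OF f inS[OF s t], of 1 "\<lambda>_. a" b]]
          by (simp add: iter_deriv.simps(2) numeral_2_eq_2)
        show "norm (iter_deriv f 2 (x + s *\<^sub>R a + t *\<^sub>R b) ?v - ?D) < \<epsilon> / 4"
          using inW[OF s t] by simp
      qed
      also have "\<dots> < h * (\<epsilon> / 2)" using h \<open>\<epsilon> > 0\<close> by simp
      finally show "norm (?\<phi>' s - h *\<^sub>R ?D) < h * (\<epsilon> / 2)" by (simp add: comm)
    qed
    then show ?thesis using h by (simp add: comm power2_eq_square)
  qed
  have "dist ((1 / h\<^sup>2) *\<^sub>R (f (x + h *\<^sub>R a + h *\<^sub>R b) - f (x + h *\<^sub>R a) - (f (x + h *\<^sub>R b) - f x))) ?D < \<epsilon>"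
    if h: "0 < h" "h < \<delta>" for h
  proof -
    let ?\<Delta> = "f (x + h *\<^sub>R a + h *\<^sub>R b) - f (x + h *\<^sub>R a) - (f (x + h *\<^sub>R b) - f x)"
    have "(1 / h\<^sup>2) *\<^sub>R ?\<Delta> - ?D = (1 / h\<^sup>2) *\<^sub>R (?\<Delta> - h\<^sup>2 *\<^sub>R ?D)"
      using h by (simp add: scaleR_right_diff_distrib)
    then have "dist ((1 / h\<^sup>2) *\<^sub>R ?\<Delta>) ?D = (1 / h\<^sup>2) * norm (?\<Delta> - h\<^sup>2 *\<^sub>R ?D)"
      by (simp add: dist_norm)
    also have "\<dots> \<le> (1 / h\<^sup>2) * (h * (h * (\<epsilon> / 2)))" using main[OF h] by (intro mult_left_mono) auto
    also have "\<dots> < \<epsilon>" using h \<open>\<epsilon> > 0\<close> by (simp add: power2_eq_square)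
    finally show ?thesis .
  qed
  then show "\<forall>\<^sub>F h in at_right 0. dist ((1 / h\<^sup>2) *\<^sub>R
      (f (x + h *\<^sub>R a + h *\<^sub>R b) - f (x + h *\<^sub>R a) - (f (x + h *\<^sub>R b) - f x))) ?D < \<epsilon>"
    using \<delta>(1) by (auto simp: eventually_at_right)
qed

lemma second_derivative_symmetric:
  fixes f :: "'e::locally_convex_space \<Rightarrow> 'a::real_normed_vector"
  assumes f: "mb_smooth_on S f" and x: "x \<in> S"
  shows "iter_deriv f 2 x ((\<lambda>_. a)(1 := b)) = iter_deriv f 2 x ((\<lambda>_. b)(1 := a))"
proof (rule tendsto_unique[OF _ second_difference_limit[OF f x]])
  have "f (x + h *\<^sub>R a + h *\<^sub>R b) - f (x + h *\<^sub>R a) - (f (x + h *\<^sub>R b) - f x) =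
      f (x + h *\<^sub>R b + h *\<^sub>R a) - f (x + h *\<^sub>R b) - (f (x + h *\<^sub>R a) - f x)" for h
    by (simp add: add_ac)
  then show "((\<lambda>h. (1 / h\<^sup>2) *\<^sub>R (f (x + h *\<^sub>R a + h *\<^sub>R b) - f (x + h *\<^sub>R a) - (f (x + h *\<^sub>R b) - f x)))
    \<longlongrightarrow> iter_deriv f 2 x ((\<lambda>_. b)(1 := a))) (at_right 0)"
    by (intro Lim_transform_eventually[OF second_difference_limit[OF f x, of b a]] always_eventually) metis
qed simp

section \<open>Sequences in a locally convex space\<close>

text \<open>
  With the product topology, sequences form a locally convex space, and the expressions
  \<open>d\<rho>(v\<^sub>0) \<cdots> d\<rho>(v\<^bsub>k-1\<^esub>) \<psi>\<close> become smooth functions of the sequence \<open>v\<close>. The type is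
  separate because the function type already carries a metric for countable domains, which requires
  metric values.
\<close>
typedef 'a sequence = "UNIV :: (nat \<Rightarrow> 'a) set" morphisms entry Sequence ..

lemma entry_Sequence [simp]: "entry (Sequence v) = v"
  by (simp add: Sequence_inverse)

lemma sequence_eqI: "(\<And>i. entry s i = entry t i) \<Longrightarrow> s = t"
  by (metis entry_inject ext)

instantiation sequence :: (real_vector) real_vector
begin
definition "0 = Sequence (\<lambda>_. 0)"
definition "s + t = Sequence (\<lambda>i. entry s i + entry t i)"
definition "s - t = Sequence (\<lambda>i. entry s i - entry t i)"
definition "- s = Sequence (\<lambda>i. - entry s i)"
definition "r *\<^sub>R s = Sequence (\<lambda>i. r *\<^sub>R entry s i)"
instance
  by standard (auto intro!: sequence_eqI simp: zero_sequence_def plus_sequence_def minus_sequence_def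
      uminus_sequence_def scaleR_sequence_def algebra_simps)
end

lemma entry_simps [simp]:
  "entry 0 i = 0" "entry (s + t) i = entry s i + entry t i" "entry (s - t) i = entry s i - entry t i"
  "entry (- s) i = - entry s i" "entry (r *\<^sub>R s) i = r *\<^sub>R entry s i"
  by (simp_all add: zero_sequence_def plus_sequence_def minus_sequence_def
      uminus_sequence_def scaleR_sequence_def)

instantiation sequence :: (topological_space) topological_space
begin
definition open_sequence_def: "open (U :: 'a sequence set) \<longleftrightarrow> open (Sequence -` U)"
instance
proof
  fix K :: "'a sequence set set" assume "\<forall>S\<in>K. open S"
  moreover have "Sequence -` \<Union>K = (\<Union>S\<in>K. Sequence -` S)" by auto
  ultimately show "open (\<Union>K)" by (auto simp: open_sequence_def)
qed (auto simp: open_sequence_def open_Int)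
end

lemma continuous_on_Sequence: "continuous_on UNIV Sequence"
  by (simp add: continuous_on_open_vimage open_sequence_def)

lemma continuous_on_entry: "continuous_on UNIV (\<lambda>s. entry s i)"
proof -
  have "open (entry -` B)" if "open B" for B :: "(nat \<Rightarrow> 'a) set"
    using that by (simp add: open_sequence_def vimage_def)
  then have "continuous_on UNIV (entry :: 'a sequence \<Rightarrow> _)" by (simp add: continuous_on_open_vimage)
  then show ?thesis by (rule continuous_on_product_then_coordinatewise)
qed

lemma tendsto_sequenceI:
  assumes "\<And>i. ((\<lambda>x. entry (f x) i) \<longlongrightarrow> entry l i) F"
  shows "(f \<longlongrightarrow> l) F"
proof -
  have "((\<lambda>x. entry (f x)) \<longlongrightarrow> entry l) F" by (rule tendsto_funI[OF assms])
  from tendsto_compose_continuous_on[OF continuous_on_Sequence open_UNIV UNIV_I this]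
  show ?thesis by (simp add: entry_inverse)
qed

lemma tendsto_entry:
  assumes "(f \<longlongrightarrow> l) F"
  shows "((\<lambda>x. entry (f x) i) \<longlongrightarrow> entry l i) F"
  by (rule tendsto_compose_continuous_on[OF continuous_on_entry open_UNIV UNIV_I assms])

instance sequence :: (t2_space) t2_space
proof
  fix s t :: "'a sequence" assume "s \<noteq> t"
  then obtain i where i: "entry s i \<noteq> entry t i" using sequence_eqI by blast
  then obtain U V where UV: "open U" "open V" "entry s i \<in> U" "entry t i \<in> V" "U \<inter> V = {}"
    using hausdorff[OF i] by blast
  have "open ((\<lambda>s. entry s i) -` U)" "open ((\<lambda>s. entry s i) -` V)"
    using UV by (auto intro: open_vimage[OF _ continuous_on_entry])
  with UV show "\<exists>U V. open U \<and> open V \<and> s \<in> U \<and> t \<in> V \<and> U \<inter> V = {}"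
    by (intro exI[of _ "(\<lambda>s. entry s i) -` U"] exI[of _ "(\<lambda>s. entry s i) -` V"]) auto
qed

instance sequence :: (locally_convex_space) topological_ab_group_add
proof
  fix a b :: "'a sequence"
  show "LIM x (nhds a \<times>\<^sub>F nhds b). fst x + snd x :> nhds (a + b)"
    by (rule tendsto_sequenceI)
      (auto intro!: tendsto_add tendsto_entry simp: filterlim_fst filterlim_snd)
  show "(uminus \<longlongrightarrow> - a) (nhds a)"
    by (rule tendsto_sequenceI) (auto intro!: tendsto_minus tendsto_entry simp: filterlim_ident)
qed

instance sequence :: (locally_convex_space) locally_convex_space
proof
  fix a :: real and b :: "'a sequence"
  show "LIM x (nhds a \<times>\<^sub>F nhds b). fst x *\<^sub>R snd x :> nhds (a *\<^sub>R b)"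
    by (rule tendsto_sequenceI)
      (auto intro!: tendsto_scaleR_lc tendsto_entry simp: filterlim_fst filterlim_snd)
next
  fix S :: "'a sequence set" assume S: "open S" "0 \<in> S"
  then have "openin (product_topology (\<lambda>i. euclidean) UNIV) (Sequence -` S)" "(\<lambda>_. 0) \<in> Sequence -` S"
    by (auto simp: open_sequence_def open_fun_def zero_sequence_def)
  from product_topology_open_contains_basis[OF this] obtain X where
    X: "(\<lambda>_. 0) \<in> Pi\<^sub>E UNIV X" "\<And>i. open (X i)" "finite {i. X i \<noteq> UNIV}" "Pi\<^sub>E UNIV X \<subseteq> Sequence -` S"
    by auto
  have "\<exists>V. open V \<and> (0::'a) \<in> V \<and> V \<subseteq> X i \<and> convex V \<and> (X i = UNIV \<longrightarrow> V = UNIV)" for i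
  proof (cases "X i = UNIV")
    case False
    then show ?thesis using convex_open_nhd[OF X(2), of 0 i] X(1) by (metis PiE_mem UNIV_I)
  qed auto
  then obtain V where V: "\<And>i. open (V i)" "\<And>i. (0::'a) \<in> V i" "\<And>i. V i \<subseteq> X i" "\<And>i. convex (V i)"
    "\<And>i. X i = UNIV \<Longrightarrow> V i = UNIV"
    by metis
  let ?V = "entry -` Pi\<^sub>E UNIV V"
  have "finite {i. V i \<noteq> UNIV}" by (rule finite_subset[OF _ X(3)]) (use V(5) in auto)
  then have "open (Pi\<^sub>E UNIV V)" using V(1) by (intro open_PiE)
  then have "open ?V" by (simp add: open_sequence_def vimage_def)
  moreover have "?V \<subseteq> S"
  proof
    fix s assume "s \<in> ?V"
    then have "entry s \<in> Pi\<^sub>E UNIV X" using V(3) by (auto simp: PiE_iff)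
    then show "s \<in> S" using X(4) by (metis entry_inverse subsetD vimageD)
  qed
  moreover have "(1 - t) *\<^sub>R x + t *\<^sub>R y \<in> ?V" if "x \<in> ?V" "y \<in> ?V" "0 \<le> t" "t \<le> 1" for x y t
    using that convexD_alt[OF V(4)] by (auto simp: PiE_iff)
  ultimately show "\<exists>V. open V \<and> 0 \<in> V \<and> V \<subseteq> S \<and>
      (\<forall>x\<in>V. \<forall>y\<in>V. \<forall>t. 0 \<le> t \<and> t \<le> 1 \<longrightarrow> (1 - t) *\<^sub>R x + t *\<^sub>R y \<in> V)"
    using V(2) by (intro exI[of _ ?V]) auto
qed

section \<open>Complex Hilbert spaces\<close>

lemma cinner_add_left: "cinner (x + y) z = cinner x z + cinner y z"
  for x :: "'h::complex_hilbert_space"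
  by (metis cinner_add_right cinner_commute complex_cnj_add)

lemma cinner_cscale_left: "cinner (cscale a x) y = cnj a * cinner x y"
  for x :: "'h::complex_hilbert_space"
  by (metis cinner_cscale_right cinner_commute complex_cnj_mult)

lemma cscale_1 [simp]: "cscale 1 x = x" for x :: "'h::complex_hilbert_space"
  using cscale_of_real[of 1 x] by simp

lemma cscale_0 [simp]: "cscale 0 x = 0" for x :: "'h::complex_hilbert_space"
  using cscale_of_real[of 0 x] by simp

lemma cinner_self: "cinner x x = complex_of_real ((norm x)\<^sup>2)" for x :: "'h::complex_hilbert_space"
proof -
  have "Im (cinner x x) = 0" using cinner_commute[of x x] by (metis cnj.simps(2) equal_neg_zero)
  moreover have "0 \<le> Re (cinner x x)"
    using norm_ge_zero[of x] by (simp add: norm_eq_sqrt_cinner)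
  ultimately show ?thesis by (simp add: norm_eq_sqrt_cinner complex_eq_iff)
qed

lemma norm_cscale: "norm (cscale a x) = cmod a * norm x" for x :: "'h::complex_hilbert_space"
proof -
  have "complex_of_real ((norm (cscale a x))\<^sup>2) = complex_of_real ((cmod a * norm x)\<^sup>2)"
    unfolding cinner_self[symmetric] cinner_cscale_left cinner_cscale_right
    by (simp only: cinner_self power_mult_distrib of_real_mult complex_norm_square[of a] mult_ac)
  then have "(norm (cscale a x))\<^sup>2 = (cmod a * norm x)\<^sup>2" by (simp only: of_real_eq_iff)
  then show ?thesis by (simp add: power2_eq_iff_nonneg)
qed

text \<open>
  The estimate for the real part is the triangle inequality squared; multiplying \<open>y\<close> by a phase makes
  the scalar product real and nonnegative.
\<close>
lemma cinner_cauchy_schwarz: "cmod (cinner x y) \<le> norm x * norm y"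
  for x y :: "'h::complex_hilbert_space"
proof -
  have re: "Re (cinner u w) \<le> norm u * norm w" for u w :: 'h
  proof -
    have "(norm (u + w))\<^sup>2 \<le> (norm u + norm w)\<^sup>2"
      by (intro power_mono norm_triangle_ineq) simp
    moreover have "complex_of_real ((norm (u + w))\<^sup>2) =
        of_real ((norm u)\<^sup>2) + of_real ((norm w)\<^sup>2) + (cinner u w + cnj (cinner u w))"
      unfolding cinner_self[symmetric] cinner_add_left cinner_add_right
      by (simp add: cinner_commute[of w u])
    then have "(norm (u + w))\<^sup>2 = (norm u)\<^sup>2 + (norm w)\<^sup>2 + 2 * Re (cinner u w)"
      by (metis (no_types, lifting) Re_complex_of_real complex_add_cnj of_real_add)
    ultimately show ?thesis by (simp add: power2_sum)
  qed
  show ?thesis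
  proof (cases "cinner x y = 0")
    case False
    let ?u = "cnj (cinner x y) / of_real (cmod (cinner x y))"
    have "cinner x (cscale ?u y) = of_real (cmod (cinner x y))"
      using False by (simp add: cinner_cscale_right complex_norm_square[symmetric] power2_eq_square
          mult.commute[of "cnj _"])
    moreover have "norm (cscale ?u y) = norm y" using False by (simp add: norm_cscale norm_divide)
    ultimately show ?thesis using re[of x "cscale ?u y"] by simp
  qed simp
qed

lemma bounded_bilinear_cinner: "bounded_bilinear (cinner :: 'h::complex_hilbert_space \<Rightarrow> _)"
proof
  show "\<exists>K. \<forall>a b::'h. norm (cinner a b) \<le> norm a * norm b * K"
    using cinner_cauchy_schwarz by (intro exI[of _ 1]) auto
  fix r and a b :: 'h
  show "cinner (r *\<^sub>R a) b = r *\<^sub>R cinner a b" "cinner a (r *\<^sub>R b) = r *\<^sub>R cinner a b"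
    by (simp_all add: cscale_of_real[symmetric] cinner_cscale_left cinner_cscale_right scaleR_conv_of_real)
qed (simp_all add: cinner_add_left cinner_add_right)

interpretation cinner: bounded_bilinear cinner by (rule bounded_bilinear_cinner)

lemma bounded_bilinear_cscale: "bounded_bilinear (cscale :: complex \<Rightarrow> 'h::complex_hilbert_space \<Rightarrow> 'h)"
proof
  show "\<exists>K. \<forall>a (b::'h). norm (cscale a b) \<le> norm a * norm b * K"
    by (intro exI[of _ 1]) (simp add: norm_cscale)
  fix r a and b :: 'h
  show "cscale (r *\<^sub>R a) b = r *\<^sub>R cscale a b" "cscale a (r *\<^sub>R b) = r *\<^sub>R cscale a b"
    by (simp_all add: cscale_of_real[symmetric] cscale_cscale scaleR_conv_of_real mult.commute)
qed (simp_all add: cscale_add_left cscale_add_right)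

interpretation cscale: bounded_bilinear cscale by (rule bounded_bilinear_cscale)

section \<open>Smooth maps between manifolds in charts\<close>

lemma mb_smooth_on_compose_subset:
  assumes "mb_smooth_on T g" "mb_smooth_on S f" "f ` S \<subseteq> T"
  shows "mb_smooth_on S (\<lambda>x. g (f x))"
proof -
  have "S \<inter> f -` T = S" using assms(3) by auto
  then show ?thesis using mb_smooth_on_compose[OF assms(1,2)] by simp
qed

lemma mb_smooth_on_linear_compose:
  assumes "linear l" "continuous_on UNIV l" "mb_smooth_on S f"
  shows "mb_smooth_on S (\<lambda>x. l (f x))"
  by (rule mb_smooth_on_compose_subset[OF mb_smooth_on_linear[OF assms(1,2) open_UNIV] assms(3)]) simp

lemma mb_smooth_on_id: "open S \<Longrightarrow> mb_smooth_on S (\<lambda>x. x)"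
  by (rule mb_smooth_on_linear) (auto simp: linear_iff)

lemma mb_smooth_on_fst: "mb_smooth_on S f \<Longrightarrow> mb_smooth_on S (\<lambda>x. fst (f x))"
  by (rule mb_smooth_on_linear_compose) (auto simp: linear_iff intro: continuous_on_fst)

lemma mb_smooth_on_snd: "mb_smooth_on S f \<Longrightarrow> mb_smooth_on S (\<lambda>x. snd (f x))"
  by (rule mb_smooth_on_linear_compose) (auto simp: linear_iff intro: continuous_on_snd)

lemma mb_smooth_on_add:
  assumes "mb_smooth_on S f" "mb_smooth_on S g"
  shows "mb_smooth_on S (\<lambda>x. f x + g x)"
proof -
  have "linear (\<lambda>p :: 'b \<times> 'b. fst p + snd p)" by (auto simp: linear_iff scaleR_right_distrib)
  moreover have "continuous_on UNIV (\<lambda>p :: 'b \<times> 'b. fst p + snd p)"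
    by (intro continuous_on_add continuous_on_fst continuous_on_snd continuous_on_id)
  ultimately have "mb_smooth_on S (\<lambda>x. fst (f x, g x) + snd (f x, g x))"
    by (rule mb_smooth_on_linear_compose) (rule mb_smooth_on_Pair[OF assms])
  then show ?thesis by simp
qed

lemma mb_smooth_on_bounded_linear:
  assumes "bounded_linear l" "mb_smooth_on S f"
  shows "mb_smooth_on S (\<lambda>x. l (f x))"
  by (rule mb_smooth_on_linear_compose[OF bounded_linear.linear linear_continuous_on]) fact+

lemma has_dir_deriv_bounded_linear:
  fixes f :: "'e::locally_convex_space \<Rightarrow> 'a::real_normed_vector" and L :: "'a \<Rightarrow> 'b::real_normed_vector"
  assumes "bounded_linear L" "has_dir_deriv f x v l"
  shows "has_dir_deriv (\<lambda>y. L (f y)) x v (L l)"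
proof -
  interpret bounded_linear L by (rule assms(1))
  show ?thesis using tendsto[OF assms(2)[unfolded has_dir_deriv_def]]
    by (simp only: has_dir_deriv_def scaleR diff)
qed

lemma smooth_map_in_charts:
  assumes f: "smooth_map M A N D f" and c: "c \<in> A" "d \<in> D" and inj: "inj_on (snd c) (fst c)"
  shows "mb_smooth_on {x \<in> snd c ` fst c. f (chart_inv c x) \<in> fst d} (\<lambda>x. snd d (f (chart_inv c x)))"
proof -
  have "snd c ` (fst c \<inter> f -` fst d) = {x \<in> snd c ` fst c. f (chart_inv c x) \<in> fst d}"
    using inj by (auto simp: inv_into_f_f)
  moreover have "mb_smooth_on (snd c ` (fst c \<inter> f -` fst d)) (snd d \<circ> f \<circ> chart_inv c)"
    using f c by (auto simp: smooth_map_def)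
  ultimately show ?thesis by (simp add: comp_def)
qed

lemma inv_into_map_prod:
  assumes "inj_on f A" "inj_on g B" "x \<in> f ` A" "y \<in> g ` B"
  shows "inv_into (A \<times> B) (map_prod f g) (x, y) = (inv_into A f x, inv_into B g y)"
  using assms by (intro inv_into_f_eq map_prod_inj_on) (auto simp: inv_into_into f_inv_into_f inv_into_f_f)

lemma smooth_map_prod_in_charts:
  assumes f: "smooth_map M (prod_atlas A A') N D f" and c: "c \<in> A" "c' \<in> A'" "d \<in> D"
    and inj: "inj_on (snd c) (fst c)" "inj_on (snd c') (fst c')"
  shows "mb_smooth_on {p. fst p \<in> snd c ` fst c \<and> snd p \<in> snd c' ` fst c' \<and>
      f (chart_inv c (fst p), chart_inv c' (snd p)) \<in> fst d}
    (\<lambda>p. snd d (f (chart_inv c (fst p), chart_inv c' (snd p))))"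
proof -
  let ?c = "(fst c \<times> fst c', map_prod (snd c) (snd c'))"
  have c': "?c \<in> prod_atlas A A'" unfolding prod_atlas_def using c by blast
  have "inj_on (snd ?c) (fst ?c)" using inj by (simp add: map_prod_inj_on)
  from smooth_map_in_charts[OF f c' c(3) this]
  have sm: "mb_smooth_on {p \<in> snd ?c ` fst ?c. f (chart_inv ?c p) \<in> fst d} (\<lambda>p. snd d (f (chart_inv ?c p)))" .
  have ci: "chart_inv ?c p = (chart_inv c (fst p), chart_inv c' (snd p))"
    if "fst p \<in> snd c ` fst c" "snd p \<in> snd c' ` fst c'" for p
    using inv_into_map_prod[OF inj that] by simp
  have im: "p \<in> snd ?c ` fst ?c \<longleftrightarrow> fst p \<in> snd c ` fst c \<and> snd p \<in> snd c' ` fst c'" for p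
    by (cases p) (auto simp: image_iff)
  have eq: "{p \<in> snd ?c ` fst ?c. f (chart_inv ?c p) \<in> fst d} = {p. fst p \<in> snd c ` fst c \<and> snd p \<in> snd c' ` fst c' \<and>
      f (chart_inv c (fst p), chart_inv c' (snd p)) \<in> fst d}"
    using ci unfolding im by auto
  show ?thesis
    by (rule mb_smooth_on_cong[OF sm[unfolded eq] mb_smooth_on_open[OF sm[unfolded eq]]])
      (use ci in auto)
qed

section \<open>Unitary representations of locally convex Lie groups\<close>

definition smooth_space :: "('k, 'b) monoid_scheme \<Rightarrow> ('k, 'f::locally_convex_space) chart set \<Rightarrow>
    ('k \<Rightarrow> 'h::complex_hilbert_space \<Rightarrow> 'h) \<Rightarrow> 'h set" where
  "smooth_space K B R = {\<psi>. smooth_map (carrier K) B UNIV vector_atlas (\<lambda>k. R k \<psi>)}"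

text \<open>
  The chart \<open>b\<close> at \<open>\<one>\<close> serves to identify the Lie algebra with the model space.
\<close>
locale smooth_unitary_rep =
  fixes K :: "('k, 'b) monoid_scheme" (structure)
    and B :: "('k, 'f::locally_convex_space) chart set"
    and R :: "'k \<Rightarrow> 'h::complex_hilbert_space \<Rightarrow> 'h"
    and b :: "('k, 'f) chart"
  assumes lie: "lc_lie_group K B"
    and unitary: "k \<in> carrier K \<Longrightarrow> R k \<in> carrier unitary_group"
    and rep_mult: "k \<in> carrier K \<Longrightarrow> l \<in> carrier K \<Longrightarrow> R (k \<otimes> l) = R k \<circ> R l"
    and rep_one: "R \<one> = id"
    and smooth_dense: "closure (smooth_space K B R) = UNIV"
    and b: "b \<in> B" and one_in: "\<one> \<in> fst b"
begin

abbreviation Sm where "Sm \<equiv> smooth_space K B R"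
abbreviation dom :: "('k, 'f) chart \<Rightarrow> 'f set" where "dom c \<equiv> snd c ` fst c"
abbreviation origin where "origin \<equiv> snd b \<one>"

sublocale group K
  using lie by (simp add: lc_lie_group_def)

lemma
  assumes "c \<in> B"
  shows chart_inj: "inj_on (snd c) (fst c)" and chart_sub: "fst c \<subseteq> carrier K" and open_dom: "open (dom c)"
  using lie assms by (auto simp: lc_lie_group_def lc_manifold_def)

lemma chart_inv_chart: "c \<in> B \<Longrightarrow> k \<in> fst c \<Longrightarrow> chart_inv c (snd c k) = k"
  by (simp add: chart_inj inv_into_f_f)

lemma chart_inv_in: "c \<in> B \<Longrightarrow> x \<in> dom c \<Longrightarrow> chart_inv c x \<in> fst c"
  by (simp add: inv_into_into)

lemma chart_inv_carrier: "c \<in> B \<Longrightarrow> x \<in> dom c \<Longrightarrow> chart_inv c x \<in> carrier K"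
  using chart_inv_in chart_sub by blast

lemma chart_chart_inv: "x \<in> dom c \<Longrightarrow> snd c (chart_inv c x) = x"
  by (simp add: f_inv_into_f)

lemma origin_in: "origin \<in> dom b" and chart_inv_origin: "chart_inv b origin = \<one>"
  using one_in b by (auto simp: chart_inv_chart)

lemma chart_cover: "k \<in> carrier K \<Longrightarrow> \<exists>c\<in>B. k \<in> fst c"
  using lie by (auto simp: lc_lie_group_def lc_manifold_def)

lemma mult_smooth:
  assumes "c \<in> B" "c' \<in> B" "d \<in> B"
  shows "mb_smooth_on {p. fst p \<in> dom c \<and> snd p \<in> dom c' \<and>
      chart_inv c (fst p) \<otimes> chart_inv c' (snd p) \<in> fst d}
    (\<lambda>p. snd d (chart_inv c (fst p) \<otimes> chart_inv c' (snd p)))"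
  using smooth_map_prod_in_charts[of _ B B _ B "\<lambda>(g, h). g \<otimes> h", OF _ assms chart_inj[OF assms(1)] chart_inj[OF assms(2)]] lie
  by (auto simp: lc_lie_group_def)

lemma
  assumes "k \<in> carrier K"
  shows rep_add: "R k (x + y) = R k x + R k y" and rep_cscale: "R k (cscale a x) = cscale a (R k x)"
    and rep_cinner: "cinner (R k x) (R k y) = cinner x y"
  using unitary[OF assms] by (auto simp: unitary_group_def)

lemma rep_norm: "k \<in> carrier K \<Longrightarrow> norm (R k x) = norm x"
  by (simp add: norm_eq_sqrt_cinner rep_cinner)

lemma rep_bounded_linear: "k \<in> carrier K \<Longrightarrow> bounded_linear (R k)"
  by (rule bounded_linear_intro[where K = 1])
    (simp_all add: rep_add rep_norm cscale_of_real[symmetric] rep_cscale)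

lemma smooth_spaceI:
  assumes "\<And>c. c \<in> B \<Longrightarrow> mb_smooth_on (dom c) (\<lambda>x. R (chart_inv c x) \<psi>)"
  shows "\<psi> \<in> Sm"
  using assms by (simp add: smooth_space_def smooth_map_def vector_atlas_def comp_def)

lemma orbit_smooth:
  assumes "\<psi> \<in> Sm" "c \<in> B"
  shows "mb_smooth_on (dom c) (\<lambda>x. R (chart_inv c x) \<psi>)"
  using assms by (simp add: smooth_space_def smooth_map_def vector_atlas_def comp_def)

lemma smooth_space_add: "\<phi> \<in> Sm \<Longrightarrow> \<psi> \<in> Sm \<Longrightarrow> \<phi> + \<psi> \<in> Sm"
proof (rule smooth_spaceI)
  fix c assume *: "\<phi> \<in> Sm" "\<psi> \<in> Sm" "c \<in> B"
  show "mb_smooth_on (dom c) (\<lambda>x. R (chart_inv c x) (\<phi> + \<psi>))"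
    by (rule mb_smooth_on_cong[OF mb_smooth_on_add[OF orbit_smooth[OF *(1,3)] orbit_smooth[OF *(2,3)]]])
      (auto simp: open_dom[OF *(3)] rep_add[OF chart_inv_carrier[OF *(3)]])
qed

lemma smooth_space_cscale: "\<psi> \<in> Sm \<Longrightarrow> cscale a \<psi> \<in> Sm"
proof (rule smooth_spaceI)
  fix c assume *: "\<psi> \<in> Sm" "c \<in> B"
  show "mb_smooth_on (dom c) (\<lambda>x. R (chart_inv c x) (cscale a \<psi>))"
    by (rule mb_smooth_on_cong[OF mb_smooth_on_bounded_linear[OF cscale.bounded_linear_right orbit_smooth[OF *]]])
      (auto simp: open_dom[OF *(2)] rep_cscale[OF chart_inv_carrier[OF *(2)]])
qed

lemma smooth_space_scaleR: "\<psi> \<in> Sm \<Longrightarrow> r *\<^sub>R \<psi> \<in> Sm"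
  using smooth_space_cscale[of \<psi> "of_real r"] by (simp add: cscale_of_real)

lemma smooth_space_diff: "\<phi> \<in> Sm \<Longrightarrow> \<psi> \<in> Sm \<Longrightarrow> \<phi> - \<psi> \<in> Sm"
  using smooth_space_add[of \<phi> "(-1) *\<^sub>R \<psi>"] smooth_space_scaleR[of \<psi> "-1"] by simp

lemma product_orbit_smooth:
  assumes \<psi>: "\<psi> \<in> Sm" and c: "c \<in> B" "c' \<in> B" "d \<in> B"
  shows "mb_smooth_on {p. fst p \<in> dom c \<and> snd p \<in> dom c' \<and>
      chart_inv c (fst p) \<otimes> chart_inv c' (snd p) \<in> fst d}
    (\<lambda>p. R (chart_inv c (fst p)) (R (chart_inv c' (snd p)) \<psi>))" (is "mb_smooth_on ?W _")
proof -
  have "mb_smooth_on ?W (\<lambda>p. R (chart_inv d (snd d (chart_inv c (fst p) \<otimes> chart_inv c' (snd p)))) \<psi>)"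
    by (rule mb_smooth_on_compose_subset[OF orbit_smooth[OF \<psi> c(3)] mult_smooth[OF c]]) auto
  then show ?thesis
    by (rule mb_smooth_on_cong)
      (auto simp: chart_inv_chart c rep_mult chart_inv_carrier mb_smooth_on_open[OF mult_smooth[OF c]])
qed

lemma rep_smooth_space:
  assumes \<psi>: "\<psi> \<in> Sm" and k: "k \<in> carrier K"
  shows "R k \<psi> \<in> Sm"
proof (rule smooth_spaceI)
  fix c assume c: "c \<in> B"
  obtain c' where c': "c' \<in> B" "k \<in> fst c'" using chart_cover[OF k] by blast
  show "mb_smooth_on (dom c) (\<lambda>x. R (chart_inv c x) (R k \<psi>))"
  proof (rule mb_smooth_on_localI[OF open_dom[OF c]])
    fix x assume x: "x \<in> dom c"
    then obtain d where d: "d \<in> B" "chart_inv c x \<otimes> k \<in> fst d"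
      using chart_cover[of "chart_inv c x \<otimes> k"] chart_inv_carrier[OF c x] k by blast
    let ?W = "{p. fst p \<in> dom c \<and> snd p \<in> dom c' \<and> chart_inv c (fst p) \<otimes> chart_inv c' (snd p) \<in> fst d}"
    let ?f = "\<lambda>x. (x, snd c' k)"
    have "mb_smooth_on (UNIV \<inter> ?f -` ?W)
        (\<lambda>x. R (chart_inv c (fst (?f x))) (R (chart_inv c' (snd (?f x))) \<psi>))"
      by (intro mb_smooth_on_compose[OF product_orbit_smooth[OF \<psi> c c'(1) d(1)]]
          mb_smooth_on_Pair mb_smooth_on_id mb_smooth_on_const open_UNIV)
    then show "\<exists>U. x \<in> U \<and> mb_smooth_on U (\<lambda>x. R (chart_inv c x) (R k \<psi>))"
      using x d c' by (intro exI[of _ "?f -` ?W"]) (auto simp: chart_inv_chart)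
  qed
qed

definition drep :: "'f \<Rightarrow> 'h \<Rightarrow> 'h" where
  "drep \<xi> \<psi> = dir_deriv (\<lambda>x. R (chart_inv b x) \<psi>) origin \<xi>"

lemma has_dir_deriv_orbit:
  "\<psi> \<in> Sm \<Longrightarrow> has_dir_deriv (\<lambda>x. R (chart_inv b x) \<psi>) origin \<xi> (drep \<xi> \<psi>)"
  unfolding drep_def by (rule has_dir_deriv_smooth[OF orbit_smooth[OF _ b] origin_in])

lemma has_dir_deriv_rep_orbit:
  assumes "\<psi> \<in> Sm" "k \<in> carrier K"
  shows "has_dir_deriv (\<lambda>x. R k (R (chart_inv b x) \<psi>)) origin \<xi> (R k (drep \<xi> \<psi>))"
  by (rule has_dir_deriv_bounded_linear[OF rep_bounded_linear[OF assms(2)] has_dir_deriv_orbit[OF assms(1)]])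

text \<open>
  The map \<open>x \<mapsto> R(x) d\<rho>(\<xi>)\<psi>\<close> is a partial derivative of \<open>(x, y) \<mapsto> R(x) R(y)\<psi>\<close>, which is smooth because
  it is the orbit map of \<open>\<psi>\<close> composed with the multiplication.
\<close>
lemma drep_smooth_space:
  assumes \<psi>: "\<psi> \<in> Sm"
  shows "drep \<xi> \<psi> \<in> Sm"
proof (rule smooth_spaceI)
  fix c assume c: "c \<in> B"
  let ?W = "{p. fst p \<in> dom c \<and> snd p \<in> dom b \<and> chart_inv c (fst p) \<otimes> chart_inv b (snd p) \<in> fst c}"
  let ?h = "\<lambda>p. R (chart_inv c (fst p)) (R (chart_inv b (snd p)) \<psi>)"
  have W: "(x, origin) \<in> ?W" if "x \<in> dom c" for x
    using that chart_inv_carrier[OF c that] chart_inv_in[OF c that] origin_in by (simp add: chart_inv_origin)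
  have sm: "mb_smooth_on ?W ?h" by (rule product_orbit_smooth[OF \<psi> c b c])
  have eq: "dir_deriv ?h (x, origin) (0, \<xi>) = R (chart_inv c x) (drep \<xi> \<psi>)" if x: "x \<in> dom c" for x
    using has_dir_deriv_rep_orbit[OF \<psi> chart_inv_carrier[OF c x], of \<xi>]
    by (intro has_dir_derivD(2)) (simp add: has_dir_deriv_def)
  have "mb_smooth_on (dom c \<inter> (\<lambda>x. (x, origin)) -` ?W) (\<lambda>x. dir_deriv ?h (x, origin) (0, \<xi>))"
    by (intro mb_smooth_on_dir_deriv[OF sm] mb_smooth_on_Pair mb_smooth_on_id mb_smooth_on_const open_dom c)
  then show "mb_smooth_on (dom c) (\<lambda>x. R (chart_inv c x) (drep \<xi> \<psi>))"
    by (rule mb_smooth_on_cong) (use W eq open_dom[OF c] in auto)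
qed

lemma drep_add:
  assumes "\<phi> \<in> Sm" "\<psi> \<in> Sm"
  shows "drep \<xi> (\<phi> + \<psi>) = drep \<xi> \<phi> + drep \<xi> \<psi>"
proof -
  have "has_dir_deriv (\<lambda>x. R (chart_inv b x) (\<phi> + \<psi>)) origin \<xi> (drep \<xi> \<phi> + drep \<xi> \<psi>)"
    by (rule iffD2[OF has_dir_deriv_cong[OF open_dom[OF b] origin_in]
        has_dir_deriv_add[OF has_dir_deriv_orbit[OF assms(1)] has_dir_deriv_orbit[OF assms(2)]]])
      (rule rep_add[OF chart_inv_carrier[OF b]])
  then show ?thesis unfolding drep_def[of \<xi> "\<phi> + \<psi>"] by (rule has_dir_derivD(2))
qed

lemma drep_cscale:
  assumes "\<psi> \<in> Sm"
  shows "drep \<xi> (cscale a \<psi>) = cscale a (drep \<xi> \<psi>)"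
proof -
  have "has_dir_deriv (\<lambda>x. R (chart_inv b x) (cscale a \<psi>)) origin \<xi> (cscale a (drep \<xi> \<psi>))"
    by (rule iffD2[OF has_dir_deriv_cong[OF open_dom[OF b] origin_in]
        has_dir_deriv_bounded_linear[OF cscale.bounded_linear_right has_dir_deriv_orbit[OF assms]]])
      (rule rep_cscale[OF chart_inv_carrier[OF b]])
  then show ?thesis unfolding drep_def[of \<xi> "cscale a \<psi>"] by (rule has_dir_derivD(2))
qed

lemma drep_add_dir: "\<psi> \<in> Sm \<Longrightarrow> drep (\<xi> + \<eta>) \<psi> = drep \<xi> \<psi> + drep \<eta> \<psi>"
  unfolding drep_def by (rule C1_on_add_dir[OF C1_on_smooth[OF orbit_smooth[OF _ b]] origin_in])

lemma drep_scaleR_dir: "\<psi> \<in> Sm \<Longrightarrow> drep (r *\<^sub>R \<xi>) \<psi> = r *\<^sub>R drep \<xi> \<psi>"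
  using has_dir_deriv_unique[OF has_dir_deriv_orbit has_dir_deriv_scale_dir[OF has_dir_deriv_orbit]] .

lemma drep_diff_dir: "\<psi> \<in> Sm \<Longrightarrow> drep (\<xi> - \<eta>) \<psi> = drep \<xi> \<psi> - drep \<eta> \<psi>"
  using drep_add_dir[of \<psi> \<xi> "(-1) *\<^sub>R \<eta>"] drep_scaleR_dir[of \<psi> "-1" \<eta>] by simp

lemma drep_skew:
  assumes "\<phi> \<in> Sm" "\<psi> \<in> Sm"
  shows "cinner \<phi> (drep \<xi> \<psi>) + cinner (drep \<xi> \<phi>) \<psi> = 0"
proof -
  have "has_dir_deriv (\<lambda>x. cinner (R (chart_inv b x) \<phi>) (R (chart_inv b x) \<psi>)) origin \<xi>
      (cinner (R (chart_inv b origin) \<phi>) (drep \<xi> \<psi>) + cinner (drep \<xi> \<phi>) (R (chart_inv b origin) \<psi>))"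
    by (rule has_dir_deriv_bounded_bilinear[OF bounded_bilinear_cinner has_dir_deriv_orbit has_dir_deriv_orbit]) fact+
  moreover have "has_dir_deriv (\<lambda>x. cinner (R (chart_inv b x) \<phi>) (R (chart_inv b x) \<psi>)) origin \<xi> 0"
    by (rule iffD2[OF has_dir_deriv_cong[OF open_dom[OF b] origin_in] has_dir_deriv_const])
      (rule rep_cinner[OF chart_inv_carrier[OF b]])
  ultimately show ?thesis
    using has_dir_deriv_unique by (fastforce simp: chart_inv_origin rep_one)
qed

abbreviation lif :: "'f \<Rightarrow> 'f \<Rightarrow> 'f" where "lif \<equiv> left_invariant_field K b"

lemma mult_chart:
  defines "W \<equiv> {p. fst p \<in> dom b \<and> snd p \<in> dom b \<and> chart_inv b (fst p) \<otimes> chart_inv b (snd p) \<in> fst b}"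
    and "m \<equiv> \<lambda>p. snd b (chart_inv b (fst p) \<otimes> chart_inv b (snd p))"
  shows "mb_smooth_on W m"
    and "x \<in> dom b \<Longrightarrow> (x, origin) \<in> W" "x \<in> dom b \<Longrightarrow> (origin, x) \<in> W"
    and "x \<in> dom b \<Longrightarrow> m (x, origin) = x" "x \<in> dom b \<Longrightarrow> m (origin, x) = x"
    and "x \<in> dom b \<Longrightarrow> has_dir_deriv (\<lambda>y. m (x, y)) origin \<xi> (lif \<xi> x)"
    and "x \<in> dom b \<Longrightarrow> lif \<xi> x = dir_deriv m (x, origin) (0, \<xi>)"
proof -
  show sm: "mb_smooth_on W m" unfolding W_def m_def by (rule mult_smooth[OF b b b])
  assume x: "x \<in> dom b"
  then show W: "(x, origin) \<in> W" "(origin, x) \<in> W" "m (x, origin) = x" "m (origin, x) = x"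
    using chart_inv_carrier[OF b x] chart_inv_in[OF b x] origin_in
    by (simp_all add: W_def m_def chart_inv_origin chart_chart_inv)
  have hd: "has_dir_deriv (\<lambda>y. m (x, y)) origin \<xi> (dir_deriv m (x, origin) (0, \<xi>))"
    using has_dir_deriv_smooth[OF sm W(1), of "(0, \<xi>)"] by (simp add: has_dir_deriv_def)
  moreover show "lif \<xi> x = dir_deriv m (x, origin) (0, \<xi>)"
    using has_dir_derivD(2)[OF hd] by (simp add: left_invariant_field_def m_def)
  ultimately show "has_dir_deriv (\<lambda>y. m (x, y)) origin \<xi> (lif \<xi> x)" by simp
qed

lemma lif_smooth: "mb_smooth_on (dom b \<times> UNIV) (\<lambda>p. lif (snd p) (fst p))"
proof -
  let ?W = "{p. fst p \<in> dom b \<and> snd p \<in> dom b \<and> chart_inv b (fst p) \<otimes> chart_inv b (snd p) \<in> fst b}"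
  let ?m = "\<lambda>p. snd b (chart_inv b (fst p) \<otimes> chart_inv b (snd p))"
  have o: "open (dom b \<times> (UNIV :: 'f set))" using open_dom[OF b] by (intro open_Times) auto
  have "mb_smooth_on ((dom b \<times> UNIV) \<inter> (\<lambda>p. (fst p, origin)) -` ?W)
      (\<lambda>p. dir_deriv ?m (fst p, origin) (0, snd p))"
    by (intro mb_smooth_on_dir_deriv[OF mult_chart(1)] mb_smooth_on_Pair mb_smooth_on_fst mb_smooth_on_snd
        mb_smooth_on_id mb_smooth_on_const o)
  then show ?thesis
    by (rule mb_smooth_on_cong) (use mult_chart(2,7) o in auto)
qed

lemma lif_origin: "lif \<xi> origin = \<xi>"
proof -
  have "has_dir_deriv (\<lambda>y. snd b (chart_inv b (fst (origin, y)) \<otimes> chart_inv b (snd (origin, y)))) origin \<xi> \<xi>"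
    by (rule iffD2[OF has_dir_deriv_cong[OF open_dom[OF b] origin_in mult_chart(5)] has_dir_deriv_linear])
      (auto simp: linear_iff)
  then show ?thesis using has_dir_deriv_unique[OF mult_chart(6)[OF origin_in]] by blast
qed

text \<open>
  Both sides are the velocity of \<open>R(k) R(l)\<psi> = R(kl)\<psi>\<close> when \<open>l\<close> moves through \<open>\<one>\<close> with velocity \<open>\<xi>\<close>
  and \<open>k\<close> is the group element with coordinates \<open>x\<close>.
\<close>
lemma orbit_deriv_lif:
  assumes \<psi>: "\<psi> \<in> Sm" and x: "x \<in> dom b"
  shows "dir_deriv (\<lambda>y. R (chart_inv b y) \<psi>) x (lif \<xi> x) = R (chart_inv b x) (drep \<xi> \<psi>)"
proof -
  let ?W = "{p. fst p \<in> dom b \<and> snd p \<in> dom b \<and> chart_inv b (fst p) \<otimes> chart_inv b (snd p) \<in> fst b}"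
  let ?m = "\<lambda>p. snd b (chart_inv b (fst p) \<otimes> chart_inv b (snd p))"
  let ?U = "(\<lambda>y. (x, y)) -` ?W"
  have "open ?U"
    by (rule open_vimage[OF mb_smooth_on_open[OF mult_chart(1)]])
      (intro continuous_on_Pair continuous_on_const continuous_on_id)
  moreover have "origin \<in> ?U" using mult_chart(2)[OF x] by simp
  moreover have "R (chart_inv b (?m (x, y))) \<psi> = R (chart_inv b x) (R (chart_inv b y) \<psi>)" if "y \<in> ?U" for y
    using that x b by (auto simp: chart_inv_chart rep_mult chart_inv_carrier)
  ultimately have iff: "has_dir_deriv (\<lambda>y. R (chart_inv b (?m (x, y))) \<psi>) origin \<xi> l \<longleftrightarrow>
      has_dir_deriv (\<lambda>y. R (chart_inv b x) (R (chart_inv b y) \<psi>)) origin \<xi> l" for l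
    by (rule has_dir_deriv_cong)
  have "has_dir_deriv (\<lambda>y. R (chart_inv b (?m (x, y))) \<psi>) origin \<xi>
      (dir_deriv (\<lambda>y. R (chart_inv b y) \<psi>) (?m (x, origin)) (lif \<xi> x))"
    by (rule C1_on_chain[OF C1_on_smooth[OF orbit_smooth[OF \<psi> b]] _ mult_chart(6)[OF x]])
      (use mult_chart(4)[OF x] x in simp)
  from has_dir_deriv_unique[OF iffD1[OF iff this] has_dir_deriv_rep_orbit[OF \<psi> chart_inv_carrier[OF b x]]]
  show ?thesis by (simp only: mult_chart(4)[OF x])
qed

text \<open>
  The function \<open>x \<mapsto> R(x) d\<rho>(\<eta>)\<psi>\<close> is the derivative of the orbit map along \<open>lif \<eta>\<close>. Differentiating
  it at the origin gives a second derivative of the orbit map, which is symmetric in \<open>\<xi>\<close> and \<open>\<eta>\<close>, and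
  the derivative of \<open>lif \<eta>\<close>.
\<close>
lemma drep_drep:
  assumes \<psi>: "\<psi> \<in> Sm"
  shows "drep \<xi> (drep \<eta> \<psi>) = iter_deriv (\<lambda>x. R (chart_inv b x) \<psi>) 2 origin ((\<lambda>_. \<eta>)(1 := \<xi>))
    + drep (dir_deriv (lif \<eta>) origin \<xi>) \<psi>"
proof -
  let ?O = "\<lambda>x. R (chart_inv b x) \<psi>"
  have lif: "has_dir_deriv (lif \<eta>) origin \<xi> (dir_deriv (lif \<eta>) origin \<xi>)"
  proof -
    have "mb_smooth_on (dom b) (\<lambda>x. lif (snd (x, \<eta>)) (fst (x, \<eta>)))"
      by (rule mb_smooth_on_compose_subset[OF lif_smooth])
        (auto intro!: mb_smooth_on_Pair mb_smooth_on_id mb_smooth_on_const open_dom b)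
    then show ?thesis using has_dir_deriv_smooth[OF _ origin_in] by simp
  qed
  have id: "has_dir_deriv (\<lambda>x. x) origin \<xi> \<xi>" by (rule has_dir_deriv_linear) (auto simp: linear_iff)
  from has_dir_deriv_iter_deriv_comp[where n = 1 and F = "\<lambda>x. x" and U = "\<lambda>_. lif \<eta>",
      OF orbit_smooth[OF \<psi> b] origin_in id lif]
  have along_lif: "has_dir_deriv (\<lambda>x. dir_deriv ?O x (lif \<eta> x)) origin \<xi>
      (iter_deriv ?O 2 origin ((\<lambda>_. \<eta>)(1 := \<xi>)) + drep (dir_deriv (lif \<eta>) origin \<xi>) \<psi>)"
    by (simp add: lif_origin iter_deriv.simps(2) numeral_2_eq_2 drep_def)
  have "has_dir_deriv (\<lambda>x. R (chart_inv b x) (drep \<eta> \<psi>)) origin \<xi>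
      (iter_deriv ?O 2 origin ((\<lambda>_. \<eta>)(1 := \<xi>)) + drep (dir_deriv (lif \<eta>) origin \<xi>) \<psi>)"
    by (rule iffD2[OF has_dir_deriv_cong[OF open_dom[OF b] origin_in] along_lif])
      (simp add: orbit_deriv_lif[OF \<psi>])
  with has_dir_deriv_orbit[OF drep_smooth_space[OF \<psi>]] show ?thesis
    by (rule has_dir_deriv_unique)
qed

lemma drep_lie_bracket:
  assumes \<psi>: "\<psi> \<in> Sm"
  shows "drep (lie_bracket K b \<xi> \<eta>) \<psi> = drep \<xi> (drep \<eta> \<psi>) - drep \<eta> (drep \<xi> \<psi>)"
  unfolding drep_drep[OF \<psi>] lie_bracket_def field_bracket_def lif_origin drep_diff_dir[OF \<psi>]
    second_derivative_symmetric[OF orbit_smooth[OF \<psi> b] origin_in, of \<eta> \<xi>]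
  by simp

end

section \<open>Iterated derivatives along orbits, uniformly on bounded sets\<close>

lemma linear_entry: "linear (\<lambda>s :: 'a::real_vector sequence. entry s i)"
  by (simp add: linear_iff)

definition shift :: "'a sequence \<Rightarrow> 'a sequence" where
  "shift s = Sequence (\<lambda>i. entry s (Suc i))"

lemma linear_shift: "linear (shift :: 'a::real_vector sequence \<Rightarrow> _)"
  by (auto simp: linear_iff shift_def intro!: sequence_eqI)

lemma continuous_on_shift:
  "continuous_on UNIV (shift :: 'a::topological_space sequence \<Rightarrow> _)"
  unfolding continuous_on_def
proof (intro ballI tendsto_sequenceI)
  fix a :: "'a sequence" and i
  show "((\<lambda>s. entry (shift s) i) \<longlongrightarrow> entry (shift a) i) (at a)"
    unfolding shift_def entry_Sequence by (rule tendsto_entry[OF tendsto_ident_at])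
qed

text \<open>
  Continuity at \<open>(0, 0)\<close> gives a bound for small \<open>t\<close> and small \<open>v\<close>; homogeneity carries it to all
  \<open>v\<close> in a bounded set.
\<close>
lemma homogeneous_bounded:
  fixes Z :: "real \<times> 'f::locally_convex_space sequence \<Rightarrow> 'a::real_normed_vector"
  assumes J: "open J" "0 \<in> J" and cont: "continuous_on (J \<times> UNIV) Z"
    and hom: "\<And>t s c. t \<in> J \<Longrightarrow> Z (t, c *\<^sub>R s) = c ^ k *\<^sub>R Z (t, s)"
    and B: "bounded_in_power n V"
  shows "\<exists>\<delta>>0. \<exists>C>0. \<forall>t v. \<bar>t\<bar> < \<delta> \<and> v \<in> V \<longrightarrow> t \<in> J \<and> norm (Z (t, Sequence v)) \<le> C"
proof -
  let ?C = "norm (Z (0, 0)) + 1"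
  have "open (J \<times> (UNIV :: 'f sequence set))" using J by (intro open_Times) auto
  from iffD1[OF continuous_on_open_vimage[OF this] continuous_on_norm[OF cont]]
  have "open ((\<lambda>p. norm (Z p)) -` {..<?C} \<inter> J \<times> UNIV)" by simp
  moreover have "(0, 0) \<in> (\<lambda>p. norm (Z p)) -` {..<?C} \<inter> J \<times> UNIV" using J by simp
  ultimately obtain A N where AN: "open A" "open N" "((0::real), 0) \<in> A \<times> N"
    "A \<times> N \<subseteq> (\<lambda>p. norm (Z p)) -` {..<?C} \<inter> J \<times> UNIV"
    by (rule open_prod_elim)
  then obtain \<delta> where \<delta>: "\<delta> > 0" "ball 0 \<delta> \<subseteq> A" using open_contains_ball by blast
  have "open (Sequence -` N)" "(\<lambda>_. 0) \<in> Sequence -` N"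
    using AN by (auto simp: open_sequence_def zero_sequence_def)
  then have "\<exists>s>0. \<forall>t>s. \<forall>v\<in>V. (\<lambda>i. (1 / t) *\<^sub>R v i) \<in> Sequence -` N"
    using conjunct2[OF B[unfolded bounded_in_power_def], rule_format, of "Sequence -` N"] by (simp only: simp_thms)
  then obtain s where s: "s > 0" "\<And>t v. t > s \<Longrightarrow> v \<in> V \<Longrightarrow> (\<lambda>i. (1 / t) *\<^sub>R v i) \<in> Sequence -` N"
    by metis
  define \<tau> where "\<tau> = s + 1"
  have \<tau>: "\<tau> > s" "\<tau> > 0" using s(1) by (simp_all add: \<tau>_def)
  have "t \<in> J \<and> norm (Z (t, Sequence v)) \<le> \<tau> ^ k * ?C" if t: "\<bar>t\<bar> < \<delta>" and v: "v \<in> V" for t v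
  proof -
    let ?w = "Sequence (\<lambda>i. (1 / \<tau>) *\<^sub>R v i)"
    have "t \<in> A" using \<delta>(2) t by (auto simp: subset_iff)
    moreover have "?w \<in> N" using s(2)[OF \<tau>(1) v] by simp
    ultimately have "(t, ?w) \<in> (\<lambda>p. norm (Z p)) -` {..<?C} \<inter> J \<times> UNIV" using AN(4) by blast
    then have w: "norm (Z (t, ?w)) < ?C" "t \<in> J" by auto
    have "Sequence v = \<tau> *\<^sub>R ?w" using \<tau>(2) by (intro sequence_eqI) simp
    then have "norm (Z (t, Sequence v)) = \<tau> ^ k * norm (Z (t, ?w))"
      using hom[OF w(2)] \<tau>(2) by simp
    also have "\<dots> \<le> \<tau> ^ k * ?C" using w(1) \<tau>(2) by (intro mult_left_mono) auto
    finally show ?thesis using w(2) by blast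
  qed
  moreover have "\<tau> ^ k * ?C > 0" using \<tau>(2) by (intro mult_pos_pos) (auto simp: add_nonneg_pos)
  ultimately show ?thesis using \<delta>(1) by blast
qed

context smooth_unitary_rep
begin

primrec drep_iter :: "nat \<Rightarrow> (nat \<Rightarrow> 'f) \<Rightarrow> 'h \<Rightarrow> 'h" where
  "drep_iter 0 v \<psi> = \<psi>"
| "drep_iter (Suc k) v \<psi> = drep_iter k v (drep (v k) \<psi>)"

lemma drep_iter_smooth_space: "\<psi> \<in> Sm \<Longrightarrow> drep_iter k v \<psi> \<in> Sm"
  by (induction k arbitrary: \<psi>) (auto intro: drep_smooth_space)

lemma drep_iter_Suc: "drep_iter (Suc k) v \<psi> = drep (v 0) (drep_iter k (\<lambda>i. v (Suc i)) \<psi>)"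
  by (induction k arbitrary: \<psi>) simp_all

lemma drep_iter_add:
  "\<phi> \<in> Sm \<Longrightarrow> \<psi> \<in> Sm \<Longrightarrow> drep_iter k v (\<phi> + \<psi>) = drep_iter k v \<phi> + drep_iter k v \<psi>"
  by (induction k arbitrary: \<phi> \<psi>) (auto simp: drep_add drep_smooth_space)

lemma drep_iter_cscale: "\<psi> \<in> Sm \<Longrightarrow> drep_iter k v (cscale a \<psi>) = cscale a (drep_iter k v \<psi>)"
  by (induction k arbitrary: \<psi>) (auto simp: drep_cscale drep_smooth_space)

lemma drep_iter_scaleR: "\<psi> \<in> Sm \<Longrightarrow> drep_iter k v (r *\<^sub>R \<psi>) = r *\<^sub>R drep_iter k v \<psi>"
  using drep_iter_cscale[of \<psi> k v "of_real r"] by (simp add: cscale_of_real)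

lemma drep_iter_diff:
  "\<phi> \<in> Sm \<Longrightarrow> \<psi> \<in> Sm \<Longrightarrow> drep_iter k v (\<phi> - \<psi>) = drep_iter k v \<phi> - drep_iter k v \<psi>"
  using drep_iter_add[of \<phi> "(-1) *\<^sub>R \<psi>"] drep_iter_scaleR[of \<psi> k v "-1"] smooth_space_scaleR[of \<psi> "-1"]
  by simp

lemma drep_iter_scaleR_dirs:
  "\<psi> \<in> Sm \<Longrightarrow> drep_iter k (\<lambda>i. c *\<^sub>R v i) \<psi> = c ^ k *\<^sub>R drep_iter k v \<psi>"
  by (induction k arbitrary: \<psi>)
    (auto simp: drep_scaleR_dir drep_iter_scaleR drep_smooth_space smooth_space_scaleR)

text \<open>
  The adjoint is \<open>(-1)\<^sup>k d\<rho>(v\<^bsub>k-1\<^esub>) \<cdots> d\<rho>(v\<^sub>0)\<close>, as each \<open>d\<rho>(v)\<close> is skew-symmetric on the smooth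
  vectors.
\<close>
lemma drep_iter_adjoint:
  assumes "\<phi> \<in> Sm"
  shows "\<exists>\<phi>'\<in>Sm. \<forall>\<theta>\<in>Sm. cinner \<phi> (drep_iter k v \<theta>) = cinner \<phi>' \<theta>"
proof (induction k)
  case (Suc k)
  then obtain \<phi>' where \<phi>': "\<phi>' \<in> Sm" "\<And>\<theta>. \<theta> \<in> Sm \<Longrightarrow> cinner \<phi> (drep_iter k v \<theta>) = cinner \<phi>' \<theta>"
    by blast
  have "cinner \<phi> (drep_iter (Suc k) v \<theta>) = cinner ((-1) *\<^sub>R drep (v k) \<phi>') \<theta>" if "\<theta> \<in> Sm" for \<theta>
    using drep_skew[OF \<phi>'(1) that, of "v k"] \<phi>'(2)[OF drep_smooth_space[OF that]]
    by (simp add: cinner.minus_left eq_neg_iff_add_eq_0)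
  then show ?case
    using smooth_space_scaleR[OF drep_smooth_space[OF \<phi>'(1)]] by blast
qed (use assms in auto)

lemma eq_by_density:
  assumes "\<And>\<phi>. \<phi> \<in> Sm \<Longrightarrow> cinner \<phi> x = cinner \<phi> y"
  shows "x = y"
proof -
  have "closed {\<phi>. cinner \<phi> (x - y) = 0}"
    by (intro closed_Collect_eq continuous_on_const linear_continuous_on cinner.bounded_linear_left)
  moreover have "Sm \<subseteq> {\<phi>. cinner \<phi> (x - y) = 0}" using assms by (auto simp: cinner.diff_right)
  ultimately have "cinner (x - y) (x - y) = 0" using smooth_dense closure_minimal by blast
  then show ?thesis by (simp add: cinner_self)
qed

text \<open>
  In \<open>R(y) d\<rho>(v\<^sub>0) d\<rho>(v\<^sub>1) \<cdots> d\<rho>(v\<^sub>k) f(t)\<close> the leftmost operator is the derivative along the left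
  invariant field of \<open>v\<^sub>0\<close> in the variable \<open>y\<close> of the same expression for \<open>v\<^sub>1, \<dots>, v\<^sub>k\<close>. The unbounded
  operators thus become partial derivatives of the smooth function \<open>(y, t) \<mapsto> R(y) f(t)\<close>.
\<close>
lemma drep_iter_family_smooth:
  fixes f :: "real \<Rightarrow> 'h"
  assumes N: "\<And>p. p \<in> N \<Longrightarrow> fst p \<in> dom b \<and> f (snd p) \<in> Sm"
    and sm: "mb_smooth_on N (\<lambda>p. R (chart_inv b (fst p)) (f (snd p)))"
  shows "mb_smooth_on (N \<times> UNIV)
    (\<lambda>q. R (chart_inv b (fst (fst q))) (drep_iter k (entry (snd q)) (f (snd (fst q)))))"
proof (induction k)
  have o: "open (N \<times> (UNIV :: 'f sequence set))" using mb_smooth_on_open[OF sm] by (intro open_Times) auto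
  case 0
  show ?case using o by (auto intro!: mb_smooth_on_compose_subset[OF sm] mb_smooth_on_fst mb_smooth_on_id)
next
  have o: "open (N \<times> (UNIV :: 'f sequence set))" using mb_smooth_on_open[OF sm] by (intro open_Times) auto
  case (Suc k)
  let ?\<Psi> = "\<lambda>k q. R (chart_inv b (fst (fst q))) (drep_iter k (entry (snd q)) (f (snd (fst q))))"
  let ?F = "\<lambda>q :: ('f \<times> real) \<times> 'f sequence. (fst q, shift (snd q))"
  let ?w = "\<lambda>q. ((lif (entry (snd q) 0) (fst (fst q)), 0), 0)"
  have "mb_smooth_on (N \<times> UNIV) (\<lambda>q. lif (snd (fst (fst q), entry (snd q) 0)) (fst (fst (fst q), entry (snd q) 0)))"
    by (rule mb_smooth_on_compose_subset[OF lif_smooth])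
      (use N o in \<open>auto intro!: mb_smooth_on_Pair mb_smooth_on_fst mb_smooth_on_id
        mb_smooth_on_linear_compose[OF linear_entry continuous_on_entry] mb_smooth_on_snd\<close>)
  then have w: "mb_smooth_on (N \<times> UNIV) ?w"
    using o by (intro mb_smooth_on_Pair mb_smooth_on_const) simp
  have F: "mb_smooth_on (N \<times> UNIV) ?F"
    by (intro mb_smooth_on_Pair mb_smooth_on_fst mb_smooth_on_id
        mb_smooth_on_linear_compose[OF linear_shift continuous_on_shift] mb_smooth_on_snd o)
  have eq: "dir_deriv (?\<Psi> k) (?F q) (?w q) = ?\<Psi> (Suc k) q" if q: "q \<in> N \<times> UNIV" for q
  proof -
    obtain y t s where [simp]: "q = ((y, t), s)" by (cases q) auto
    have y: "y \<in> dom b" and ft: "f t \<in> Sm" using N[of "(y, t)"] q by auto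
    let ?\<theta> = "drep_iter k (\<lambda>i. entry s (Suc i)) (f t)"
    have \<theta>: "?\<theta> \<in> Sm" by (rule drep_iter_smooth_space[OF ft])
    have "has_dir_deriv (\<lambda>y. R (chart_inv b y) ?\<theta>) y (lif (entry s 0) y)
        (R (chart_inv b y) (drep (entry s 0) ?\<theta>))"
      using has_dir_deriv_smooth[OF orbit_smooth[OF \<theta> b] y] orbit_deriv_lif[OF \<theta> y] by metis
    then have "has_dir_deriv (?\<Psi> k) (?F q) (?w q) (R (chart_inv b y) (drep (entry s 0) ?\<theta>))"
      by (simp add: has_dir_deriv_def shift_def)
    then show ?thesis by (simp add: has_dir_derivD(2) drep_iter_Suc del: drep_iter.simps)
  qed
  have "mb_smooth_on ((N \<times> UNIV) \<inter> ?F -` (N \<times> UNIV)) (\<lambda>q. dir_deriv (?\<Psi> k) (?F q) (?w q))"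
    by (rule mb_smooth_on_dir_deriv[OF Suc.IH F w])
  then show ?case
    by (rule mb_smooth_on_cong) (use o eq in auto)
qed

lemma drep_iter_bounded:
  assumes \<theta>: "\<theta> \<in> Sm" and V: "bounded_in_power n V"
  shows "\<exists>C>0. \<forall>v\<in>V. norm (drep_iter k v \<theta>) \<le> C"
proof -
  have "mb_smooth_on (dom b \<times> (UNIV :: real set)) (\<lambda>p. R (chart_inv b (fst p)) \<theta>)"
    by (rule mb_smooth_on_compose_subset[OF orbit_smooth[OF \<theta> b]])
      (auto intro!: mb_smooth_on_fst mb_smooth_on_id open_Times open_dom b)
  from drep_iter_family_smooth[where f = "\<lambda>_. \<theta>", OF _ this, of k] \<theta>
  have "mb_smooth_on ((dom b \<times> (UNIV :: real set)) \<times> UNIV)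
      (\<lambda>q. R (chart_inv b (fst (fst q))) (drep_iter k (entry (snd q)) \<theta>))" by auto
  note sm = this
  let ?g = "\<lambda>p :: real \<times> 'f sequence. ((origin, fst p), snd p)"
  have "continuous_on (UNIV \<times> UNIV) ?g"
    by (intro continuous_on_Pair continuous_on_fst continuous_on_snd continuous_on_const continuous_on_id)
  moreover have "?g ` (UNIV \<times> UNIV) \<subseteq> (dom b \<times> UNIV) \<times> UNIV"
    using origin_in by (intro image_subsetI) simp
  ultimately have "continuous_on (UNIV \<times> UNIV)
      (\<lambda>p. R (chart_inv b (fst (fst (?g p)))) (drep_iter k (entry (snd (?g p))) \<theta>))"
    by (rule continuous_on_compose2[OF mb_smooth_on_continuous[OF sm]])
  then have "continuous_on (UNIV \<times> UNIV) (\<lambda>p :: real \<times> 'f sequence. drep_iter k (entry (snd p)) \<theta>)"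
    by (simp only: fst_conv snd_conv chart_inv_origin rep_one id_apply)
  moreover have "drep_iter k (entry (c *\<^sub>R s)) \<theta> = c ^ k *\<^sub>R drep_iter k (entry s) \<theta>" for c s
    using drep_iter_scaleR_dirs[OF \<theta>, of k c "entry s"] by (simp add: scaleR_sequence_def)
  ultimately obtain \<delta> C :: real where "\<delta> > 0" "C > 0" "\<forall>t v. \<bar>t\<bar> < \<delta> \<and> v \<in> V \<longrightarrow> norm (drep_iter k v \<theta>) \<le> C"
    using homogeneous_bounded[OF open_UNIV UNIV_I _ _ V, of "\<lambda>p. drep_iter k (entry (snd p)) \<theta>" k] by auto
  then show ?thesis by (metis abs_zero)
qed

text \<open>
  Taylor's formula for the seminorms of the strong topology. The second derivative of
  \<open>t \<mapsto> d\<rho>(v\<^sub>0) \<cdots> d\<rho>(v\<^bsub>k-1\<^esub>) f(t)\<close> is continuous in \<open>(t, v)\<close> and homogeneous in \<open>v\<close>, hence bounded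
  uniformly for \<open>v\<close> in a bounded set. The first derivative is moved past the unbounded operators by
  passing to their adjoints on the dense space of smooth vectors.
\<close>
lemma drep_iter_taylor:
  fixes f :: "real \<Rightarrow> 'h"
  assumes N: "\<And>p. p \<in> N \<Longrightarrow> fst p \<in> dom b \<and> f (snd p) \<in> Sm" and N0: "(origin, 0) \<in> N"
    and sm: "mb_smooth_on N (\<lambda>p. R (chart_inv b (fst p)) (f (snd p)))"
    and f': "has_dir_deriv f 0 1 f'" "f' \<in> Sm"
    and V: "bounded_in_power n V"
  shows "\<exists>\<delta>>0. \<exists>C>0. \<forall>t v. \<bar>t\<bar> < \<delta> \<and> v \<in> V \<longrightarrow> f t \<in> Sm \<and>
    norm (drep_iter k v (f t) - drep_iter k v (f 0) - t *\<^sub>R drep_iter k v f') \<le> C * t\<^sup>2"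
proof -
  let ?\<Psi> = "\<lambda>q. R (chart_inv b (fst (fst q))) (drep_iter k (entry (snd q)) (f (snd (fst q))))"
  let ?u = "((0 :: 'f, 1 :: real), 0 :: 'f sequence)"
  define Z where "Z j p = iter_deriv ?\<Psi> j ((origin, fst p), snd p) (\<lambda>_. ?u)" for j p
  define J where "J = {t. (origin, t) \<in> N}"
  have \<Psi>: "mb_smooth_on (N \<times> UNIV) ?\<Psi>" by (rule drep_iter_family_smooth[OF N sm])
  have "continuous_on UNIV (\<lambda>t::real. (origin, t))"
    by (intro continuous_on_Pair continuous_on_const continuous_on_id)
  from open_vimage[OF mb_smooth_on_open[OF sm] this] have J: "open J" "0 \<in> J"
    using N0 by (simp_all add: J_def vimage_def)
  have fSm: "f t \<in> Sm" if "t \<in> J" for t using N[of "(origin, t)"] that by (simp add: J_def)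
  have Z0: "Z 0 (t, s) = drep_iter k (entry s) (f t)" for t s
    by (simp add: Z_def chart_inv_origin rep_one)
  have Z': "has_dir_deriv (\<lambda>t. Z j (t, s)) t 1 (Z (Suc j) (t, s))" if "t \<in> J" for j t s
  proof -
    have "((origin, t), s) \<in> N \<times> UNIV" using that by (simp add: J_def)
    moreover have "(\<lambda>_. ?u)(j := ?u) = (\<lambda>_. ?u)" by (rule ext) simp
    ultimately have "has_dir_deriv (\<lambda>q. iter_deriv ?\<Psi> j q (\<lambda>_. ?u)) ((origin, t), s) ?u
        (iter_deriv ?\<Psi> (Suc j) ((origin, t), s) (\<lambda>_. ?u))"
      using has_dir_deriv_iter_deriv[OF \<Psi>, of "((origin, t), s)" j "\<lambda>_. ?u" ?u] by (simp only:)
    then show ?thesis by (simp add: has_dir_deriv_def Z_def)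
  qed
  have hom: "Z j (t, c *\<^sub>R s) = c ^ k *\<^sub>R Z j (t, s)" if "t \<in> J" for j t c s
    using that
  proof (induction j arbitrary: t)
    case 0
    then show ?case using drep_iter_scaleR_dirs[OF fSm, of t k c "entry s"] by (simp add: Z0 scaleR_sequence_def)
  next
    case (Suc j)
    have "has_dir_deriv (\<lambda>t. Z j (t, c *\<^sub>R s)) t 1 (c ^ k *\<^sub>R Z (Suc j) (t, s))"
      by (rule iffD2[OF has_dir_deriv_cong[OF J(1) Suc.prems] has_dir_deriv_scaleR[OF Z'[OF Suc.prems]]])
        (rule Suc.IH)
    with Z'[OF Suc.prems] show ?case by (rule has_dir_deriv_unique)
  qed
  have "continuous_on (J \<times> UNIV) (Z 2)"
    unfolding Z_def by (rule continuous_on_iter_deriv[OF \<Psi>])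
      (auto simp: J_def intro!: continuous_on_Pair continuous_on_fst continuous_on_snd continuous_on_const continuous_on_id)
  from homogeneous_bounded[OF J this hom V]
  obtain \<delta> C where \<delta>C: "\<delta> > 0" "C > 0" "\<And>t v. \<bar>t\<bar> < \<delta> \<Longrightarrow> v \<in> V \<Longrightarrow> t \<in> J \<and> norm (Z 2 (t, Sequence v)) \<le> C"
    by metis
  \<comment> \<open>commuting the derivative with the unbounded operators, tested against smooth vectors\<close>
  have Z1: "Z 1 (0, Sequence v) = drep_iter k v f'" for v
  proof (rule eq_by_density)
    fix \<phi> assume \<phi>: "\<phi> \<in> Sm"
    obtain \<phi>' where \<phi>': "\<And>\<theta>. \<theta> \<in> Sm \<Longrightarrow> cinner \<phi> (drep_iter k v \<theta>) = cinner \<phi>' \<theta>"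
      using drep_iter_adjoint[OF \<phi>] by blast
    have "has_dir_deriv (\<lambda>t. cinner \<phi> (Z 0 (t, Sequence v))) 0 1 (cinner \<phi>' f')"
      by (rule iffD2[OF has_dir_deriv_cong[OF J]
          has_dir_deriv_bounded_linear[OF cinner.bounded_linear_right f'(1)]])
        (simp add: Z0 \<phi>' fSm)
    moreover have "has_dir_deriv (\<lambda>t. cinner \<phi> (Z 0 (t, Sequence v))) 0 1 (cinner \<phi> (Z 1 (0, Sequence v)))"
      using has_dir_deriv_bounded_linear[OF cinner.bounded_linear_right Z'[OF J(2), of 0]] by simp
    ultimately show "cinner \<phi> (Z 1 (0, Sequence v)) = cinner \<phi> (drep_iter k v f')"
      using has_dir_deriv_unique \<phi>'[OF f'(2)] by metis
  qed
  have "norm (drep_iter k v (f t) - drep_iter k v (f 0) - t *\<^sub>R drep_iter k v f') \<le> (C + 2) * t\<^sup>2"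
    if t: "\<bar>t\<bar> < \<delta>" and v: "v \<in> V" for t v
  proof (cases "t = 0")
    case False
    let ?s = "Sequence v"
    \<comment> \<open>The bounds on derivatives must be strict, which costs two units in the constant.\<close>
    have Z1': "norm (Z 1 (q, ?s) - Z 1 (0, ?s)) < \<bar>t\<bar> * (C + 2)" if q: "\<bar>q\<bar> \<le> \<bar>t\<bar>" for q
    proof -
      have "norm (Z 1 (q, ?s) - Z 1 (0, ?s) - q *\<^sub>R 0) \<le> \<bar>q\<bar> * (C + 1)"
      proof (rule increment_bound[where \<gamma>' = "\<lambda>q. Z 2 (q, ?s)"])
        fix p assume "\<bar>p\<bar> \<le> \<bar>q\<bar>"
        then have "\<bar>p\<bar> < \<delta>" using q t by simp
        from \<delta>C(3)[OF this v] show "norm (Z 2 (p, ?s) - 0) < C + 1"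
          "has_dir_deriv (\<lambda>q. Z 1 (q, ?s)) p 1 (Z 2 (p, ?s))"
          using Z'[of p 1 ?s] by (simp_all add: numeral_2_eq_2)
      qed
      also have "\<dots> \<le> \<bar>t\<bar> * (C + 1)" using q \<delta>C(2) by (intro mult_right_mono) auto
      also have "\<dots> < \<bar>t\<bar> * (C + 2)" using False by simp
      finally show ?thesis by simp
    qed
    have "norm (Z 0 (t, ?s) - Z 0 (0, ?s) - t *\<^sub>R Z 1 (0, ?s)) \<le> \<bar>t\<bar> * (\<bar>t\<bar> * (C + 2))"
    proof (rule increment_bound[where \<gamma>' = "\<lambda>q. Z 1 (q, ?s)"])
      fix q assume q: "\<bar>q\<bar> \<le> \<bar>t\<bar>"
      then have "\<bar>q\<bar> < \<delta>" using t by simp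
      from \<delta>C(3)[OF this v] show "has_dir_deriv (\<lambda>q. Z 0 (q, ?s)) q 1 (Z 1 (q, ?s))"
        using Z'[of q 0 ?s] by simp
    qed (rule Z1')
    also have "\<bar>t\<bar> * (\<bar>t\<bar> * (C + 2)) = (C + 2) * t\<^sup>2" by (simp add: power2_eq_square flip: abs_mult)
    finally show ?thesis by (simp only: Z0 Z1 entry_Sequence)
  qed simp
  then show ?thesis using \<delta>C fSm by (intro exI[of _ \<delta>] conjI exI[of _ "C + 2"]) auto
qed

text \<open>
  A rescaled curve \<open>s(t) f(t)\<close> through \<open>f(0) = \<psi>\<close>; the difference quotient is split into
  \<open>s(t) ((f(t) - \<psi>)/t - f')\<close>, \<open>(s(t) - 1) f'\<close> and \<open>((s(t) - 1)/t - s') \<psi>\<close>.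
\<close>
lemma drep_iter_difference_quotient:
  fixes f :: "real \<Rightarrow> 'h" and s :: "real \<Rightarrow> complex"
  assumes N: "\<And>p. p \<in> N \<Longrightarrow> fst p \<in> dom b \<and> f (snd p) \<in> Sm" and N0: "(origin, 0) \<in> N"
    and sm: "mb_smooth_on N (\<lambda>p. R (chart_inv b (fst p)) (f (snd p)))"
    and f': "has_dir_deriv f 0 1 f'" "f' \<in> Sm"
    and s: "has_dir_deriv s 0 1 s'" "s 0 = 1"
    and V: "bounded_in_power n V" and \<epsilon>: "\<epsilon> > 0"
  shows "\<forall>\<^sub>F t in at 0. \<forall>v\<in>V.
    norm (drep_iter k v ((1 / t) *\<^sub>R (cscale (s t) (f t) - f 0) - (f' + cscale s' (f 0)))) \<le> \<epsilon>"
proof -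
  have \<psi>: "f 0 \<in> Sm" using N[OF N0] by simp
  from drep_iter_taylor[OF N N0 sm f' V, of k] obtain \<delta> C where \<delta>C: "\<delta> > 0"
    "\<And>t v. \<bar>t\<bar> < \<delta> \<Longrightarrow> v \<in> V \<Longrightarrow> f t \<in> Sm \<and>
      norm (drep_iter k v (f t) - drep_iter k v (f 0) - t *\<^sub>R drep_iter k v f') \<le> C * t\<^sup>2"
    by metis
  obtain C1 where C1: "\<And>v. v \<in> V \<Longrightarrow> norm (drep_iter k v f') \<le> C1" using drep_iter_bounded[OF f'(2) V] by blast
  obtain C2 where C2: "\<And>v. v \<in> V \<Longrightarrow> norm (drep_iter k v (f 0)) \<le> C2" using drep_iter_bounded[OF \<psi> V] by blast
  let ?q = "\<lambda>t. (1 / t) *\<^sub>R (s t - 1) - s'"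
  have "((\<lambda>t. s (0 + t *\<^sub>R 1)) \<longlongrightarrow> s 0) (at 0)" by (rule has_dir_deriv_imp_tendsto[OF s(1)])
  then have lim_s: "(s \<longlongrightarrow> 1) (at 0)" using s(2) by simp
  have "((\<lambda>t. (1 / t) *\<^sub>R (s t - 1)) \<longlongrightarrow> s') (at 0)" using s by (simp add: has_dir_deriv_def)
  then have lim_q: "(?q \<longlongrightarrow> s' - s') (at 0)" by (intro tendsto_diff tendsto_const)
  have "((\<lambda>t. cmod (s t) * (C * \<bar>t\<bar>) + cmod (s t - 1) * C1 + cmod (?q t) * C2)
      \<longlongrightarrow> cmod 1 * (C * \<bar>0\<bar>) + cmod (1 - 1) * C1 + cmod (s' - s') * C2) (at 0)"
    by (intro tendsto_add tendsto_mult tendsto_norm tendsto_diff tendsto_const tendsto_rabs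
        tendsto_ident_at lim_s lim_q)
  then have "\<forall>\<^sub>F t in at 0. cmod (s t) * (C * \<bar>t\<bar>) + cmod (s t - 1) * C1 + cmod (?q t) * C2 < \<epsilon>"
    using \<epsilon> by (intro order_tendstoD) auto
  moreover have "\<forall>\<^sub>F t in at 0. t \<noteq> 0 \<and> \<bar>t\<bar> < \<delta>"
    using \<delta>C(1) by (auto simp: eventually_at intro!: exI[of _ \<delta>])
  ultimately show ?thesis
  proof eventually_elim
    case (elim t)
    show ?case
    proof
      fix v assume v: "v \<in> V"
      have t: "t \<noteq> 0" "\<bar>t\<bar> < \<delta>" using elim by auto
      have ft: "f t \<in> Sm" using \<delta>C(2)[OF t(2) v] by blast
      let ?d = "drep_iter k v"
      let ?T = "(1 / t) *\<^sub>R (?d (f t) - ?d (f 0) - t *\<^sub>R ?d f')"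
      have "?d ((1 / t) *\<^sub>R (cscale (s t) (f t) - f 0) - (f' + cscale s' (f 0))) =
          (1 / t) *\<^sub>R (cscale (s t) (?d (f t)) - ?d (f 0)) - (?d f' + cscale s' (?d (f 0)))"
        by (simp add: drep_iter_diff drep_iter_add drep_iter_scaleR drep_iter_cscale ft \<psi> f'(2)
            smooth_space_diff smooth_space_add smooth_space_scaleR smooth_space_cscale)
      also have "\<dots> = cscale (s t) ?T + cscale (s t - 1) (?d f') + cscale (?q t) (?d (f 0))"
        using t(1) by (simp add: cscale.diff_right cscale.diff_left cscale.scaleR_right cscale.scaleR_left
            scaleR_right_diff_distrib)
      also have "norm \<dots> \<le> cmod (s t) * norm ?T + cmod (s t - 1) * norm (?d f') + cmod (?q t) * norm (?d (f 0))"
        by (intro norm_triangle_le add_mono) (simp_all add: norm_cscale)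
      also have "\<dots> \<le> cmod (s t) * (C * \<bar>t\<bar>) + cmod (s t - 1) * C1 + cmod (?q t) * C2"
      proof (intro add_mono mult_left_mono C1 C2 v norm_ge_zero)
        have "norm ?T = norm (?d (f t) - ?d (f 0) - t *\<^sub>R ?d f') / \<bar>t\<bar>" by simp
        also have "\<dots> \<le> C * t\<^sup>2 / \<bar>t\<bar>" using \<delta>C(2)[OF t(2) v] by (intro divide_right_mono) auto
        also have "\<dots> = C * \<bar>t\<bar>" using t(1) by (cases "t > 0") (auto simp: power2_eq_square)
        finally show "norm ?T \<le> C * \<bar>t\<bar>" .
      qed
      finally show "norm (?d ((1 / t) *\<^sub>R (cscale (s t) (f t) - f 0) - (f' + cscale s' (f 0)))) \<le> \<epsilon>"
        using elim(1) by linarith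
    qed
  qed
qed

lemma orbit_curve:
  assumes \<psi>: "\<psi> \<in> Sm" and x: "mb_smooth_on I x" "0 \<in> I" "x 0 = origin"
  defines "f \<equiv> \<lambda>t :: real. R (chart_inv b (x t)) \<psi>"
  obtains N where "\<And>p. p \<in> N \<Longrightarrow> fst p \<in> dom b \<and> f (snd p) \<in> Sm" "(origin, 0) \<in> N"
    "mb_smooth_on N (\<lambda>p. R (chart_inv b (fst p)) (f (snd p)))"
    "has_dir_deriv f 0 1 (drep (dir_deriv x 0 1) \<psi>)"
proof
  let ?W = "{p. fst p \<in> dom b \<and> snd p \<in> dom b \<and> chart_inv b (fst p) \<otimes> chart_inv b (snd p) \<in> fst b}"
  let ?F = "\<lambda>p :: 'f \<times> real. (fst p, x (snd p))"
  let ?N = "(UNIV \<times> I) \<inter> ?F -` ?W"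
  have o: "open (UNIV \<times> I :: ('f \<times> real) set)" using mb_smooth_on_open[OF x(1)] by (intro open_Times) auto
  have "mb_smooth_on (UNIV \<times> I) ?F"
    using o by (intro mb_smooth_on_Pair mb_smooth_on_compose_subset[OF x(1)] mb_smooth_on_fst
        mb_smooth_on_snd mb_smooth_on_id) auto
  from mb_smooth_on_compose[OF product_orbit_smooth[OF \<psi> b b b] this]
  show "mb_smooth_on ?N (\<lambda>p. R (chart_inv b (fst p)) (f (snd p)))" by (simp add: f_def)
  show "fst p \<in> dom b \<and> f (snd p) \<in> Sm" if "p \<in> ?N" for p
    using that rep_smooth_space[OF \<psi> chart_inv_carrier[OF b]] by (auto simp: f_def)
  show "(origin, 0) \<in> ?N"
    using x mult_chart(2)[OF origin_in] by simp
  show "has_dir_deriv f 0 1 (drep (dir_deriv x 0 1) \<psi>)"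
    using C1_on_chain[OF C1_on_smooth[OF orbit_smooth[OF \<psi> b]] _ has_dir_deriv_smooth[OF x(1,2)]]
      x(3) origin_in unfolding f_def drep_def by simp
qed

end

section \<open>Rays and projective unitary operators\<close>

lemma ray_self: "\<psi> \<in> ray \<psi>"
  unfolding ray_def by (rule CollectI, rule exI[of _ 1]) simp

lemma ray_cscale:
  assumes "a \<noteq> 0"
  shows "ray (cscale a \<psi>) = ray \<psi>"
proof -
  have "\<exists>d. cscale e \<psi> = cscale d (cscale a \<psi>) \<and> d \<noteq> 0" if "e \<noteq> 0" for e
    using that assms by (intro exI[of _ "e / a"]) (simp add: cscale_cscale)
  moreover have "\<exists>e. cscale d (cscale a \<psi>) = cscale e \<psi> \<and> e \<noteq> 0" if "d \<noteq> 0" for d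
    using that assms by (intro exI[of _ "d * a"]) (simp add: cscale_cscale)
  ultimately show ?thesis unfolding ray_def by blast
qed

lemma ray_eq_of_mem: "\<phi> \<in> ray \<psi> \<Longrightarrow> ray \<phi> = ray \<psi>"
  by (auto simp: ray_def[of \<psi>] ray_cscale)

lemma proj_chart_ray:
  "proj_chart \<psi> (ray \<phi>) = cscale (inverse (cinner \<psi> \<phi>)) \<phi> - \<psi>"
proof -
  have "(SOME \<phi>'. \<phi>' \<in> ray \<phi>) \<in> ray \<phi>" using ray_self by (rule someI)
  then obtain a where a: "(SOME \<phi>'. \<phi>' \<in> ray \<phi>) = cscale a \<phi>" "a \<noteq> 0" by (auto simp: ray_def)
  have "inverse (a * cinner \<psi> \<phi>) * a = inverse (cinner \<psi> \<phi>)" using a(2) by (simp add: field_simps)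
  then show ?thesis
    by (simp only: proj_chart_def a(1) cinner_cscale_right cscale_cscale Let_def)
qed

lemma unit_rep_ray:
  assumes "\<psi> \<noteq> 0"
  shows "unit_rep (ray \<psi>) \<in> ray \<psi>" "norm (unit_rep (ray \<psi>)) = 1"
proof -
  let ?a = "complex_of_real (1 / norm \<psi>)"
  have "cscale ?a \<psi> \<in> ray \<psi>" "norm (cscale ?a \<psi>) = 1"
    using assms by (auto simp: ray_def norm_cscale norm_divide intro!: exI[of _ ?a])
  then have "\<exists>\<phi>. \<phi> \<in> ray \<psi> \<and> norm \<phi> = 1" by blast
  from someI_ex[OF this] show "unit_rep (ray \<psi>) \<in> ray \<psi>" "norm (unit_rep (ray \<psi>)) = 1"
    by (simp_all add: unit_rep_def)
qed

lemma pu_class_eq: "pu_class U = {cscale z \<circ> U | z. z \<in> circle}"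
  by (auto simp: r_coset_def phases_def unitary_group_def)

lemma pu_act_ray:
  assumes "\<And>a x. U (cscale a x) = cscale a (U x)"
  shows "pu_act (pu_class U) (ray \<psi>) = ray (U \<psi>)"
proof
  show "pu_act (pu_class U) (ray \<psi>) \<subseteq> ray (U \<psi>)"
    unfolding pu_act_def pu_class_eq
  proof safe
    fix z \<phi> assume z: "z \<in> circle" and "\<phi> \<in> ray \<psi>"
    then obtain a where a: "\<phi> = cscale a \<psi>" "a \<noteq> 0" by (auto simp: ray_def)
    have "(cscale z \<circ> U) \<phi> = cscale (z * a) (U \<psi>)" by (simp add: a assms cscale_cscale)
    moreover have "z * a \<noteq> 0" using z a by (auto simp: circle_def)
    ultimately show "(cscale z \<circ> U) \<phi> \<in> ray (U \<psi>)" by (auto simp: ray_def)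
  qed
  show "ray (U \<psi>) \<subseteq> pu_act (pu_class U) (ray \<psi>)"
  proof
    fix \<phi> assume "\<phi> \<in> ray (U \<psi>)"
    then obtain a where a: "\<phi> = cscale a (U \<psi>)" "a \<noteq> 0" by (auto simp: ray_def)
    have "\<phi> = (cscale 1 \<circ> U) (cscale a \<psi>)" by (simp add: a assms)
    moreover have "cscale 1 \<circ> U \<in> pu_class U" by (auto simp: pu_class_eq circle_def)
    moreover have "cscale a \<psi> \<in> ray \<psi>" using a by (auto simp: ray_def)
    ultimately show "\<phi> \<in> pu_act (pu_class U) (ray \<psi>)" unfolding pu_act_def by blast
  qed
qed

lemma has_dir_deriv_inverse:
  fixes f :: "'e::locally_convex_space \<Rightarrow> complex"
  assumes f: "has_dir_deriv f x v l" and nz: "f x \<noteq> 0"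
  shows "has_dir_deriv (\<lambda>y. inverse (f y)) x v (- (l * inverse (f x) * inverse (f x)))"
proof -
  let ?q = "\<lambda>t. (1 / t) *\<^sub>R (f (x + t *\<^sub>R v) - f x)"
  have lim: "((\<lambda>t. f (x + t *\<^sub>R v)) \<longlongrightarrow> f x) (at 0)" by (rule has_dir_deriv_imp_tendsto[OF f])
  have "((\<lambda>t. - (?q t * inverse (f (x + t *\<^sub>R v)) * inverse (f x))) \<longlongrightarrow> - (l * inverse (f x) * inverse (f x))) (at 0)"
    using f by (intro tendsto_minus tendsto_mult tendsto_inverse lim tendsto_const nz) (simp add: has_dir_deriv_def)
  moreover have "\<forall>\<^sub>F t in at 0. f (x + t *\<^sub>R v) \<noteq> 0"
    using tendsto_imp_eventually_ne[OF lim nz] .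
  then have "\<forall>\<^sub>F t in at 0. - (?q t * inverse (f (x + t *\<^sub>R v)) * inverse (f x)) =
      (1 / t) *\<^sub>R (inverse (f (x + t *\<^sub>R v)) - inverse (f x))"
  proof eventually_elim
    case (elim t)
    have "- ((f (x + t *\<^sub>R v) - f x) * inverse (f (x + t *\<^sub>R v)) * inverse (f x)) =
        inverse (f (x + t *\<^sub>R v)) - inverse (f x)"
      using elim nz by (simp add: field_simps)
    then show ?case by (metis mult_scaleR_left scaleR_minus_right)
  qed
  ultimately show ?thesis unfolding has_dir_deriv_def by (rule Lim_transform_eventually)
qed

lemma circle_chart:
  fixes a \<theta> :: real
  assumes "a < \<theta>" "\<theta> < a + 2 * pi"
  shows "(THE t. a < t \<and> t < a + 2 * pi \<and> cis \<theta> = cis t) = \<theta>"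
proof (rule the_equality)
  fix t assume t: "a < t \<and> t < a + 2 * pi \<and> cis \<theta> = cis t"
  then have "sin t = sin \<theta> \<and> cos t = cos \<theta>" by (simp add: complex_eq_iff)
  then obtain n :: int where n: "t = \<theta> + 2 * pi * n" using sin_cos_eq_iff by blast
  have "\<bar>2 * pi * n\<bar> < 2 * pi" using t assms n by linarith
  then have "\<bar>real_of_int n\<bar> < 1" using pi_gt_zero by (simp add: abs_mult)
  then have "n = 0" by linarith
  then show "t = \<theta>" using n by simp
qed (use assms in auto)

section \<open>The central extension and its representation\<close>

lemma carrier_sharp_group:
  "k \<in> carrier (sharp_group G \<rho>) \<longleftrightarrow>
    fst k \<in> carrier G \<and> snd k \<in> carrier unitary_group \<and> \<rho> (fst k) = pu_class (snd k)"
  by (auto simp: sharp_group_def case_prod_unfold)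

lemma mult_sharp_group: "k \<otimes>\<^bsub>sharp_group G \<rho>\<^esub> l = (fst k \<otimes>\<^bsub>G\<^esub> fst l, snd k \<circ> snd l)"
  by (simp add: sharp_group_def DirProd_def unitary_group_def case_prod_unfold)

lemma one_sharp_group: "\<one>\<^bsub>sharp_group G \<rho>\<^esub> = (\<one>\<^bsub>G\<^esub>, id)"
  by (simp add: sharp_group_def DirProd_def unitary_group_def)

lemma smooth_vectors_eq: "smooth_vectors G \<rho> Ash = smooth_space (sharp_group G \<rho>) Ash snd"
  by (simp add: smooth_vectors_def smooth_space_def case_prod_unfold)

locale projective_rep =
  fixes G :: "('g, 'b) monoid_scheme"
    and A :: "('g, 'e::locally_convex_space) chart set"
    and \<rho> :: "'g \<Rightarrow> ('h::complex_hilbert_space \<Rightarrow> 'h) set"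
    and Ash :: "('g \<times> ('h \<Rightarrow> 'h), 'f::locally_convex_space) chart set"
    and c :: "('g, 'e) chart"
    and csh :: "('g \<times> ('h \<Rightarrow> 'h), 'f) chart"
  assumes lie_G: "lc_lie_group G A"
    and sharp: "sharp_lie_group G A \<rho> Ash"
    and c: "c \<in> A" "\<one>\<^bsub>G\<^esub> \<in> fst c"
    and csh: "csh \<in> Ash" "\<one>\<^bsub>sharp_group G \<rho>\<^esub> \<in> fst csh"
begin

sublocale smooth_unitary_rep "sharp_group G \<rho>" Ash snd csh
  using sharp csh by unfold_locales
    (auto simp: sharp_lie_group_def carrier_sharp_group mult_sharp_group one_sharp_group smooth_vectors_eq)

abbreviation one_G where "one_G \<equiv> snd c \<one>\<^bsub>G\<^esub>"

lemma derived_rep_eq: "derived_rep G \<rho> csh = drep"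
  by (intro ext) (simp add: derived_rep_def drep_def)

lemma derived_rep_iter_eq: "derived_rep_iter G \<rho> csh k v \<psi> = drep_iter k v \<psi>"
  by (induction k arbitrary: \<psi>) (simp_all add: derived_rep_eq)

lemma inj_c: "inj_on (snd c) (fst c)" and fst_c: "fst c \<subseteq> carrier G"
  using lie_G c by (auto simp: lc_lie_group_def lc_manifold_def)

lemma chart_inv_one_G: "chart_inv c one_G = \<one>\<^bsub>G\<^esub>"
  using c inj_c by (simp add: inv_into_f_f)

lemma pu_act_sharp: "k \<in> carrier (sharp_group G \<rho>) \<Longrightarrow> pu_act (\<rho> (fst k)) (ray \<psi>) = ray (snd k \<psi>)"
  using pu_act_ray[of "snd k" \<psi>] rep_cscale[of k] by (simp add: carrier_sharp_group)

text \<open>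
  A local trivialization of the bundle is multiplied by a constant phase in order to send \<open>\<one>\<close> to the
  identity of the extension.
\<close>
lemma section_through_one:
  obtains \<sigma> N where "mb_smooth_on N \<sigma>" "one_G \<in> N" "\<sigma> one_G = origin"
    "\<forall>y\<in>N. y \<in> snd c ` fst c \<and> \<sigma> y \<in> dom csh \<and> fst (chart_inv csh (\<sigma> y)) = chart_inv c y"
proof -
  have "principal_U1_bundle G A \<rho> Ash" using sharp by (simp add: sharp_lie_group_def)
  moreover have "\<one>\<^bsub>G\<^esub> \<in> carrier G" using c fst_c by blast
  ultimately obtain V \<Phi> where triv: "openin (manifold_topology (carrier G) A) V \<and> \<one>\<^bsub>G\<^esub> \<in> V \<and>
      diffeomorphism (V \<times> circle) (prod_atlas (restrict_atlas A V) circle_atlas)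
        (carrier (sharp_group G \<rho>) \<inter> fst -` V) (restrict_atlas Ash (fst -` V)) \<Phi> \<and>
      (\<forall>h\<in>V. \<forall>z\<in>circle. fst (\<Phi> (h, z)) = h \<and> snd (\<Phi> (h, z)) = cscale z \<circ> snd (\<Phi> (h, 1)))"
    unfolding principal_U1_bundle_def by (elim ballE exE) (rule that, auto)
  then have V: "\<one>\<^bsub>G\<^esub> \<in> V"
    and diff: "diffeomorphism (V \<times> circle) (prod_atlas (restrict_atlas A V) circle_atlas)
        (carrier (sharp_group G \<rho>) \<inter> fst -` V) (restrict_atlas Ash (fst -` V)) \<Phi>"
    by simp_all
  have eqv: "fst (\<Phi> (h, z)) = h \<and> snd (\<Phi> (h, z)) = cscale z \<circ> snd (\<Phi> (h, 1))"
    if "h \<in> V" "z \<in> circle" for h z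
    using triv that by blast
  have one_circle: "1 \<in> circle" by (simp add: circle_def)
  have "\<Phi> (\<one>\<^bsub>G\<^esub>, 1) \<in> carrier (sharp_group G \<rho>)"
    using diff V one_circle by (auto simp: diffeomorphism_def dest: bij_betwE)
  moreover have "\<one>\<^bsub>sharp_group G \<rho>\<^esub> \<in> carrier (sharp_group G \<rho>)" by (rule one_closed)
  ultimately have "pu_class (snd (\<Phi> (\<one>\<^bsub>G\<^esub>, 1))) = pu_class id"
    using eqv[OF V one_circle] by (simp add: carrier_sharp_group one_sharp_group)
  moreover have "cscale 1 \<circ> U \<in> pu_class U" for U :: "'h \<Rightarrow> 'h"
    using one_circle unfolding pu_class_eq by blast
  then have "snd (\<Phi> (\<one>\<^bsub>G\<^esub>, 1)) \<in> pu_class (snd (\<Phi> (\<one>\<^bsub>G\<^esub>, 1)))" by (simp add: comp_def)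
  ultimately obtain w where w: "w \<in> circle" "snd (\<Phi> (\<one>\<^bsub>G\<^esub>, 1)) = cscale w"
    by (auto simp: pu_class_eq)
  \<comment> \<open>The trivialization sends \<open>(\<one>, 1)\<close> to multiplication by \<open>w\<close>; the phase \<open>cnj w\<close> compensates for it.\<close>
  have "cnj w = cis (Arg2pi (cnj w))"
    using w(1) complex_norm_eq_1_exp[of "cnj w"] by (simp add: circle_def cis_conv_exp)
  then obtain \<theta> where \<theta>: "cnj w = cis \<theta>" by blast
  have "cis \<theta> * w = 1"
    using w(1) complex_norm_square[of w] by (simp add: \<theta>[symmetric] circle_def mult.commute)
  moreover have \<theta>_circle: "cis \<theta> \<in> circle" by (simp add: circle_def)
  ultimately have \<Phi>_one: "\<Phi> (\<one>\<^bsub>G\<^esub>, cis \<theta>) = \<one>\<^bsub>sharp_group G \<rho>\<^esub>"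
    using eqv[OF V \<theta>_circle] w(2) by (intro prod_eqI) (auto simp: one_sharp_group fun_eq_iff cscale_cscale)
  \<comment> \<open>the chart of the circle centred at this phase\<close>
  define \<kappa> where "\<kappa> = (cis ` {\<theta> - pi<..<\<theta> - pi + 2 * pi},
    \<lambda>z. THE t. \<theta> - pi < t \<and> t < \<theta> - pi + 2 * pi \<and> z = cis t)"
  have \<kappa>: "\<kappa> \<in> circle_atlas" unfolding \<kappa>_def circle_atlas_def by blast
  have \<kappa>_cis: "snd \<kappa> (cis t) = t" if "\<theta> - pi < t" "t < \<theta> - pi + 2 * pi" for t
    unfolding \<kappa>_def snd_conv using circle_chart[OF that] .
  have \<kappa>_inj: "inj_on (snd \<kappa>) (fst \<kappa>)"
    by (rule inj_onI) (auto simp: \<kappa>_def[THEN arg_cong, of fst] \<kappa>_cis)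
  have \<theta>_in: "cis \<theta> \<in> fst \<kappa>" by (auto simp: \<kappa>_def)
  have \<kappa>_\<theta>: "snd \<kappa> (cis \<theta>) = \<theta>" by (rule \<kappa>_cis) auto
  have inv_\<theta>: "chart_inv \<kappa> \<theta> = cis \<theta>" using inv_into_f_f[OF \<kappa>_inj \<theta>_in] \<kappa>_\<theta> by simp
  let ?cV = "(fst c \<inter> V, snd c)" and ?d = "(fst csh \<inter> fst -` V, snd csh)"
  have cV: "?cV \<in> restrict_atlas A V" "inj_on (snd ?cV) (fst ?cV)" and d: "?d \<in> restrict_atlas Ash (fst -` V)"
    using c csh inj_c by (auto simp: restrict_atlas_def inj_on_def)
  have inv_cV: "chart_inv ?cV y = chart_inv c y \<and> chart_inv c y \<in> V \<and> y \<in> snd c ` fst c"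
    if "y \<in> snd c ` (fst c \<inter> V)" for y
    using that inj_c cV(2) by (auto simp: inv_into_f_f)
  let ?W = "{p. fst p \<in> snd ?cV ` fst ?cV \<and> snd p \<in> snd \<kappa> ` fst \<kappa> \<and>
    \<Phi> (chart_inv ?cV (fst p), chart_inv \<kappa> (snd p)) \<in> fst ?d}"
  let ?s = "\<lambda>p. snd ?d (\<Phi> (chart_inv ?cV (fst p), chart_inv \<kappa> (snd p)))"
  have "mb_smooth_on ?W ?s"
    using diff cV d \<kappa> \<kappa>_inj unfolding diffeomorphism_def by (intro smooth_map_prod_in_charts) blast+
  from mb_smooth_on_compose[OF this, of UNIV "\<lambda>y. (y, \<theta>)"]
  have sm: "mb_smooth_on ((\<lambda>y. (y, \<theta>)) -` ?W) (\<lambda>y. ?s (y, \<theta>))"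
    by (simp add: mb_smooth_on_Pair mb_smooth_on_id mb_smooth_on_const)
  show ?thesis
  proof (rule that[OF sm])
    have "chart_inv ?cV one_G = \<one>\<^bsub>G\<^esub>" using inv_cV[of one_G] c V by (auto simp: chart_inv_one_G)
    then show "one_G \<in> (\<lambda>y. (y, \<theta>)) -` ?W" "?s (one_G, \<theta>) = origin"
      using c V csh \<theta>_in \<kappa>_\<theta> inv_\<theta> \<Phi>_one by (auto simp: one_sharp_group image_iff intro: bexI[of _ "cis \<theta>"])
    show "\<forall>y\<in>(\<lambda>y. (y, \<theta>)) -` ?W. y \<in> snd c ` fst c \<and> ?s (y, \<theta>) \<in> dom csh \<and>
        fst (chart_inv csh (?s (y, \<theta>))) = chart_inv c y"
    proof
      fix y assume y: "y \<in> (\<lambda>y. (y, \<theta>)) -` ?W"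
      then have *: "chart_inv ?cV y = chart_inv c y" "chart_inv c y \<in> V" "y \<in> snd c ` fst c"
        "\<Phi> (chart_inv c y, cis \<theta>) \<in> fst csh"
        using inv_cV[of y] inv_\<theta> by auto
      then show "y \<in> snd c ` fst c \<and> ?s (y, \<theta>) \<in> dom csh \<and> fst (chart_inv csh (?s (y, \<theta>))) = chart_inv c y"
        using eqv[OF *(2) \<theta>_circle] chart_inv_chart[OF csh(1) *(4)] inv_\<theta> by simp
    qed
  qed
qed

lemma projection_smooth:
  "mb_smooth_on {x \<in> dom csh. fst (chart_inv csh x) \<in> fst c} (\<lambda>x. snd c (fst (chart_inv csh x)))"
proof -
  have "smooth_map (carrier (sharp_group G \<rho>)) Ash (carrier G) A fst"
    using sharp by (simp add: sharp_lie_group_def)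
  then show ?thesis by (rule smooth_map_in_charts[OF _ csh(1) c(1) chart_inj[OF csh(1)]])
qed

lemma fst_chart_inv_origin: "fst (chart_inv csh origin) = \<one>\<^bsub>G\<^esub>"
  unfolding chart_inv_origin by (simp add: one_sharp_group)

lemma origin_in_projection_dom: "origin \<in> {x \<in> dom csh. fst (chart_inv csh x) \<in> fst c}"
  using origin_in c(2) by (simp add: fst_chart_inv_origin)

lemma projection_origin: "snd c (fst (chart_inv csh origin)) = one_G"
  by (simp add: fst_chart_inv_origin)

lemma has_dir_deriv_projection:
  "has_dir_deriv (\<lambda>x. snd c (fst (chart_inv csh x))) origin \<zeta> (sharp_projection G c \<rho> csh \<zeta>)"
  unfolding sharp_projection_def
  by (rule has_dir_deriv_smooth[OF projection_smooth origin_in_projection_dom])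

lemma curve_lift:
  obtains x I where "mb_smooth_on I x" "(0::real) \<in> I" "x 0 = origin"
    "sharp_projection G c \<rho> csh (dir_deriv x 0 1) = \<xi>"
    "\<forall>t\<in>I. x t \<in> dom csh \<and> fst (chart_inv csh (x t)) = chart_inv c (one_G + t *\<^sub>R \<xi>)"
proof -
  obtain \<sigma> N where \<sigma>: "mb_smooth_on N \<sigma>" "one_G \<in> N" "\<sigma> one_G = origin"
    "\<forall>y\<in>N. y \<in> snd c ` fst c \<and> \<sigma> y \<in> dom csh \<and> fst (chart_inv csh (\<sigma> y)) = chart_inv c y"
    by (rule section_through_one)
  let ?l = "\<lambda>t::real. one_G + t *\<^sub>R \<xi>"
  have "linear (\<lambda>t::real. t *\<^sub>R \<xi>)" by (simp add: linear_iff scaleR_left_distrib)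
  moreover have "continuous_on UNIV (\<lambda>t::real. t *\<^sub>R \<xi>)"
    by (intro continuous_on_scaleR_lc continuous_on_id continuous_on_const)
  ultimately have "mb_smooth_on UNIV ?l"
    by (intro mb_smooth_on_add mb_smooth_on_const mb_smooth_on_linear open_UNIV)
  from mb_smooth_on_compose[OF \<sigma>(1) this]
  have x: "mb_smooth_on (?l -` N) (\<lambda>t. \<sigma> (?l t))" by simp
  have 0: "0 \<in> ?l -` N" using \<sigma>(2) by simp
  have "has_dir_deriv (\<lambda>t. snd c (fst (chart_inv csh (\<sigma> (?l t))))) 0 1
      (sharp_projection G c \<rho> csh (dir_deriv (\<lambda>t. \<sigma> (?l t)) 0 1))"
    using C1_on_chain[OF C1_on_smooth[OF projection_smooth] _ has_dir_deriv_smooth[OF x 0, of 1]]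
      origin_in_projection_dom \<sigma>(3) by (simp add: sharp_projection_def)
  moreover have "has_dir_deriv (\<lambda>t. snd c (fst (chart_inv csh (\<sigma> (?l t))))) 0 1 \<xi>"
  proof (rule iffD2[OF has_dir_deriv_cong[OF mb_smooth_on_open[OF x] 0]])
    show "snd c (fst (chart_inv csh (\<sigma> (?l t)))) = ?l t" if "t \<in> ?l -` N" for t
      using bspec[OF \<sigma>(4), of "?l t"] that by (simp add: f_inv_into_f)
    show "has_dir_deriv ?l 0 1 \<xi>"
      using has_dir_deriv_line[of "\<lambda>y. y" one_G 0 \<xi> \<xi>] has_dir_deriv_linear[of "\<lambda>y. y" _ \<xi>]
      by (simp add: linear_iff)
  qed
  ultimately have "sharp_projection G c \<rho> csh (dir_deriv (\<lambda>t. \<sigma> (?l t)) 0 1) = \<xi>"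
    by (rule has_dir_deriv_unique)
  then show ?thesis
    using x 0 \<sigma>(3,4) by (intro that[of "?l -` N" "\<lambda>t. \<sigma> (?l t)"]) auto
qed

lemma sharp_projection_lift: "sharp_projection G c \<rho> csh (sharp_lift G c \<rho> csh \<xi>) = \<xi>"
proof -
  obtain x :: "real \<Rightarrow> 'f" where "sharp_projection G c \<rho> csh (dir_deriv x 0 1) = \<xi>" by (rule curve_lift)
  then show ?thesis unfolding sharp_lift_def by (rule someI)
qed

text \<open>
  The component of \<open>d\<rho>(\<zeta>)\<psi>\<close> orthogonal to the unit vector \<open>\<psi>\<close>: the velocity of the ray of \<open>\<psi>\<close> in the
  chart centred there.
\<close>
definition horizontal :: "'h \<Rightarrow> 'f \<Rightarrow> 'h" where
  "horizontal \<psi> \<zeta> = drep \<zeta> \<psi> + cscale (- cinner \<psi> (drep \<zeta> \<psi>)) \<psi>"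

lemma has_dir_deriv_orbit_chart:
  assumes \<psi>: "\<psi> \<in> Sm" "norm \<psi> = 1"
  shows "has_dir_deriv (\<lambda>x. proj_chart \<psi> (ray (snd (chart_inv csh x) \<psi>))) origin \<zeta> (horizontal \<psi> \<zeta>)"
proof -
  have 1: "cinner \<psi> \<psi> = 1" using \<psi>(2) by (simp add: cinner_self)
  note o = has_dir_deriv_orbit[OF \<psi>(1), of \<zeta>]
  have "has_dir_deriv (\<lambda>x. inverse (cinner \<psi> (snd (chart_inv csh x) \<psi>))) origin \<zeta> (- cinner \<psi> (drep \<zeta> \<psi>))"
    using has_dir_deriv_inverse[OF has_dir_deriv_bounded_linear[OF cinner.bounded_linear_right o, of \<psi>]]
    by (simp add: chart_inv_origin rep_one 1)
  from has_dir_deriv_add[OF has_dir_deriv_bounded_bilinear[OF bounded_bilinear_cscale this o]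
      has_dir_deriv_const[of "- \<psi>"]]
  show ?thesis by (simp add: proj_chart_ray horizontal_def chart_inv_origin rep_one 1)
qed

text \<open>
  The orbit map of a smooth ray is smooth in the charts of \<open>G\<close> and its pull-back to the extension is
  the ray of the orbit map of \<open>\<psi>\<close>, so \<open>horizontal \<psi> \<zeta>\<close> depends on the projection of \<open>\<zeta>\<close> only.
\<close>
lemma horizontal_eq_orbit_deriv:
  assumes \<psi>: "\<psi> \<in> Sm" "norm \<psi> = 1"
  shows "horizontal \<psi> \<zeta> =
    dir_deriv (\<lambda>y. proj_chart \<psi> (pu_act (\<rho> (chart_inv c y)) (ray \<psi>))) one_G (sharp_projection G c \<rho> csh \<zeta>)"
proof -
  let ?P = "\<lambda>y. proj_chart \<psi> (pu_act (\<rho> (chart_inv c y)) (ray \<psi>))"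
  let ?W = "snd c ` (fst c \<inter> (\<lambda>g. pu_act (\<rho> g) (ray \<psi>)) -` proj_chart_dom \<psi>)"
  have 1: "cinner \<psi> \<psi> = 1" "\<psi> \<noteq> 0" using \<psi>(2) by (auto simp: cinner_self)
  have "ray \<psi> \<in> proj_smooth_rays G A \<rho>"
    using sharp \<psi>(1) 1(2) by (auto simp: sharp_lie_group_def smooth_vectors_eq proj_def)
  then have sm: "mb_smooth_on ?W ?P"
    using c(1) \<psi>(2) by (auto simp: proj_smooth_rays_def smooth_to_proj_def comp_def)
  have "pu_act (\<rho> \<one>\<^bsub>G\<^esub>) (ray \<psi>) = ray \<psi>"
    using pu_act_sharp[OF one_closed, of \<psi>] by (simp add: one_sharp_group)
  moreover have "ray \<psi> \<in> proj_chart_dom \<psi>" using 1(1) by (auto simp: proj_chart_dom_def)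
  ultimately have W: "one_G \<in> ?W" using c by auto
  have "has_dir_deriv (\<lambda>x. ?P (snd c (fst (chart_inv csh x)))) origin \<zeta>
      (dir_deriv ?P one_G (sharp_projection G c \<rho> csh \<zeta>))"
    using C1_on_chain[OF C1_on_smooth[OF sm] _ has_dir_deriv_projection] W by (simp only: projection_origin)
  moreover have "has_dir_deriv (\<lambda>x. ?P (snd c (fst (chart_inv csh x)))) origin \<zeta> (horizontal \<psi> \<zeta>)"
  proof (rule iffD2[OF has_dir_deriv_cong[OF mb_smooth_on_open[OF projection_smooth] origin_in_projection_dom]
        has_dir_deriv_orbit_chart[OF \<psi>]])
    fix x assume x: "x \<in> {x \<in> dom csh. fst (chart_inv csh x) \<in> fst c}"
    then have "chart_inv csh x \<in> carrier (sharp_group G \<rho>)" using chart_inv_carrier[OF csh(1)] by blast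
    then show "?P (snd c (fst (chart_inv csh x))) = proj_chart \<psi> (ray (snd (chart_inv csh x) \<psi>))"
      using x inj_c by (simp add: inv_into_f_f pu_act_sharp)
  qed
  ultimately show ?thesis using has_dir_deriv_unique by blast
qed

section \<open>The strong topology and the fundamental vector fields\<close>

lemma openin_strong_topology:
  "openin (strong_topology G \<rho> Ash csh) W \<longleftrightarrow> W \<subseteq> Sm \<and>
    (\<forall>\<psi>\<in>W. \<exists>F \<epsilon>. finite F \<and> (\<forall>(k, B)\<in>F. bounded_in_power k B) \<and> \<epsilon> > 0 \<and>
      (\<forall>\<phi>\<in>Sm. (\<forall>(k, B)\<in>F. strong_seminorm G \<rho> csh k B (\<phi> - \<psi>) < \<epsilon>) \<longrightarrow> \<phi> \<in> W))"
proof -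
  let ?Q = "\<lambda>W \<psi> F \<epsilon>. finite F \<and> (\<forall>(k, B)\<in>F. bounded_in_power k B) \<and> \<epsilon> > 0 \<and>
      (\<forall>\<phi>\<in>Sm. (\<forall>(k, B)\<in>F. strong_seminorm G \<rho> csh k B (\<phi> - \<psi>) < \<epsilon>) \<longrightarrow> \<phi> \<in> W)"
  have "istopology (\<lambda>W. W \<subseteq> Sm \<and> (\<forall>\<psi>\<in>W. \<exists>F \<epsilon>. ?Q W \<psi> F \<epsilon>))"
    unfolding istopology_def
  proof (intro conjI allI impI)
    fix W W' assume W: "W \<subseteq> Sm \<and> (\<forall>\<psi>\<in>W. \<exists>F \<epsilon>. ?Q W \<psi> F \<epsilon>)" "W' \<subseteq> Sm \<and> (\<forall>\<psi>\<in>W'. \<exists>F \<epsilon>. ?Q W' \<psi> F \<epsilon>)"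
    show "W \<inter> W' \<subseteq> Sm" using W by auto
    show "\<forall>\<psi>\<in>W \<inter> W'. \<exists>F \<epsilon>. ?Q (W \<inter> W') \<psi> F \<epsilon>"
    proof
      fix \<psi> assume "\<psi> \<in> W \<inter> W'"
      then obtain F \<epsilon> F' \<epsilon>' where "?Q W \<psi> F \<epsilon>" "?Q W' \<psi> F' \<epsilon>'" using W by blast
      then show "\<exists>F \<epsilon>. ?Q (W \<inter> W') \<psi> F \<epsilon>"
        by (intro exI[of _ "F \<union> F'"] exI[of _ "min \<epsilon> \<epsilon>'"]) (auto simp: case_prod_unfold)
    qed
  next
    fix K assume K: "\<forall>W\<in>K. W \<subseteq> Sm \<and> (\<forall>\<psi>\<in>W. \<exists>F \<epsilon>. ?Q W \<psi> F \<epsilon>)"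
    then show "\<Union>K \<subseteq> Sm" by auto
    show "\<forall>\<psi>\<in>\<Union>K. \<exists>F \<epsilon>. ?Q (\<Union>K) \<psi> F \<epsilon>"
    proof
      fix \<psi> assume "\<psi> \<in> \<Union>K"
      then obtain W where W: "W \<in> K" "\<psi> \<in> W" by blast
      from bspec[OF conjunct2[OF bspec[OF K W(1)]] W(2)]
      show "\<exists>F \<epsilon>. ?Q (\<Union>K) \<psi> F \<epsilon>"
        by (elim ex_forward) (use W(1) in auto)
    qed
  qed
  then show ?thesis
    by (simp add: strong_topology_def smooth_vectors_eq)
qed

lemma topspace_strong_topology: "topspace (strong_topology G \<rho> Ash csh) = Sm"
proof -
  have "openin (strong_topology G \<rho> Ash csh) Sm"
    unfolding openin_strong_topology by (auto intro!: exI[of _ "{}"] exI[of _ 1])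
  moreover have "W \<subseteq> Sm" if "openin (strong_topology G \<rho> Ash csh) W" for W
    using that openin_strong_topology by blast
  ultimately show ?thesis using openin_subset openin_topspace by (metis subset_antisym)
qed

lemma strong_seminorm_0: "strong_seminorm G \<rho> csh 0 {\<lambda>_. 0} \<phi> = ennreal (norm \<phi>)"
  by (simp add: strong_seminorm_def)

lemma bounded_zero: "bounded_in_power 0 {\<lambda>_. 0 :: 'f}"
  unfolding bounded_in_power_def by (auto intro!: exI[of _ 1])

lemma limitin_tangent_imp_tendsto:
  assumes lim: "limitin (proj_tangent_topology G \<rho> Ash csh r) q v F"
  shows "(q \<longlongrightarrow> v) F"
proof (rule tendstoI)
  fix \<epsilon> :: real assume \<epsilon>: "\<epsilon> > 0"
  let ?T = "{v. cinner (unit_rep r) v = 0}"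
  let ?W = "{\<phi> \<in> Sm. dist \<phi> v < \<epsilon>}"
  have v: "v \<in> Sm \<inter> ?T"
    using lim by (simp add: limitin_def proj_tangent_topology_def topspace_strong_topology)
  have "openin (strong_topology G \<rho> Ash csh) ?W"
    unfolding openin_strong_topology
  proof (intro conjI ballI)
    fix \<psi> assume \<psi>: "\<psi> \<in> ?W"
    let ?e = "\<epsilon> - dist \<psi> v"
    have "\<phi> \<in> ?W" if "\<phi> \<in> Sm" "ennreal (norm (\<phi> - \<psi>)) < ennreal ?e" for \<phi>
    proof -
      have "dist \<phi> \<psi> < ?e" using that(2) by (simp add: dist_norm ennreal_less_iff)
      then show ?thesis using that(1) dist_triangle[of \<phi> v \<psi>] by simp
    qed
    then show "\<exists>F \<epsilon>'. finite F \<and> (\<forall>(k, B)\<in>F. bounded_in_power k B) \<and> \<epsilon>' > 0 \<and>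
      (\<forall>\<phi>\<in>Sm. (\<forall>(k, B)\<in>F. strong_seminorm G \<rho> csh k B (\<phi> - \<psi>) < \<epsilon>') \<longrightarrow> \<phi> \<in> ?W)"
      using \<psi> bounded_zero
      by (intro exI[of _ "{(0, {\<lambda>_. 0})}"] exI[of _ "ennreal ?e"]) (auto simp: strong_seminorm_0)
  qed auto
  then have "openin (proj_tangent_topology G \<rho> Ash csh r) (?W \<inter> ?T)"
    unfolding proj_tangent_topology_def by (rule openin_subtopology_Int)
  moreover have "v \<in> ?W \<inter> ?T" using v \<epsilon> by simp
  ultimately have "\<forall>\<^sub>F t in F. q t \<in> ?W \<inter> ?T" using lim unfolding limitin_def by blast
  then show "\<forall>\<^sub>F t in F. dist (q t) v < \<epsilon>" by (rule eventually_mono) simp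
qed

lemma limitin_tangentI:
  assumes v: "v \<in> Sm" "cinner (unit_rep r) v = 0"
    and q: "\<forall>\<^sub>F t in F. q t \<in> Sm \<and> cinner (unit_rep r) (q t) = 0"
    and lim: "\<And>k n B \<epsilon>. bounded_in_power n B \<Longrightarrow> \<epsilon> > 0 \<Longrightarrow>
      \<forall>\<^sub>F t in F. \<forall>w\<in>B. norm (drep_iter k w (q t - v)) \<le> \<epsilon>"
  shows "limitin (proj_tangent_topology G \<rho> Ash csh r) q v F"
  unfolding limitin_def
proof (intro conjI allI impI)
  let ?T = "{v. cinner (unit_rep r) v = 0}"
  show "v \<in> topspace (proj_tangent_topology G \<rho> Ash csh r)"
    using v by (simp add: proj_tangent_topology_def topspace_strong_topology)
  fix U assume U: "openin (proj_tangent_topology G \<rho> Ash csh r) U \<and> v \<in> U"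
  then obtain W where W: "openin (strong_topology G \<rho> Ash csh) W" "U = W \<inter> ?T"
    by (auto simp: proj_tangent_topology_def openin_subtopology)
  then have "v \<in> W" using U by blast
  from bspec[OF conjunct2[OF iffD1[OF openin_strong_topology W(1)]] this]
  obtain D \<epsilon> where D: "finite D" "\<forall>(k, B)\<in>D. bounded_in_power k B" "\<epsilon> > 0"
    "\<forall>\<phi>\<in>Sm. (\<forall>(k, B)\<in>D. strong_seminorm G \<rho> csh k B (\<phi> - v) < \<epsilon>) \<longrightarrow> \<phi> \<in> W"
    by (elim exE conjE) (rule that)
  obtain e where e: "0 < e" "e < \<epsilon>" using dense[OF D(3)] by blast
  then obtain e' where e': "e = ennreal e'" "e' > 0"
    by (cases e) (auto simp: ennreal_less_iff top_unique less_top[symmetric])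
  have "\<forall>\<^sub>F t in F. strong_seminorm G \<rho> csh (fst p) (snd p) (q t - v) < \<epsilon>" if "p \<in> D" for p
  proof -
    have "bounded_in_power (fst p) (snd p)" using D(2) that by auto
    from lim[OF this e'(2), of "fst p"] show ?thesis
    proof eventually_elim
      case (elim t)
      then have "strong_seminorm G \<rho> csh (fst p) (snd p) (q t - v) \<le> e"
        unfolding strong_seminorm_def e'(1) derived_rep_iter_eq by (intro SUP_least ennreal_leI) auto
      then show ?case using e(2) by (rule le_less_trans)
    qed
  qed
  then have "\<forall>\<^sub>F t in F. \<forall>p\<in>D. strong_seminorm G \<rho> csh (fst p) (snd p) (q t - v) < \<epsilon>"
    using D(1) by (simp add: eventually_ball_finite)
  with q show "\<forall>\<^sub>F t in F. q t \<in> U"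
  proof eventually_elim
    case (elim t)
    then have "q t \<in> W" using bspec[OF D(4), of "q t"] by (simp add: case_prod_unfold)
    then show ?case using elim W(2) by blast
  qed
qed

text \<open>
  Along a lifted curve through \<open>\<one>\<close> the chart value of the moving ray is \<open>s(t) U\<^sub>t \<psi> - \<psi>\<close> with
  \<open>s(t) = 1 / \<langle>\<psi>, U\<^sub>t \<psi>\<rangle>\<close>, whose difference quotients converge in all seminorms of the strong topology.
  The lift with velocity \<open>\<zeta>\<close> may be replaced by the one obtained from the bundle, as both have the
  same horizontal part.
\<close>
lemma fundamental_field_eq:
  assumes \<psi>: "\<psi> \<in> Sm" "norm \<psi> = 1" and r: "r = ray \<psi>" "unit_rep r = \<psi>"
    and \<zeta>: "sharp_projection G c \<rho> csh \<zeta> = \<xi>"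
  shows "fundamental_field G c \<rho> Ash csh \<xi> r = horizontal \<psi> \<zeta>"
proof -
  obtain x I where x: "mb_smooth_on I x" "(0::real) \<in> I" "x 0 = origin"
    and proj: "sharp_projection G c \<rho> csh (dir_deriv x 0 1) = \<xi>"
    and lifts: "\<forall>t\<in>I. x t \<in> dom csh \<and> fst (chart_inv csh (x t)) = chart_inv c (one_G + t *\<^sub>R \<xi>)"
    by (rule curve_lift)
  note lift = bspec[OF lifts]
  define f where "f = (\<lambda>t. snd (chart_inv csh (x t)) \<psi>)"
  define s where "s = (\<lambda>t. inverse (cinner \<psi> (f t)))"
  let ?\<zeta> = "dir_deriv x 0 1"
  let ?q = "\<lambda>t. (1 / t) *\<^sub>R (proj_chart (unit_rep r) (pu_act (\<rho> (chart_inv c (one_G + t *\<^sub>R \<xi>))) r)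
    - proj_chart (unit_rep r) r)"
  obtain N where N: "\<And>p. p \<in> N \<Longrightarrow> fst p \<in> dom csh \<and> f (snd p) \<in> Sm" "(origin, 0) \<in> N"
    "mb_smooth_on N (\<lambda>p. snd (chart_inv csh (fst p)) (f (snd p)))"
    "has_dir_deriv f 0 1 (drep ?\<zeta> \<psi>)"
    using orbit_curve[OF \<psi>(1) x] unfolding f_def by blast
  have 1: "cinner \<psi> \<psi> = 1" using \<psi>(2) by (simp add: cinner_self)
  have f0: "f 0 = \<psi>" by (simp add: f_def x(3) chart_inv_origin rep_one)
  have s0: "s 0 = 1" by (simp add: s_def f0 1)
  have s': "has_dir_deriv s 0 1 (- cinner \<psi> (drep ?\<zeta> \<psi>))"
    using has_dir_deriv_inverse[OF has_dir_deriv_bounded_linear[OF cinner.bounded_linear_right N(4), of \<psi>]]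
    by (simp add: s_def f0 1)
  have q: "?q t = (1 / t) *\<^sub>R (cscale (s t) (f t) - f 0)" if "t \<in> I" for t
  proof -
    have "pu_act (\<rho> (chart_inv c (one_G + t *\<^sub>R \<xi>))) r = ray (f t)"
      using pu_act_sharp[of "chart_inv csh (x t)" \<psi>] lift[OF that] chart_inv_carrier[OF csh(1)]
      by (auto simp: r(1) f_def)
    then show ?thesis by (simp add: proj_chart_ray r(2) s_def f0) (simp add: r(1) proj_chart_ray 1)
  qed
  have evI: "\<forall>\<^sub>F t in at 0. t \<in> I"
    using topological_tendstoD[OF tendsto_ident_at mb_smooth_on_open[OF x(1)] x(2)] .
  have hor: "horizontal \<psi> ?\<zeta> = drep ?\<zeta> \<psi> + cscale (- cinner \<psi> (drep ?\<zeta> \<psi>)) (f 0)"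
    by (simp add: horizontal_def f0)
  have strong: "limitin (proj_tangent_topology G \<rho> Ash csh r) ?q (horizontal \<psi> ?\<zeta>) (at 0)"
  proof (rule limitin_tangentI)
    show "horizontal \<psi> ?\<zeta> \<in> Sm"
      unfolding horizontal_def by (intro smooth_space_add smooth_space_cscale drep_smooth_space \<psi>)
    show "cinner (unit_rep r) (horizontal \<psi> ?\<zeta>) = 0"
      by (simp add: r(2) horizontal_def cinner_add_right cinner_cscale_right 1)
    have "((\<lambda>t. cinner \<psi> (f (0 + t *\<^sub>R 1))) \<longlongrightarrow> cinner \<psi> (f 0)) (at 0)"
      by (rule has_dir_deriv_imp_tendsto[OF has_dir_deriv_bounded_linear[OF cinner.bounded_linear_right N(4)]])
    then have "\<forall>\<^sub>F t in at 0. cinner \<psi> (f t) \<noteq> 0"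
      using tendsto_imp_eventually_ne[of _ "cinner \<psi> (f 0)" _ 0] by (simp add: f0 1)
    with evI show "\<forall>\<^sub>F t in at 0. ?q t \<in> Sm \<and> cinner (unit_rep r) (?q t) = 0"
    proof eventually_elim
      case (elim t)
      have "f t \<in> Sm"
        using rep_smooth_space[OF \<psi>(1) chart_inv_carrier[OF csh(1)]] lift[OF elim(1)] by (simp add: f_def)
      then have "?q t \<in> Sm"
        unfolding q[OF elim(1)] f0 by (intro smooth_space_scaleR smooth_space_diff smooth_space_cscale \<psi>)
      moreover have "cinner \<psi> (?q t) = 0"
        unfolding q[OF elim(1)] f0 using elim(2)
        by (simp add: cinner.scaleR_right cinner.diff_right cinner_cscale_right s_def 1)
      ultimately show ?case by (simp only: r(2))
    qed
    fix k n and B :: "(nat \<Rightarrow> 'f) set" and \<epsilon> :: real assume B: "bounded_in_power n B" "\<epsilon> > 0"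
    have "\<forall>\<^sub>F t in at 0. \<forall>w\<in>B.
        norm (drep_iter k w ((1 / t) *\<^sub>R (cscale (s t) (f t) - f 0) - horizontal \<psi> ?\<zeta>)) \<le> \<epsilon>"
      unfolding hor
      by (rule drep_iter_difference_quotient[where N = N, OF _ N(2-4) drep_smooth_space[OF \<psi>(1)] s' s0 B])
        (rule N(1))
    with evI
    show "\<forall>\<^sub>F t in at 0. \<forall>w\<in>B. norm (drep_iter k w (?q t - horizontal \<psi> ?\<zeta>)) \<le> \<epsilon>"
      by eventually_elim (simp only: q)
  qed
  have "fundamental_field G c \<rho> Ash csh \<xi> r = horizontal \<psi> ?\<zeta>"
    unfolding fundamental_field_def
  proof (rule the_equality, rule strong)
    fix v assume "limitin (proj_tangent_topology G \<rho> Ash csh r) ?q v (at 0)"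
    from tendsto_unique[OF _ limitin_tangent_imp_tendsto[OF this] limitin_tangent_imp_tendsto[OF strong]]
    show "v = horizontal \<psi> ?\<zeta>" by simp
  qed
  also have "\<dots> = horizontal \<psi> \<zeta>"
    by (simp only: horizontal_eq_orbit_deriv[OF \<psi>] proj \<zeta>)
  finally show ?thesis .
qed

text \<open>
  The scalar products \<open>\<langle>\<psi>, d\<rho>(\<zeta>)\<psi>\<rangle>\<close> are imaginary, so the removed components contribute a real number.
\<close>
lemma cinner_horizontal:
  assumes \<psi>: "\<psi> \<in> Sm" "norm \<psi> = 1"
  shows "Im (cinner (horizontal \<psi> \<zeta>) (horizontal \<psi> \<eta>)) = Im (cinner (drep \<zeta> \<psi>) (drep \<eta> \<psi>))"
proof -
  have 1: "cinner \<psi> \<psi> = 1" using \<psi>(2) by (simp add: cinner_self)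
  have im: "Re (cinner \<psi> (drep \<xi> \<psi>)) = 0" "cinner (drep \<xi> \<psi>) \<psi> = - cinner \<psi> (drep \<xi> \<psi>)" for \<xi>
  proof -
    from drep_skew[OF \<psi>(1,1), of \<xi>]
    show *: "cinner (drep \<xi> \<psi>) \<psi> = - cinner \<psi> (drep \<xi> \<psi>)" by (simp add: eq_neg_iff_add_eq_0 add.commute)
    show "Re (cinner \<psi> (drep \<xi> \<psi>)) = 0"
      using arg_cong[OF *, of Re] arg_cong[OF cinner_commute[of "drep \<xi> \<psi>" \<psi>], of Re] by simp
  qed
  show ?thesis
    unfolding horizontal_def
    by (simp add: cinner_add_left cinner_add_right cinner_cscale_left cinner_cscale_right 1 im)
qed

text \<open>
  Skew-symmetry gives \<open>\<langle>\<psi>, [d\<rho>(\<zeta>), d\<rho>(\<eta>)]\<psi>\<rangle> = - 2\<i> Im \<langle>d\<rho>(\<zeta>)\<psi>, d\<rho>(\<eta>)\<psi>\<rangle>\<close>. The momentum map is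
  evaluated at an arbitrary vector of the ray; the normalization makes the choice irrelevant.
\<close>
lemma momentum_bracket:
  assumes \<psi>: "\<psi> \<in> Sm" "norm \<psi> = 1"
  shows "momentum G \<rho> csh (ray \<psi>) (lie_bracket (sharp_group G \<rho>) csh \<zeta> \<eta>) =
    2 * Im (cinner (drep \<zeta> \<psi>) (drep \<eta> \<psi>))"
proof -
  let ?Z = "lie_bracket (sharp_group G \<rho>) csh \<zeta> \<eta>"
  let ?w = "cinner (drep \<zeta> \<psi>) (drep \<eta> \<psi>)"
  have "(SOME \<phi>. \<phi> \<in> ray \<psi>) \<in> ray \<psi>" using ray_self by (rule someI)
  then obtain a where a: "(SOME \<phi>. \<phi> \<in> ray \<psi>) = cscale a \<psi>" "a \<noteq> 0" by (auto simp: ray_def)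
  have "cinner \<psi> \<psi> = 1" using \<psi>(2) by (simp add: cinner_self)
  then have "momentum G \<rho> csh (ray \<psi>) ?Z = Re (cinner \<psi> (cscale \<i> (drep ?Z \<psi>)))"
    using a(2) by (simp add: momentum_def Let_def a(1) derived_rep_eq drep_cscale[OF \<psi>(1)]
        cinner_cscale_left cinner_cscale_right)
  also have "cinner \<psi> (drep ?Z \<psi>) = cnj ?w - ?w"
    using drep_skew[OF \<psi>(1) drep_smooth_space[OF \<psi>(1)], of \<zeta> \<eta>]
      drep_skew[OF \<psi>(1) drep_smooth_space[OF \<psi>(1)], of \<eta> \<zeta>]
    by (simp add: drep_lie_bracket[OF \<psi>(1)] cinner.diff_right cinner_commute[of "drep \<eta> \<psi>"]
        add_eq_0_iff)
  then have "cinner \<psi> (cscale \<i> (drep ?Z \<psi>)) = \<i> * (cnj ?w - ?w)" by (simp add: cinner_cscale_right)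
  finally show ?thesis by simp
qed

end

section \<open>The Kostant-Souriau cocycle is the differential of the momentum map\<close>

theorem proposition4p2:
  fixes G :: "('g, 'b) monoid_scheme"
    and A :: "('g, 'e::locally_convex_space) chart set"
    and \<rho> :: "'g \<Rightarrow> ('h::complex_hilbert_space \<Rightarrow> 'h) set"
    and Ash :: "('g \<times> ('h \<Rightarrow> 'h), 'f::locally_convex_space) chart set"
    and c :: "('g, 'e) chart"
    and csh :: "('g \<times> ('h \<Rightarrow> 'h), 'f) chart"
    and r :: "'h set"
  assumes "lc_lie_group G A"
    and "smooth_projective_rep G A \<rho>"
    and "sharp_lie_group G A \<rho> Ash"
    and "c \<in> A" and "\<one>\<^bsub>G\<^esub> \<in> fst c"
    and "csh \<in> Ash" and "\<one>\<^bsub>sharp_group G \<rho>\<^esub> \<in> fst csh"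
    and "r \<in> proj (smooth_vectors G \<rho> Ash)"
  shows "kostant_souriau G c \<rho> Ash csh r = delta G c \<rho> csh (momentum G \<rho> csh r)"
proof (intro ext)
  fix \<xi> \<eta>
  interpret projective_rep G A \<rho> Ash c csh
    using assms(1,3-7) by (rule projective_rep.intro)
  obtain \<phi> where \<phi>: "\<phi> \<in> Sm" "\<phi> \<noteq> 0" "r = ray \<phi>"
    using assms(8) by (auto simp: proj_def smooth_vectors_eq)
  define \<psi> where "\<psi> = unit_rep r"
  have "\<psi> \<in> ray \<phi>" and norm: "norm \<psi> = 1"
    using unit_rep_ray[OF \<phi>(2)] by (simp_all add: \<psi>_def \<phi>(3))
  then have \<psi>: "\<psi> \<in> Sm" and r: "r = ray \<psi>"
    using smooth_space_cscale[OF \<phi>(1)] ray_eq_of_mem[of \<psi> \<phi>] \<phi>(3) by (auto simp: ray_def[of \<phi>])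
  have field: "fundamental_field G c \<rho> Ash csh \<xi> r = horizontal \<psi> (sharp_lift G c \<rho> csh \<xi>)" for \<xi>
    by (rule fundamental_field_eq[OF \<psi> norm r \<psi>_def[symmetric] sharp_projection_lift])
  show "kostant_souriau G c \<rho> Ash csh r \<xi> \<eta> = delta G c \<rho> csh (momentum G \<rho> csh r) \<xi> \<eta>"
    unfolding kostant_souriau_def symplectic_form_def delta_def field cinner_horizontal[OF \<psi> norm]
    by (simp only: r momentum_bracket[OF \<psi> norm])
qed

end
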